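(* Let $\sigma$ be a connected skew Young diagram whose topmost row is row $1$. Then $$RG_\sigma(\mathbf{x};\mathbf{w}) \;=\; \sum_{(\mu,\mathbf{e})} (-1)^{|B(\mu/\sigma)|}\, a_{\sigma,\mu,\mathbf{e}}\, s_\mu(\mathbf{x})\,\mathbf{w}^{\mathbf{e}},$$ where the sum is over all skew shapes $\mu\supseteq\sigma$ (containment convention below) and all eventually-zero nonnegative integer sequences $\mathbf{e}=(e_1,e_2,\ldots)$, and $a_{\sigma,\mu,\mathbf{e}}$ is the (nonnegative) number of pairs $(T',T'')$ such that $T'$ is a row-weakly-bounded semistandard tableau on $A(\mu/\sigma)$, $T''$ is a reverse row-strict, row-bounded tableau on $B(\mu/\sigma)$, and $c(T')+c(T'')=\mathbf{e}$.
   Context: Boxes are pairs $(i,j)$ of positive integers, $i$ the row index (increasing downward), $j$ the column index (increasing to the right); $(i,j)\preceq(i',j')$ iff $i\le i'$, $j\le j'$. A skew Young diagram (skew shape) is a finite set of boxes closed under intervals ($a,c\in\sigma$, $a\preceq b\preceq c$ implies $b\in\sigma$); connected means its Hasse diagram under $\preceq$ is connected. Rows are numbered so that the top row of $\sigma$ is row 1. Containment convention: $\mu\supseteq\sigma$ means every box of $\sigma$ is in $\mu$ and every box of $\mu$ is in the same column as some box of $\sigma$. Then $\mu\setminus\sigma$ splits into $A(\mu/\sigma)$ (boxes above boxes of $\sigma$ in their column) and $B(\mu/\sigma)$ (boxes below). A tableau assigns a positive integer to each box; semistandard: rows weakly increasing left to right, columns strictly increasing top to bottom; reverse row-strict: rows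 strictly decreasing left to right, columns weakly decreasing top to bottom; row-bounded: $T(i,j)<i$ for each box $(i,j)$; row-weakly-bounded: $T(i,j)\le i$. Content $c(T)=(c_1,c_2,\dots)$ with $c_i$ the number of occurrences of label $i$; $\mathbf{x}^c=\prod x_i^{c_i}$, $\mathbf{w}^{\mathbf{e}}=\prod w_i^{e_i}$. A set-valued tableau assigns a nonempty finite set of positive integers to each box; with $S\le T$ meaning $\max S\le \min T$ and $S<T$ meaning $\max S<\min T$, it is semistandard if rows weakly increase and columns strictly increase. $\mathrm{SS}(\sigma)$ is the set of semistandard set-valued tableaux of shape $\sigma$. The excess $e(T)=(e_1,e_2,\dots)$ has $e_i$ = (number of labels in row $i$) minus (number of boxes in row $i$); $|e(T)|=\sum e_i$. $s_\mu(\mathbf{x})=\sum_T\mathbf{x}^{c(T)}$ over semistandard tableaux of shape $\mu$. The row-refined skew stable Grothendieck polynomial is $RG_\sigma(\mathbf{x};\mathbf{w})=\sum_{T\in\mathrm{SS}(\sigma)}(-1)^{|e(T)|}\mathbf{x}^{c(T)}\mathbf{w}^{e(T)}$. *)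

theory Defs
  imports
    "HOL-Analysis.Infinite_Sum"
    "HOL-Library.Poly_Mapping"
    "HOL-Library.Product_Order"
    "HOL-Library.FuncSet"
begin

section \<open>Formal power series in arbitrarily many variables\<close>

text \<open>
  Exponent vectors are finitely supported functions from the variables to the natural numbers;
  a power series is an arbitrary family of integer coefficients indexed by them.
\<close>

typedef 'v mfps = "UNIV :: (('v \<Rightarrow>\<^sub>0 nat) \<Rightarrow> int) set"
  morphisms coeff Abs_mfps ..

lemma coeff_Abs_mfps [simp]: "coeff (Abs_mfps f) = f"
  by (simp add: Abs_mfps_inverse)

lemma mfps_eqI: "(\<And>m. coeff f m = coeff g m) \<Longrightarrow> f = g"
  by (metis coeff_inject ext)

definition decomps :: "('v \<Rightarrow>\<^sub>0 nat) \<Rightarrow> (('v \<Rightarrow>\<^sub>0 nat) \<times> ('v \<Rightarrow>\<^sub>0 nat)) set" where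
  "decomps m = {(a, b). a + b = m}"

instantiation mfps :: (type) "{zero, one, plus, minus, uminus, times}"
begin
definition "0 = Abs_mfps (\<lambda>_. 0)"
definition "1 = Abs_mfps (\<lambda>m. if m = 0 then 1 else 0)"
definition "f + g = Abs_mfps (\<lambda>m. coeff f m + coeff g m)"
definition "f - g = Abs_mfps (\<lambda>m. coeff f m - coeff g m)"
definition "- f = Abs_mfps (\<lambda>m. - coeff f m)"
definition "f * g = Abs_mfps (\<lambda>m. \<Sum>(a, b)\<in>decomps m. coeff f a * coeff g b)"
instance ..
end

lemma coeff_simps [simp]:
  "coeff 0 m = 0"
  "coeff 1 m = (if m = 0 then 1 else 0)"
  "coeff (f + g) m = coeff f m + coeff g m"
  "coeff (f - g) m = coeff f m - coeff g m"
  "coeff (- f) m = - coeff f m"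
  by (simp_all add: zero_mfps_def one_mfps_def plus_mfps_def minus_mfps_def uminus_mfps_def)

lemma coeff_mult: "coeff (f * g) m = (\<Sum>(a, b)\<in>decomps m. coeff f a * coeff g b)"
  by (simp add: times_mfps_def)

lemma finite_decomps [simp]:
  fixes m :: "'a \<Rightarrow>\<^sub>0 nat"
  shows "finite (decomps m)"
proof -
  let ?N = "Max (insert 0 (Poly_Mapping.lookup m ` Poly_Mapping.keys m))"
  let ?F = "{f :: 'a \<Rightarrow> nat. \<forall>x. (x \<in> Poly_Mapping.keys m \<longrightarrow> f x \<in> {..?N}) \<and> (x \<notin> Poly_Mapping.keys m \<longrightarrow> f x = 0)}"
  have le: "Poly_Mapping.lookup a x \<le> Poly_Mapping.lookup m x" if "a + b = m" for a b x
    using that by (auto simp: lookup_add)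
  have "Poly_Mapping.lookup ` fst ` decomps m \<subseteq> ?F"
  proof (safe; clarsimp simp: decomps_def)
    fix a b :: "'a \<Rightarrow>\<^sub>0 nat" and x
    assume m: "m = a + b" and "x \<in> Poly_Mapping.keys (a + b)"
    have "Poly_Mapping.lookup a x \<le> Poly_Mapping.lookup m x" using le[of a b x] m by simp
    also have "Poly_Mapping.lookup m x \<le> ?N"
      using \<open>x \<in> Poly_Mapping.keys (a + b)\<close> m by (intro Max_ge) auto
    finally show "Poly_Mapping.lookup a x \<le> Max (insert 0 (Poly_Mapping.lookup (a + b) ` Poly_Mapping.keys (a + b)))"
      using m by simp
  next
    fix a b :: "'a \<Rightarrow>\<^sub>0 nat" and x
    assume "x \<notin> Poly_Mapping.keys (a + b)"
    then show "Poly_Mapping.lookup a x = 0" by (simp add: in_keys_iff lookup_add)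
  qed
  moreover have "finite ?F"
    by (rule finite_set_of_finite_funs) auto
  ultimately have "finite (Poly_Mapping.lookup ` fst ` decomps m)"
    by (rule finite_subset)
  then have "finite (fst ` decomps m)"
    by (rule finite_imageD) (auto simp: inj_on_def lookup_inject)
  moreover have "decomps m \<subseteq> (\<lambda>a. (a, m - a)) ` fst ` decomps m"
    by (force simp: decomps_def)
  ultimately show ?thesis
    by (meson finite_imageI finite_subset)
qed

instance mfps :: (type) comm_ring_1
proof
  fix f g h :: "'a mfps"
  show "f * g = g * f"
  proof (rule mfps_eqI)
    fix m :: "'a \<Rightarrow>\<^sub>0 nat"
    show "coeff (f * g) m = coeff (g * f) m"
      unfolding coeff_mult
      by (rule sum.reindex_bij_witness[where i = prod.swap and j = prod.swap])
         (auto simp: decomps_def ac_simps)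
  qed
  show "f * g * h = f * (g * h)"
  proof (rule mfps_eqI)
    fix m :: "'a \<Rightarrow>\<^sub>0 nat"
    have "coeff (f * g * h) m =
        (\<Sum>p\<in>decomps m. \<Sum>q\<in>decomps (fst p). coeff f (fst q) * coeff g (snd q) * coeff h (snd p))"
      by (simp add: coeff_mult sum_distrib_right case_prod_unfold)
    also have "\<dots> = (\<Sum>(p, q)\<in>Sigma (decomps m) (\<lambda>p. decomps (fst p)).
        coeff f (fst q) * coeff g (snd q) * coeff h (snd p))"
      by (rule sum.Sigma) auto
    also have "\<dots> = (\<Sum>(p, q)\<in>Sigma (decomps m) (\<lambda>p. decomps (snd p)).
        coeff f (fst p) * (coeff g (fst q) * coeff h (snd q)))"
      by (rule sum.reindex_bij_witness
          [where i = "\<lambda>(p, q). ((fst p + fst q, snd q), (fst p, fst q))"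
             and j = "\<lambda>(p, q). ((fst q, snd q + snd p), (snd q, snd p))"])
         (auto simp: decomps_def ac_simps)
    also have "\<dots> = (\<Sum>p\<in>decomps m. \<Sum>q\<in>decomps (snd p).
        coeff f (fst p) * (coeff g (fst q) * coeff h (snd q)))"
      by (rule sum.Sigma[symmetric]) auto
    also have "\<dots> = coeff (f * (g * h)) m"
      by (simp add: coeff_mult sum_distrib_left case_prod_unfold)
    finally show "coeff (f * g * h) m = coeff (f * (g * h)) m" .
  qed
  show "1 * f = f"
  proof (rule mfps_eqI)
    fix m :: "'a \<Rightarrow>\<^sub>0 nat"
    have "(0, m) \<in> decomps m"
      by (simp add: decomps_def)
    then have "coeff (1 * f) m = (\<Sum>(a, b)\<in>{(0, m)}. coeff (1 :: 'a mfps) a * coeff f b)"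
      unfolding coeff_mult
      by (intro sum.mono_neutral_right) (simp, simp, auto simp: decomps_def split: if_splits)
    also have "\<dots> = coeff f m"
      by simp
    finally show "coeff (1 * f) m = coeff f m" .
  qed
  show "(f + g) * h = f * h + g * h"
    by (rule mfps_eqI)
       (simp add: coeff_mult case_prod_unfold sum.distrib[symmetric] distrib_right)
  show "(0::'a mfps) \<noteq> 1"
  proof
    assume "(0::'a mfps) = 1"
    then have "coeff (0::'a mfps) 0 = coeff (1::'a mfps) 0" by (rule arg_cong)
    then show False by simp
  qed
qed (rule mfps_eqI, simp)+

lemma coeff_sum: "coeff (\<Sum>i\<in>A. F i) m = (\<Sum>i\<in>A. coeff (F i) m)"
  by (induction A rule: infinite_finite_induct) simp_all

text \<open>
  The topology of coefficientwise convergence, i.e. the product topology for discrete coefficients: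
  a basic neighbourhood of a series fixes finitely many of its coefficients.
\<close>

instantiation mfps :: (type) t2_space
begin
definition open_mfps :: "'a mfps set \<Rightarrow> bool" where
  "open_mfps U \<longleftrightarrow>
     (\<forall>f\<in>U. \<exists>M. finite M \<and> (\<forall>g. (\<forall>m\<in>M. coeff g m = coeff f m) \<longrightarrow> g \<in> U))"
instance
proof
  show "open (UNIV :: 'a mfps set)"
    by (auto simp: open_mfps_def)
next
  fix U V :: "'a mfps set"
  assume U: "open U" and V: "open V"
  show "open (U \<inter> V)"
    unfolding open_mfps_def
  proof
    fix f assume "f \<in> U \<inter> V"
    then have "f \<in> U" "f \<in> V" by auto
    obtain M where M: "finite M" "\<forall>g. (\<forall>m\<in>M. coeff g m = coeff f m) \<longrightarrow> g \<in> U"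
      using bspec[OF U[unfolded open_mfps_def] \<open>f \<in> U\<close>] by auto
    obtain N where N: "finite N" "\<forall>g. (\<forall>m\<in>N. coeff g m = coeff f m) \<longrightarrow> g \<in> V"
      using bspec[OF V[unfolded open_mfps_def] \<open>f \<in> V\<close>] by auto
    from M N show "\<exists>M. finite M \<and> (\<forall>g. (\<forall>m\<in>M. coeff g m = coeff f m) \<longrightarrow> g \<in> U \<inter> V)"
      by (intro exI[of _ "M \<union> N"]) auto
  qed
next
  fix K :: "'a mfps set set"
  assume "\<forall>S\<in>K. open S"
  then show "open (\<Union>K)"
    unfolding open_mfps_def by (meson Union_iff)
next
  fix f g :: "'a mfps"
  assume "f \<noteq> g"
  then obtain m where m: "coeff f m \<noteq> coeff g m"
    using mfps_eqI by blast
  have op: "open {h. coeff h m = c}" for c :: int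
    unfolding open_mfps_def by (auto intro!: exI[of _ "{m}"])
  show "\<exists>U V. open U \<and> open V \<and> f \<in> U \<and> g \<in> V \<and> U \<inter> V = {}"
    using m op by (intro exI[of _ "{h. coeff h m = coeff f m}"] exI[of _ "{h. coeff h m = coeff g m}"]) auto
qed
end

lemma tendsto_mfps_iff:
  "(F \<longlongrightarrow> l) X \<longleftrightarrow> (\<forall>m. eventually (\<lambda>x. coeff (F x) m = coeff l m) X)"
proof safe
  fix m
  assume lim: "(F \<longlongrightarrow> l) X"
  have "open {h. coeff h m = coeff l m}"
    unfolding open_mfps_def by (auto intro!: exI[of _ "{m}"])
  then show "eventually (\<lambda>x. coeff (F x) m = coeff l m) X"
    using topological_tendstoD[OF lim] by fastforce
next
  assume ev: "\<forall>m. eventually (\<lambda>x. coeff (F x) m = coeff l m) X"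
  show "(F \<longlongrightarrow> l) X"
  proof (rule topological_tendstoI)
    fix U assume "open U" "l \<in> U"
    then obtain M where M: "finite M" "\<And>g. (\<forall>m\<in>M. coeff g m = coeff l m) \<Longrightarrow> g \<in> U"
      unfolding open_mfps_def by blast
    have "eventually (\<lambda>x. \<forall>m\<in>M. coeff (F x) m = coeff l m) X"
      using ev M(1) by (simp add: eventually_ball_finite)
    then show "eventually (\<lambda>x. F x \<in> U) X"
      by (rule eventually_mono) (use M(2) in blast)
  qed
qed

lemma has_sum_mfps:
  fixes F :: "'i \<Rightarrow> 'v mfps"
  assumes fin: "\<And>m. finite {i\<in>I. coeff (F i) m \<noteq> 0}"
  shows "(F has_sum Abs_mfps (\<lambda>m. \<Sum>i | i \<in> I \<and> coeff (F i) m \<noteq> 0. coeff (F i) m)) I"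
  unfolding has_sum_def tendsto_mfps_iff
proof
  fix m
  let ?J = "{i\<in>I. coeff (F i) m \<noteq> 0}"
  have "eventually (\<lambda>A. finite A \<and> ?J \<subseteq> A \<and> A \<subseteq> I) (finite_subsets_at_top I)"
    unfolding eventually_finite_subsets_at_top
    by (intro exI[of _ ?J]) (use fin in auto)
  then show "eventually (\<lambda>A. coeff (sum F A) m =
      coeff (Abs_mfps (\<lambda>m. \<Sum>i | i \<in> I \<and> coeff (F i) m \<noteq> 0. coeff (F i) m)) m)
      (finite_subsets_at_top I)"
  proof (rule eventually_mono)
    fix A assume A: "finite A \<and> ?J \<subseteq> A \<and> A \<subseteq> I"
    show "coeff (sum F A) m =
        coeff (Abs_mfps (\<lambda>m. \<Sum>i | i \<in> I \<and> coeff (F i) m \<noteq> 0. coeff (F i) m)) m"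
      using A by (auto simp: coeff_sum intro!: sum.mono_neutral_right)
  qed
qed

definition mfps_var :: "'v \<Rightarrow> 'v mfps" where
  "mfps_var v = Abs_mfps (\<lambda>m. if m = Poly_Mapping.single v 1 then 1 else 0)"

datatype variable = X nat | W nat

definition x_power :: "(nat \<Rightarrow>\<^sub>0 nat) \<Rightarrow> variable mfps" where
  "x_power c = (\<Prod>i\<in>Poly_Mapping.keys c. mfps_var (X i) ^ Poly_Mapping.lookup c i)"

definition w_power :: "(nat \<Rightarrow>\<^sub>0 nat) \<Rightarrow> variable mfps" where
  "w_power e = (\<Prod>i\<in>Poly_Mapping.keys e. mfps_var (W i) ^ Poly_Mapping.lookup e i)"


section \<open>Skew shapes\<close>

text \<open>
  Boxes are pairs (row, column); the order on them is the componentwise order of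
  \<^theory>\<open>HOL-Library.Product_Order\<close>. All row, column and variable indices and all labels start
  from 1.
\<close>

type_synonym box = "nat \<times> nat"

definition skew_shape :: "box set \<Rightarrow> bool" where
  "skew_shape \<sigma> \<longleftrightarrow> finite \<sigma> \<and> (\<forall>(i, j)\<in>\<sigma>. 1 \<le> i \<and> 1 \<le> j) \<and>
     (\<forall>a\<in>\<sigma>. \<forall>c\<in>\<sigma>. \<forall>b. a \<le> b \<and> b \<le> c \<longrightarrow> b \<in> \<sigma>)"

definition hasse :: "box set \<Rightarrow> (box \<times> box) set" where
  "hasse \<sigma> = {(a, b). a \<in> \<sigma> \<and> b \<in> \<sigma> \<and> a < b \<and> \<not> (\<exists>c\<in>\<sigma>. a < c \<and> c < b)}"

definition connected_shape :: "box set \<Rightarrow> bool" where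
  "connected_shape \<sigma> \<longleftrightarrow> (\<forall>a\<in>\<sigma>. \<forall>b\<in>\<sigma>. (a, b) \<in> (hasse \<sigma> \<union> (hasse \<sigma>)\<inverse>)\<^sup>*)"

definition contains_shape :: "box set \<Rightarrow> box set \<Rightarrow> bool" where
  "contains_shape \<mu> \<sigma> \<longleftrightarrow> \<sigma> \<subseteq> \<mu> \<and> (\<forall>(i, j)\<in>\<mu>. \<exists>i'. (i', j) \<in> \<sigma>)"

definition above_part :: "box set \<Rightarrow> box set \<Rightarrow> box set" where
  "above_part \<mu> \<sigma> = {(i, j). (i, j) \<in> \<mu> - \<sigma> \<and> (\<exists>i'. (i', j) \<in> \<sigma> \<and> i < i')}"

definition below_part :: "box set \<Rightarrow> box set \<Rightarrow> box set" where
  "below_part \<mu> \<sigma> = {(i, j). (i, j) \<in> \<mu> - \<sigma> \<and> (\<exists>i'. (i', j) \<in> \<sigma> \<and> i' < i)}"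


section \<open>Tableaux\<close>

text \<open>Tableaux are extensional functions, so that distinct tableaux differ on some box.\<close>

definition tableaux :: "box set \<Rightarrow> (box \<Rightarrow> nat) set" where
  "tableaux \<sigma> = \<sigma> \<rightarrow>\<^sub>E {1..}"

definition semistandard_tableaux :: "box set \<Rightarrow> (box \<Rightarrow> nat) set" where
  "semistandard_tableaux \<sigma> = {T \<in> tableaux \<sigma>.
     (\<forall>i j j'. (i, j) \<in> \<sigma> \<and> (i, j') \<in> \<sigma> \<and> j < j' \<longrightarrow> T (i, j) \<le> T (i, j')) \<and>
     (\<forall>i i' j. (i, j) \<in> \<sigma> \<and> (i', j) \<in> \<sigma> \<and> i < i' \<longrightarrow> T (i, j) < T (i', j))}"

definition reverse_row_strict_tableaux :: "box set \<Rightarrow> (box \<Rightarrow> nat) set" where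
  "reverse_row_strict_tableaux \<sigma> = {T \<in> tableaux \<sigma>.
     (\<forall>i j j'. (i, j) \<in> \<sigma> \<and> (i, j') \<in> \<sigma> \<and> j < j' \<longrightarrow> T (i, j) > T (i, j')) \<and>
     (\<forall>i i' j. (i, j) \<in> \<sigma> \<and> (i', j) \<in> \<sigma> \<and> i < i' \<longrightarrow> T (i, j) \<ge> T (i', j))}"

definition row_bounded :: "box set \<Rightarrow> (box \<Rightarrow> nat) \<Rightarrow> bool" where
  "row_bounded \<sigma> T \<longleftrightarrow> (\<forall>(i, j)\<in>\<sigma>. T (i, j) < i)"

definition row_weakly_bounded :: "box set \<Rightarrow> (box \<Rightarrow> nat) \<Rightarrow> bool" where
  "row_weakly_bounded \<sigma> T \<longleftrightarrow> (\<forall>(i, j)\<in>\<sigma>. T (i, j) \<le> i)"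

definition content :: "box set \<Rightarrow> (box \<Rightarrow> nat) \<Rightarrow> (nat \<Rightarrow>\<^sub>0 nat)" where
  "content \<sigma> T = (\<Sum>b\<in>\<sigma>. Poly_Mapping.single (T b) 1)"

lemma lookup_content:
  assumes "finite \<sigma>"
  shows "Poly_Mapping.lookup (content \<sigma> T) i = card {b\<in>\<sigma>. T b = i}"
proof -
  have "Poly_Mapping.lookup (content \<sigma> T) i = (\<Sum>b\<in>\<sigma>. if T b = i then 1 else 0)"
    unfolding content_def lookup_sum by (rule sum.cong) (auto simp: lookup_single)
  also have "\<dots> = card {b\<in>\<sigma>. T b = i}"
    using assms by (simp add: sum.If_cases Int_def)
  finally show ?thesis .
qed

definition set_valued_tableaux :: "box set \<Rightarrow> (box \<Rightarrow> nat set) set" where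
  "set_valued_tableaux \<sigma> = \<sigma> \<rightarrow>\<^sub>E {S. finite S \<and> S \<noteq> {} \<and> S \<subseteq> {1..}}"

definition SS :: "box set \<Rightarrow> (box \<Rightarrow> nat set) set" where
  "SS \<sigma> = {T \<in> set_valued_tableaux \<sigma>.
     (\<forall>i j j'. (i, j) \<in> \<sigma> \<and> (i, j') \<in> \<sigma> \<and> j < j' \<longrightarrow> Max (T (i, j)) \<le> Min (T (i, j'))) \<and>
     (\<forall>i i' j. (i, j) \<in> \<sigma> \<and> (i', j) \<in> \<sigma> \<and> i < i' \<longrightarrow> Max (T (i, j)) < Min (T (i', j)))}"

definition sv_content :: "box set \<Rightarrow> (box \<Rightarrow> nat set) \<Rightarrow> (nat \<Rightarrow>\<^sub>0 nat)" where
  "sv_content \<sigma> T = (\<Sum>b\<in>\<sigma>. \<Sum>i\<in>T b. Poly_Mapping.single i 1)"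

text \<open>The number of labels minus the number of boxes, both recorded row by row.\<close>

definition excess :: "box set \<Rightarrow> (box \<Rightarrow> nat set) \<Rightarrow> (nat \<Rightarrow>\<^sub>0 nat)" where
  "excess \<sigma> T =
     (\<Sum>b\<in>\<sigma>. Poly_Mapping.single (fst b) (card (T b))) - (\<Sum>b\<in>\<sigma>. Poly_Mapping.single (fst b) 1)"

lemma lookup_excess:
  assumes "finite \<sigma>"
  shows "Poly_Mapping.lookup (excess \<sigma> T) i =
    (\<Sum>b | b \<in> \<sigma> \<and> fst b = i. card (T b)) - card {b\<in>\<sigma>. fst b = i}"
proof -
  have "Poly_Mapping.lookup (\<Sum>b\<in>\<sigma>. Poly_Mapping.single (fst b) (f b)) i = (\<Sum>b | b \<in> \<sigma> \<and> fst b = i. f b)"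
    for f :: "box \<Rightarrow> nat"
    unfolding lookup_sum using assms
    by (intro sum.mono_neutral_cong_right) (auto simp: lookup_single)
  then show ?thesis
    by (simp add: excess_def lookup_minus)
qed

definition exponent_sum :: "(nat \<Rightarrow>\<^sub>0 nat) \<Rightarrow> nat" where
  "exponent_sum e = (\<Sum>i\<in>Poly_Mapping.keys e. Poly_Mapping.lookup e i)"


section \<open>The generating functions and the coefficients\<close>

definition schur :: "box set \<Rightarrow> variable mfps" where
  "schur \<mu> = (\<Sum>\<^sub>\<infinity>T\<in>semistandard_tableaux \<mu>. x_power (content \<mu> T))"

definition RG :: "box set \<Rightarrow> variable mfps" where
  "RG \<sigma> = (\<Sum>\<^sub>\<infinity>T\<in>SS \<sigma>.
     (-1) ^ exponent_sum (excess \<sigma> T) * x_power (sv_content \<sigma> T) * w_power (excess \<sigma> T))"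

definition coeff_a :: "box set \<Rightarrow> box set \<Rightarrow> (nat \<Rightarrow>\<^sub>0 nat) \<Rightarrow> nat" where
  "coeff_a \<sigma> \<mu> e = card {(T', T'').
     T' \<in> semistandard_tableaux (above_part \<mu> \<sigma>) \<and> row_weakly_bounded (above_part \<mu> \<sigma>) T' \<and>
     T'' \<in> reverse_row_strict_tableaux (below_part \<mu> \<sigma>) \<and> row_bounded (below_part \<mu> \<sigma>) T'' \<and>
     content (above_part \<mu> \<sigma>) T' + content (below_part \<mu> \<sigma>) T'' = e}"

text \<open>
  Both series are summable for finite shapes: only finitely many tableaux contribute to any one
  coefficient.
\<close>

definition mfps_monom :: "('v \<Rightarrow>\<^sub>0 nat) \<Rightarrow> 'v mfps" where
  "mfps_monom m = Abs_mfps (\<lambda>k. if k = m then 1 else 0)"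

lemma coeff_monom: "coeff (mfps_monom m) k = (if k = m then 1 else 0)"
  by (simp add: mfps_monom_def)

lemma mfps_monom_0: "mfps_monom 0 = 1"
  by (rule mfps_eqI) (simp add: coeff_monom)

lemma mfps_monom_mult: "mfps_monom a * mfps_monom b = mfps_monom (a + b)"
proof (rule mfps_eqI)
  fix m
  have "coeff (mfps_monom a * mfps_monom b) m =
      (\<Sum>p\<in>decomps m. if p = (a, b) then 1 else 0)"
    unfolding coeff_mult by (rule sum.cong) (auto simp: coeff_monom split: if_splits)
  also have "\<dots> = coeff (mfps_monom (a + b)) m"
    by (auto simp: sum.delta coeff_monom) (auto simp: decomps_def)
  finally show "coeff (mfps_monom a * mfps_monom b) m = coeff (mfps_monom (a + b)) m" .
qed

lemma mfps_var_power: "mfps_var v ^ n = mfps_monom (Poly_Mapping.single v n)"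
proof (induction n)
  case 0
  then show ?case by (simp add: mfps_monom_0)
next
  case (Suc n)
  have "mfps_var v = mfps_monom (Poly_Mapping.single v 1)"
    by (simp add: mfps_var_def mfps_monom_def)
  then show ?case
    using Suc by (simp add: mfps_monom_mult flip: single_add)
qed

lemma mfps_monom_prod: "(\<Prod>i\<in>A. mfps_monom (g i)) = mfps_monom (\<Sum>i\<in>A. g i)"
  by (induction A rule: infinite_finite_induct) (simp_all add: mfps_monom_0 mfps_monom_mult)

lemma x_power_eq:
  "x_power c = mfps_monom (\<Sum>i\<in>Poly_Mapping.keys c. Poly_Mapping.single (X i) (Poly_Mapping.lookup c i))"
  by (simp add: x_power_def mfps_var_power mfps_monom_prod)

lemma w_power_eq:
  "w_power e = mfps_monom (\<Sum>i\<in>Poly_Mapping.keys e. Poly_Mapping.single (W i) (Poly_Mapping.lookup e i))"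
  by (simp add: w_power_def mfps_var_power mfps_monom_prod)

lemma lookup_x_exponent:
  "Poly_Mapping.lookup (\<Sum>i\<in>Poly_Mapping.keys c. Poly_Mapping.single (X i) (Poly_Mapping.lookup c i)) (X j) =
   Poly_Mapping.lookup c j"
proof -
  have "(\<Sum>i\<in>Poly_Mapping.keys c. Poly_Mapping.lookup (Poly_Mapping.single (X i) (Poly_Mapping.lookup c i)) (X j)) =
      (\<Sum>i\<in>Poly_Mapping.keys c. if i = j then Poly_Mapping.lookup c j else 0)"
    by (rule sum.cong) (auto simp: lookup_single)
  then show ?thesis
    by (simp add: lookup_sum in_keys_iff)
qed

lemma coeff_minus_one_power_mult:
  "coeff ((-1) ^ n * f) m = 0 \<longleftrightarrow> coeff f m = 0"
  by (cases "even n") simp_all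

lemma schur_summable:
  assumes "finite \<mu>"
  shows "(\<lambda>T. x_power (content \<mu> T)) summable_on semistandard_tableaux \<mu>"
proof -
  have "finite {T \<in> semistandard_tableaux \<mu>. coeff (x_power (content \<mu> T)) m \<noteq> 0}" for m
  proof (rule finite_subset)
    let ?K = "{i. X i \<in> Poly_Mapping.keys m}"
    show "finite (\<mu> \<rightarrow>\<^sub>E ?K)"
      using assms finite_vimageI[of "Poly_Mapping.keys m" X]
      by (intro finite_PiE) (auto simp: vimage_def inj_def)
    show "{T \<in> semistandard_tableaux \<mu>. coeff (x_power (content \<mu> T)) m \<noteq> 0} \<subseteq> \<mu> \<rightarrow>\<^sub>E ?K"
    proof clarify
      fix T assume T: "T \<in> semistandard_tableaux \<mu>" "coeff (x_power (content \<mu> T)) m \<noteq> 0"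
      then have m: "Poly_Mapping.lookup m (X i) = card {b\<in>\<mu>. T b = i}" for i
        by (auto simp: x_power_eq coeff_monom lookup_x_exponent lookup_content[OF assms, symmetric]
            split: if_splits)
      have "T b \<in> ?K" if "b \<in> \<mu>" for b
        using assms that by (cases b) (auto simp: in_keys_iff m)
      with T(1) show "T \<in> \<mu> \<rightarrow>\<^sub>E ?K"
        by (auto simp: semistandard_tableaux_def tableaux_def PiE_iff)
    qed
  qed
  then show ?thesis
    unfolding summable_on_def by (blast intro: has_sum_mfps)
qed

lemma RG_summable:
  assumes "finite \<sigma>"
  shows "(\<lambda>T. (-1) ^ exponent_sum (excess \<sigma> T) * x_power (sv_content \<sigma> T) * w_power (excess \<sigma> T))
    summable_on SS \<sigma>"
proof -
  let ?f = "\<lambda>T. (-1) ^ exponent_sum (excess \<sigma> T) * x_power (sv_content \<sigma> T) * w_power (excess \<sigma> T)"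
  have "finite {T \<in> SS \<sigma>. coeff (?f T) m \<noteq> 0}" for m
  proof (rule finite_subset)
    let ?K = "{i. X i \<in> Poly_Mapping.keys m}"
    show "finite (\<sigma> \<rightarrow>\<^sub>E Pow ?K)"
      using assms finite_vimageI[of "Poly_Mapping.keys m" X]
      by (intro finite_PiE) (auto simp: vimage_def inj_def)
    show "{T \<in> SS \<sigma>. coeff (?f T) m \<noteq> 0} \<subseteq> \<sigma> \<rightarrow>\<^sub>E Pow ?K"
    proof clarify
      fix T assume T: "T \<in> SS \<sigma>" "coeff (?f T) m \<noteq> 0"
      then have ge: "Poly_Mapping.lookup (sv_content \<sigma> T) i \<le> Poly_Mapping.lookup m (X i)" for i
        by (auto simp: mult.assoc coeff_minus_one_power_mult x_power_eq w_power_eq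
            mfps_monom_mult coeff_monom lookup_add lookup_x_exponent split: if_splits)
      have T': "finite (T b)" if "b \<in> \<sigma>" for b
        using T(1) that by (auto simp: SS_def set_valued_tableaux_def PiE_iff)
      have "i \<in> ?K" if b: "b \<in> \<sigma>" and i: "i \<in> T b" for b i
      proof -
        have "(1::nat) \<le> (\<Sum>k\<in>T b. Poly_Mapping.lookup (Poly_Mapping.single k 1) i)"
          using member_le_sum[of i "T b" "\<lambda>k. Poly_Mapping.lookup (Poly_Mapping.single k (1::nat)) i"] T'[OF b] i
          by simp
        also have "\<dots> \<le> (\<Sum>b\<in>\<sigma>. \<Sum>k\<in>T b. Poly_Mapping.lookup (Poly_Mapping.single k 1) i)"
          using b assms by (intro member_le_sum) auto
        also have "\<dots> = Poly_Mapping.lookup (sv_content \<sigma> T) i"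
          by (simp add: sv_content_def lookup_sum)
        finally show ?thesis
          using ge[of i] by (simp add: in_keys_iff)
      qed
      with T(1) show "T \<in> \<sigma> \<rightarrow>\<^sub>E Pow ?K"
        by (auto simp: SS_def set_valued_tableaux_def PiE_iff)
    qed
  qed
  then show ?thesis
    unfolding summable_on_def by (blast intro: has_sum_mfps)
qed

end

theory Submission
  imports Defs
begin

text \<open>
  A skew shape with columns p, ..., r - 1 is the region between two weakly decreasing sequences of
  column heights, and a tableau is a chain of such sequences, one step per label. Summing over the
  chains turns every generating function into a product of matrices indexed by height sequences:
  \<^item> semistandard tableaux of shape \<open>\<mu>\<close>: horizontal strip matrices U;
  \<^item> set-valued tableaux: a deformation of U in which a column that does not grow contributes
    \<open>1 - x w\<^sub>i\<close> instead of 1 when the label may be added to its lowest box, in row i;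
  \<^item> the tableaux T'' on B: matrices D with index m, removing vertical strips in rows below m,
    with weight \<open>- w\<^sub>m\<close> per box;
  \<^item> the tableaux T' on A: boxes whose label is their row index, and horizontal strip matrices H
    with index m, adding boxes in rows below m, with weight \<open>w\<^sub>m\<close> per box.

  Let V with index m be the deformed matrix in which only the variables \<open>w\<^sub>1, ..., w\<^sub>m\<close> are present.
  Then V(m - 1) D(m) = D(m) V(m), which carries U to the fully deformed matrix along
  D(1) D(2) ..., and D(m) is the inverse of H(m). This gives the expansion for the matrix V that
  ignores the upper boundary of \<open>\<sigma>\<close>; taking the upper boundary into account amounts to the sum
  over the boxes of T' labelled by their row.
\<close>

text \<open>The upper boundary is the obstacle. A chain of \<open>V\<close> that starts at the upper
  boundary \<open>t\<close> also offers the factor \<open>1 - x w\<close> for lowest boxes in rows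
  at most \<open>t j\<close>, which are not in the shape. The cure is to start from every profile
  \<nu> below \<open>t\<close>, with one \<open>w i\<close> for each box of row i between \<nu> and
  \<open>t\<close>: a hidden column of height h - 1 that grows then contributes the
  \<open>x w\<close> that a resting column of height h lacks. These weighted starts must come from
  undeformed chains, which begin at a still lower profile s. Pulling D to the left through the
  deformed steps leaves it at s, where it cancels against H, because H transposed inverts D. Hence
  T' has two layers: from s to \<nu> with labels smaller than the row (H), and from \<nu> to
  \<open>t\<close> with labels equal to the row. All identities hold over an arbitrary commutative
  ring and finite sets of profiles. Finiteness comes from looking at one monomial at a time: it
  involves only the x variables up to some N, so labels stop at N and columns grow by at most N
  boxes. The height bound \<open>L\<close>, which also caps the indices of D and H, leaves exactly
  that much room.\<close>

section \<open>Chains of column profiles\<close>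

text \<open>Heights vanish outside the columns, so that column r acts as an empty column to the right.\<close>

definition profiles :: "nat \<Rightarrow> nat \<Rightarrow> (nat \<Rightarrow> nat) set" where
  "profiles p r = {h. (\<forall>j. j \<notin> {p..<r} \<longrightarrow> h j = 0) \<and> (\<forall>j\<ge>p. h (Suc j) \<le> h j)}"

definition bounded_profiles :: "nat \<Rightarrow> nat \<Rightarrow> nat \<Rightarrow> (nat \<Rightarrow> nat) set" where
  "bounded_profiles p r L = {h \<in> profiles p r. \<forall>j. h j \<le> L}"

lemma profiles_outside: "h \<in> profiles p r \<Longrightarrow> j \<notin> {p..<r} \<Longrightarrow> h j = 0"
  by (auto simp: profiles_def)

lemma profiles_Suc: "h \<in> profiles p r \<Longrightarrow> p \<le> j \<Longrightarrow> h (Suc j) \<le> h j"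
  by (auto simp: profiles_def)

lemma profiles_antimono:
  assumes "h \<in> profiles p r" "p \<le> j" "j \<le> k"
  shows "h k \<le> h j"
  using assms(3)
proof (induction k rule: dec_induct)
  case (step k)
  then show ?case using profiles_Suc[OF assms(1), of k] assms(2) by simp
qed simp

lemma finite_bounded_profiles [simp]: "finite (bounded_profiles p r L)"
proof (rule finite_subset)
  show "bounded_profiles p r L \<subseteq>
      {f. \<forall>x. (x \<in> {p..<r} \<longrightarrow> f x \<in> {..L}) \<and> (x \<notin> {p..<r} \<longrightarrow> f x = 0)}"
    by (auto simp: bounded_profiles_def profiles_def)
qed (rule finite_set_of_finite_funs, auto)

lemma bounded_profilesD:
  assumes "h \<in> bounded_profiles p r L"
  shows "h \<in> profiles p r" "h j \<le> L"
  using assms by (auto simp: bounded_profiles_def)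

text \<open>In contrast to \<open>profiles\<close>, nothing relates neighbouring columns, so sums of
  products over this set can be evaluated column by column.\<close>

definition zero_extended :: "nat \<Rightarrow> nat \<Rightarrow> (nat \<Rightarrow> nat set) \<Rightarrow> (nat \<Rightarrow> nat) set" where
  "zero_extended p r B = {h. (\<forall>j\<in>{p..<r}. h j \<in> B j) \<and> (\<forall>j. j \<notin> {p..<r} \<longrightarrow> h j = 0)}"

lemma finite_zero_extended:
  assumes "\<And>j. j \<in> {p..<r} \<Longrightarrow> finite (B j)"
  shows "finite (zero_extended p r B)"
proof (rule finite_subset)
  show "zero_extended p r B \<subseteq>
      {f. \<forall>x. (x \<in> {p..<r} \<longrightarrow> f x \<in> (\<Union>j\<in>{p..<r}. B j)) \<and> (x \<notin> {p..<r} \<longrightarrow> f x = 0)}"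
    unfolding zero_extended_def by blast
qed (rule finite_set_of_finite_funs, use assms in auto)

text \<open>Only the factor of the first column involves \<open>h p\<close>, and its sum over
  \<open>h p\<close> does not depend on the value in the next column. So the columns can be summed
  away from left to right. The value 0 plays the right neighbour of the last column.\<close>

lemma sum_prod_coupled:
  fixes f :: "nat \<Rightarrow> nat \<Rightarrow> nat \<Rightarrow> 'a::comm_semiring_1"
  assumes "p \<le> r" and "\<And>j. j \<in> {p..<r} \<Longrightarrow> finite (B j)"
    and "\<And>j v. j \<in> {p..<r} \<Longrightarrow> v \<in> (if Suc j < r then B (Suc j) else {0}) \<Longrightarrow> (\<Sum>u\<in>B j. f j u v) = c j"
  shows "(\<Sum>h\<in>zero_extended p r B. \<Prod>j=p..<r. f j (h j) (h (Suc j))) = (\<Prod>j=p..<r. c j)"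
  using assms
proof (induction p rule: inc_induct)
  case base
  have "zero_extended r r B = {\<lambda>_. 0}"
    by (auto simp: zero_extended_def)
  then show ?case by simp
next
  case (step p)
  let ?g = "\<lambda>h::nat \<Rightarrow> nat. \<Prod>j=Suc p..<r. f j (h j) (h (Suc j))"
  have IH: "(\<Sum>h\<in>zero_extended (Suc p) r B. ?g h) = (\<Prod>j=Suc p..<r. c j)"
    using step by auto
  have split: "{p..<r} = insert p {Suc p..<r}"
    using step.hyps by auto
  have "(\<Sum>h\<in>zero_extended p r B. \<Prod>j=p..<r. f j (h j) (h (Suc j))) =
      (\<Sum>h\<in>zero_extended p r B. f p (h p) (h (Suc p)) * ?g h)"
    by (simp add: split)
  also have "\<dots> = (\<Sum>(h, u)\<in>zero_extended (Suc p) r B \<times> B p. f p u (h (Suc p)) * ?g h)"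
  proof (rule sum.reindex_bij_witness[where j = "\<lambda>h. (h(p := 0), h p)" and i = "\<lambda>(h, u). h(p := u)"])
    fix h assume "h \<in> zero_extended p r B"
    then show "(h(p := 0), h p) \<in> zero_extended (Suc p) r B \<times> B p"
      using step.hyps by (auto simp: zero_extended_def)
    have "?g (h(p := 0)) = ?g h" by (rule prod.cong) auto
    then show "(case (h(p := 0), h p) of (h, u) \<Rightarrow> f p u (h (Suc p)) * ?g h) = f p (h p) (h (Suc p)) * ?g h"
      by simp
  qed (use step.hyps in \<open>auto simp: zero_extended_def fun_eq_iff\<close>)
  also have "\<dots> = (\<Sum>h\<in>zero_extended (Suc p) r B. (\<Sum>u\<in>B p. f p u (h (Suc p))) * ?g h)"
    by (simp add: sum.cartesian_product sum_distrib_right)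
  also have "\<dots> = (\<Sum>h\<in>zero_extended (Suc p) r B. c p * ?g h)"
  proof (rule sum.cong[OF refl])
    fix h assume h: "h \<in> zero_extended (Suc p) r B"
    then have "h (Suc p) \<in> (if Suc p < r then B (Suc p) else {0})"
      by (auto simp: zero_extended_def)
    then show "(\<Sum>u\<in>B p. f p u (h (Suc p))) * ?g h = c p * ?g h"
      using step.prems(2)[of p] step.hyps by auto
  qed
  also have "\<dots> = (\<Prod>j=p..<r. c j)"
    using IH by (simp add: split flip: sum_distrib_left)
  finally show ?case .
qed

lemma sum_prod_zero_extended:
  fixes f :: "nat \<Rightarrow> nat \<Rightarrow> 'a::comm_semiring_1"
  assumes "p \<le> r" and "\<And>j. j \<in> {p..<r} \<Longrightarrow> finite (B j)"
  shows "(\<Sum>h\<in>zero_extended p r B. \<Prod>j=p..<r. f j (h j)) = (\<Prod>j=p..<r. \<Sum>u\<in>B j. f j u)"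
  using sum_prod_coupled[OF assms, where f = "\<lambda>j u v. f j u"] by simp

section \<open>Products and chains of kernels\<close>

definition kernel_mult ::
    "'s set \<Rightarrow> ('r \<Rightarrow> 's \<Rightarrow> 'a) \<Rightarrow> ('s \<Rightarrow> 't \<Rightarrow> 'a) \<Rightarrow> 'r \<Rightarrow> 't \<Rightarrow> 'a::comm_ring_1" where
  "kernel_mult S K K' a b = (\<Sum>c\<in>S. K a c * K' c b)"

lemma kernel_mult_assoc:
  "kernel_mult S (kernel_mult S K K') K'' a b = kernel_mult S K (kernel_mult S K' K'') a b"
  unfolding kernel_mult_def sum_distrib_left sum_distrib_right mult.assoc
  by (rule sum.swap)

text \<open>The factors are numbered from 1, like the labels, and the newest factor stands on the
  right. In a chain of tableau steps it is therefore the step of the largest label.\<close>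

fun chain :: "'s set \<Rightarrow> (nat \<Rightarrow> 's \<Rightarrow> 's \<Rightarrow> 'a::comm_ring_1) \<Rightarrow> nat \<Rightarrow> 's \<Rightarrow> 's \<Rightarrow> 'a" where
  "chain S K 0 = (\<lambda>a b. if a = b then 1 else 0)"
| "chain S K (Suc N) = kernel_mult S (chain S K N) (K (Suc N))"

lemma kernel_mult_left_cong:
  assumes "\<And>c. c \<in> S \<Longrightarrow> K a c = K2 a c"
  shows "kernel_mult S K K' a b = kernel_mult S K2 K' a b"
  unfolding kernel_mult_def using assms by (intro sum.cong) auto

text \<open>The premise \<open>K a c \<noteq> 0\<close> is what makes this useful: the commutation
  relations hold only for profiles with room below the height bound, and the profiles reached from
  \<open>a\<close> have it.\<close>

lemma kernel_mult_right_cong: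
  assumes "\<And>c. c \<in> S \<Longrightarrow> K a c \<noteq> 0 \<Longrightarrow> K' c b = K2 c b"
  shows "kernel_mult S K K' a b = kernel_mult S K K2 a b"
  unfolding kernel_mult_def using assms by (intro sum.cong) (auto, metis mult_zero_left)

lemma kernel_mult_id_left:
  "finite S \<Longrightarrow> a \<in> S \<Longrightarrow> kernel_mult S (\<lambda>a b. if a = b then 1 else 0) K a b = K a b"
  by (simp add: kernel_mult_def if_distrib[of "\<lambda>x. x * _"] cong: if_cong)

lemma kernel_mult_id_right:
  "finite S \<Longrightarrow> b \<in> S \<Longrightarrow> kernel_mult S K (\<lambda>a b. if a = b then 1 else 0) a b = K a b"
  by (simp add: kernel_mult_def if_distrib[of "\<lambda>x. _ * x"] cong: if_cong)

lemma kernel_mult_nonzeroE: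
  assumes "kernel_mult S K K' a b \<noteq> 0"
  obtains c where "c \<in> S" "K a c \<noteq> 0" "K' c b \<noteq> 0"
  using assms unfolding kernel_mult_def
  by (metis (no_types, lifting) mult_zero_left mult_zero_right sum.neutral)

text \<open>Applied with R the pointwise order of profiles, or its converse for D, this confines the
  sums over intermediate profiles to intervals.\<close>

lemma chain_nonzero:
  assumes R: "reflp R" "transp R" "\<And>k a b. a \<in> S \<Longrightarrow> b \<in> S \<Longrightarrow> K k a b \<noteq> 0 \<Longrightarrow> R a b"
    and "chain S K N a b \<noteq> 0" "a \<in> S" "b \<in> S"
  shows "R a b"
  using assms(4-)
proof (induction N arbitrary: b)
  case 0
  then show ?case using R(1) by (auto simp: reflp_def split: if_splits)
next
  case (Suc N)
  from Suc.prems(1) obtain c where "c \<in> S" "chain S K N a c \<noteq> 0" "K (Suc N) c b \<noteq> 0"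
    by (auto elim: kernel_mult_nonzeroE)
  then show ?case
    using Suc.IH[of c] Suc.prems R(2,3) by (blast dest: transpD)
qed


section \<open>Transfer matrices\<close>

locale transfer_kernels =
  fixes p r :: nat and w :: "nat \<Rightarrow> 'a::comm_ring_1"
  assumes pr: "p \<le> r"
begin

abbreviation "J \<equiv> {p..<r}"

text \<open>The box in row \<open>\<alpha> j\<close> of column j can take the new label in addition
  to smaller ones only if \<alpha> has no box to its right, since that box would carry a smaller
  label; this is the condition \<open>\<alpha> (Suc j) < \<alpha> j\<close>.\<close>

definition V :: "nat \<Rightarrow> 'a \<Rightarrow> (nat \<Rightarrow> nat) \<Rightarrow> (nat \<Rightarrow> nat) \<Rightarrow> 'a" where
  "V m x \<alpha> \<beta> = (if \<forall>j\<in>J. \<beta> j = \<alpha> j \<or> \<beta> j = Suc (\<alpha> j) then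
     \<Prod>j\<in>J. if \<beta> j = \<alpha> j then 1 - (if \<alpha> (Suc j) < \<alpha> j \<and> \<alpha> j \<le> m then x * w (\<alpha> j) else 0) else x
   else 0)"

text \<open>The set-valued step for a shape with upper boundary \<open>t\<close>: a box in a row at
  most \<open>t j\<close> is not in the shape and cannot take an additional label.\<close>

definition V_above :: "(nat \<Rightarrow> nat) \<Rightarrow> 'a \<Rightarrow> (nat \<Rightarrow> nat) \<Rightarrow> (nat \<Rightarrow> nat) \<Rightarrow> 'a" where
  "V_above t x \<alpha> \<beta> = (if \<forall>j\<in>J. \<beta> j = \<alpha> j \<or> \<beta> j = Suc (\<alpha> j) then
     \<Prod>j\<in>J. if \<beta> j = \<alpha> j then 1 - (if \<alpha> (Suc j) < \<alpha> j \<and> t j < \<alpha> j then x * w (\<alpha> j) else 0) else x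
   else 0)"

text \<open>The first argument is the larger profile. Column j loses the rows from
  \<open>\<beta> j + 1\<close> to \<open>\<gamma> j\<close>, and
  \<open>\<gamma> (Suc j) \<le> \<beta> j\<close> says that column j + 1 has no box in these rows,
  so at most one box leaves each row.\<close>

definition D :: "nat \<Rightarrow> (nat \<Rightarrow> nat) \<Rightarrow> (nat \<Rightarrow> nat) \<Rightarrow> 'a" where
  "D m \<gamma> \<beta> = (if \<forall>j\<in>J. \<gamma> (Suc j) \<le> \<beta> j \<and> \<beta> j \<le> \<gamma> j \<and> (\<beta> j < \<gamma> j \<longrightarrow> m \<le> \<beta> j)
     then \<Prod>j\<in>J. (- w m) ^ (\<gamma> j - \<beta> j) else 0)"

definition H :: "nat \<Rightarrow> (nat \<Rightarrow> nat) \<Rightarrow> (nat \<Rightarrow> nat) \<Rightarrow> 'a" where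
  "H m \<alpha> \<beta> = (if \<forall>j\<in>J. \<beta> j = \<alpha> j \<or> \<beta> j = Suc (\<alpha> j) \<and> m \<le> \<alpha> j
     then \<Prod>j\<in>J. if \<beta> j = \<alpha> j then 1 else w m else 0)"

section \<open>Commutation of V and D\<close>

text \<open>The interlacing condition \<open>\<gamma> (Suc j) \<le> \<beta> j\<close> on the
  intermediate profile is charged to column j + 1, as \<open>u \<le> \<beta> (j - 1)\<close> there.
  All conditions then concern a single column, with \<alpha> and \<beta> fixed, and the sum factors.
  The strict bound on \<alpha> keeps grown columns within the height bound.\<close>

lemma V_times_D:
  assumes \<alpha>: "\<alpha> \<in> profiles p r" and aL: "\<And>j. \<alpha> j < L" and \<beta>: "\<beta> \<in> profiles p r"
  shows "kernel_mult (bounded_profiles p r L) (V m x) (D n) \<alpha> \<beta> = (\<Prod>j\<in>J.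
     \<Sum>u | (u = \<alpha> j \<or> u = Suc (\<alpha> j)) \<and> \<beta> j \<le> u \<and> (p < j \<longrightarrow> u \<le> \<beta> (j - 1)) \<and> (\<beta> j < u \<longrightarrow> n \<le> \<beta> j).
       (if u = \<alpha> j then 1 - (if \<alpha> (Suc j) < \<alpha> j \<and> \<alpha> j \<le> m then x * w (\<alpha> j) else 0) else x) * (- w n) ^ (u - \<beta> j))"
proof -
  let ?B = "\<lambda>j. {u. (u = \<alpha> j \<or> u = Suc (\<alpha> j)) \<and> \<beta> j \<le> u \<and> (p < j \<longrightarrow> u \<le> \<beta> (j - 1)) \<and> (\<beta> j < u \<longrightarrow> n \<le> \<beta> j)}"
  let ?f = "\<lambda>j u. (if u = \<alpha> j then 1 - (if \<alpha> (Suc j) < \<alpha> j \<and> \<alpha> j \<le> m then x * w (\<alpha> j) else 0) else x) * (- w n) ^ (u - \<beta> j)"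
  have iff: "\<gamma> \<in> zero_extended p r ?B \<longleftrightarrow> \<gamma> \<in> bounded_profiles p r L \<and> (\<forall>j\<in>J. \<gamma> j = \<alpha> j \<or> \<gamma> j = Suc (\<alpha> j)) \<and>
      (\<forall>j\<in>J. \<gamma> (Suc j) \<le> \<beta> j \<and> \<beta> j \<le> \<gamma> j \<and> (\<beta> j < \<gamma> j \<longrightarrow> n \<le> \<beta> j))" (is "?l \<longleftrightarrow> ?r") for \<gamma>
  proof
    assume ?l
    then have 1: "\<And>j. j \<in> J \<Longrightarrow> \<gamma> j \<in> ?B j" "\<And>j. j \<notin> J \<Longrightarrow> \<gamma> j = 0"
      by (auto simp: zero_extended_def)
    have 2: "\<gamma> (Suc j) \<le> \<beta> j" if "j \<in> J" for j
      using 1(1)[of "Suc j"] 1(2)[of "Suc j"] that by (cases "Suc j < r") auto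
    have "\<gamma> (Suc j) \<le> \<gamma> j" if "p \<le> j" for j
      using 1(1)[of j] 1(2)[of "Suc j"] 2[of j] that by (cases "j < r") auto
    moreover have "\<gamma> j \<le> L" for j
      using 1(1)[of j] 1(2)[of j] aL[of j] by (cases "j \<in> J") auto
    ultimately show ?r
      using 1 2 by (auto simp: bounded_profiles_def profiles_def)
  next
    assume ?r
    then have *: "\<And>j. j \<in> J \<Longrightarrow> \<gamma> (Suc j) \<le> \<beta> j" by auto
    have "\<gamma> j \<le> \<beta> (j - 1)" if "j \<in> J" "p < j" for j
      using *[of "j - 1"] that by (cases j) auto
    with \<open>?r\<close> show ?l
      by (auto simp: zero_extended_def bounded_profiles_def profiles_def)
  qed
  have "kernel_mult (bounded_profiles p r L) (V m x) (D n) \<alpha> \<beta> =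
      (\<Sum>\<gamma>\<in>zero_extended p r ?B. \<Prod>j\<in>J. ?f j (\<gamma> j))"
    unfolding kernel_mult_def
  proof (rule sum.mono_neutral_cong_right)
    fix \<gamma> assume "\<gamma> \<in> zero_extended p r ?B"
    then show "V m x \<alpha> \<gamma> * D n \<gamma> \<beta> = (\<Prod>j\<in>J. ?f j (\<gamma> j))"
      unfolding iff V_def D_def by (simp add: prod.distrib)
  qed (use iff in \<open>auto simp: V_def D_def\<close>)
  also have "\<dots> = (\<Prod>j\<in>J. \<Sum>u\<in>?B j. ?f j u)"
    by (rule sum_prod_zero_extended[OF pr]) auto
  finally show ?thesis .
qed

text \<open>Here the columns are coupled by the corner condition of \<open>V\<close>, which compares
  two intermediate heights. It decouples because \<open>D\<close> and \<open>V\<close> carry the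
  same index n.\<close>

lemma D_times_V:
  assumes \<alpha>: "\<alpha> \<in> bounded_profiles p r L" and \<beta>: "\<beta> \<in> profiles p r"
  shows "kernel_mult (bounded_profiles p r L) (D n) (V n x) \<alpha> \<beta> = (\<Prod>j\<in>J.
     \<Sum>u | (\<beta> j = u \<or> \<beta> j = Suc u) \<and> \<alpha> (Suc j) \<le> u \<and> u \<le> \<alpha> j \<and> (u < \<alpha> j \<longrightarrow> n \<le> u).
       (if \<beta> j = u then 1 - (if \<alpha> (Suc j) < \<beta> j \<and> \<beta> j \<le> n then x * w (\<beta> j) else 0) else x) * (- w n) ^ (\<alpha> j - u))"
proof -
  let ?B = "\<lambda>j. {u. (\<beta> j = u \<or> \<beta> j = Suc u) \<and> \<alpha> (Suc j) \<le> u \<and> u \<le> \<alpha> j \<and> (u < \<alpha> j \<longrightarrow> n \<le> u)}"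
  let ?f = "\<lambda>j u. (if \<beta> j = u then 1 - (if \<alpha> (Suc j) < \<beta> j \<and> \<beta> j \<le> n then x * w (\<beta> j) else 0) else x) * (- w n) ^ (\<alpha> j - u)"
  have iff: "\<delta> \<in> zero_extended p r ?B \<longleftrightarrow> \<delta> \<in> bounded_profiles p r L \<and> (\<forall>j\<in>J. \<beta> j = \<delta> j \<or> \<beta> j = Suc (\<delta> j)) \<and>
      (\<forall>j\<in>J. \<alpha> (Suc j) \<le> \<delta> j \<and> \<delta> j \<le> \<alpha> j \<and> (\<delta> j < \<alpha> j \<longrightarrow> n \<le> \<delta> j))" (is "?l \<longleftrightarrow> ?r") for \<delta>
  proof
    assume ?l
    then have 1: "\<And>j. j \<in> J \<Longrightarrow> \<delta> j \<in> ?B j" "\<And>j. j \<notin> J \<Longrightarrow> \<delta> j = 0"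
      by (auto simp: zero_extended_def)
    have 2: "\<delta> j \<le> \<alpha> j" for j
      using 1(1)[of "j"] 1(2)[of "j"] by (cases "j \<in> J") auto
    have "\<delta> (Suc j) \<le> \<delta> j" if "p \<le> j" for j
      using 1(1)[of j] 1(2)[of "Suc j"] 2[of "Suc j"] that by (cases "j < r") auto
    moreover have "\<delta> j \<le> L" for j
      using 2[of j] bounded_profilesD(2)[OF \<alpha>, of j] by simp
    ultimately show ?r
      using 1 2 by (auto simp: bounded_profiles_def profiles_def)
  qed (auto simp: zero_extended_def bounded_profiles_def profiles_def)
  have "kernel_mult (bounded_profiles p r L) (D n) (V n x) \<alpha> \<beta> =
      (\<Sum>\<gamma>\<in>zero_extended p r ?B. \<Prod>j\<in>J. ?f j (\<gamma> j))"
    unfolding kernel_mult_def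
  proof (rule sum.mono_neutral_cong_right)
    fix \<delta> assume "\<delta> \<in> zero_extended p r ?B"
    then have \<delta>: "\<delta> \<in> profiles p r" "\<And>j. j \<in> J \<Longrightarrow> \<beta> j = \<delta> j \<or> \<beta> j = Suc (\<delta> j)"
        "\<And>j. j \<in> J \<Longrightarrow> \<alpha> (Suc j) \<le> \<delta> j \<and> \<delta> j \<le> \<alpha> j \<and> (\<delta> j < \<alpha> j \<longrightarrow> n \<le> \<delta> j)"
      unfolding iff by (auto simp: bounded_profiles_def)
    \<comment> \<open>If \<delta> and \<alpha> differ in column j + 1, then boxes were removed
      there, so \<open>n \<le> \<delta> (Suc j)\<close>, and both comparisons fail because
      \<open>\<beta> j \<le> n\<close>.\<close>
    have *: "\<delta> (Suc j) < \<beta> j \<longleftrightarrow> \<alpha> (Suc j) < \<beta> j" if "j \<in> J" "\<beta> j \<le> n" for j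
    proof (cases "Suc j \<in> J")
      case True
      then show ?thesis using \<delta>(3)[of "Suc j"] that by auto
    next
      case False
      then show ?thesis
        using profiles_outside[OF \<delta>(1)] profiles_outside[OF bounded_profilesD(1)[OF \<alpha>]] by simp
    qed
    have "D n \<alpha> \<delta> * V n x \<delta> \<beta> = (\<Prod>j\<in>J. (- w n) ^ (\<alpha> j - \<delta> j)) *
       (\<Prod>j\<in>J. if \<beta> j = \<delta> j then 1 - (if \<delta> (Suc j) < \<delta> j \<and> \<delta> j \<le> n then x * w (\<delta> j) else 0) else x)"
      using \<delta> by (simp add: V_def D_def)
    also have "\<dots> = (\<Prod>j\<in>J. ?f j (\<delta> j))"
      unfolding prod.distrib[symmetric]
    proof (rule prod.cong[OF refl])
      fix j assume "j \<in> J"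
      then show "(- w n) ^ (\<alpha> j - \<delta> j) *
          (if \<beta> j = \<delta> j then 1 - (if \<delta> (Suc j) < \<delta> j \<and> \<delta> j \<le> n then x * w (\<delta> j) else 0) else x) = ?f j (\<delta> j)"
        using *[of j] by auto
    qed
    finally show "D n \<alpha> \<delta> * V n x \<delta> \<beta> = (\<Prod>j\<in>J. ?f j (\<delta> j))" .
  qed (use iff in \<open>auto simp: V_def D_def\<close>)
  also have "\<dots> = (\<Prod>j\<in>J. \<Sum>u\<in>?B j. ?f j u)"
    by (rule sum_prod_zero_extended[OF pr]) (auto intro: finite_subset[of _ "{.._}"])
  finally show ?thesis .
qed


lemma sum_pair: "(\<Sum>u | (u = a \<or> u = Suc a) \<and> P u. f u) =
    (if P a then f a else 0) + (if P (Suc a) then f (Suc a) else (0::'b::comm_monoid_add))"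
proof -
  have "{u. (u = a \<or> u = Suc a) \<and> P u} = {u\<in>{a, Suc a}. P u}"
    by auto
  then have "(\<Sum>u | (u = a \<or> u = Suc a) \<and> P u. f u) = (\<Sum>u\<in>{a, Suc a}. if P u then f u else 0)"
    by (simp only: sum.inter_filter finite.intros)
  then show ?thesis by simp
qed

lemma sum_pair': "(\<Sum>u | (b = u \<or> b = Suc u) \<and> P u. f u) =
    (if P b then f b else 0) + (if b \<noteq> 0 \<and> P (b - 1) then f (b - 1) else (0::'b::comm_monoid_add))"
proof -
  have "{u. (b = u \<or> b = Suc u) \<and> P u} = {u\<in>{b, b - 1}. (b = u \<or> b = Suc u) \<and> P u}"
    by auto
  then have "(\<Sum>u | (b = u \<or> b = Suc u) \<and> P u. f u) =
      (\<Sum>u\<in>{b, b - 1}. if (b = u \<or> b = Suc u) \<and> P u then f u else 0)"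
    by (simp only: sum.inter_filter finite.intros)
  then show ?thesis by (cases b) simp_all
qed

text \<open>
  Both sides are products over the columns. The factor of a column j with \<open>\<beta> j > m\<close> that does not
  grow is, up to a common factor, g j on the left and g (j + 1) on the right, where g j depends on
  \<open>\<alpha> j\<close> and \<open>\<beta> (j - 1)\<close>; for a growing column g j = g (j + 1) = u. So the products agree up to the
  first and the last g, which both equal u. As u may be a zero divisor, the induction carries the
  common cofactor c along instead of cancelling.
\<close>

lemma V_D_commute:
  assumes \<alpha>: "\<alpha> \<in> profiles p r" and aL: "\<And>j. \<alpha> j < L" and \<beta>: "\<beta> \<in> profiles p r"
  shows "kernel_mult (bounded_profiles p r L) (V m x) (D (Suc m)) \<alpha> \<beta> =
         kernel_mult (bounded_profiles p r L) (D (Suc m)) (V (Suc m) x) \<alpha> \<beta>"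
proof -
  let ?n = "Suc m"
  have \<alpha>': "\<alpha> \<in> bounded_profiles p r L"
    using \<alpha> aL by (auto simp: bounded_profiles_def less_imp_le)
  define l where "l j = (\<Sum>u | (u = \<alpha> j \<or> u = Suc (\<alpha> j)) \<and> \<beta> j \<le> u \<and> (p < j \<longrightarrow> u \<le> \<beta> (j - 1)) \<and> (\<beta> j < u \<longrightarrow> ?n \<le> \<beta> j).
       (if u = \<alpha> j then 1 - (if \<alpha> (Suc j) < \<alpha> j \<and> \<alpha> j \<le> m then x * w (\<alpha> j) else 0) else x) * (- w ?n) ^ (u - \<beta> j))" for j
  define k where "k j = (\<Sum>u | (\<beta> j = u \<or> \<beta> j = Suc u) \<and> \<alpha> (Suc j) \<le> u \<and> u \<le> \<alpha> j \<and> (u < \<alpha> j \<longrightarrow> ?n \<le> u).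
       (if \<beta> j = u then 1 - (if \<alpha> (Suc j) < \<beta> j \<and> \<beta> j \<le> ?n then x * w (\<beta> j) else 0) else x) * (- w ?n) ^ (\<alpha> j - u))" for j
  have l: "l j = (if \<beta> j \<le> \<alpha> j \<and> (p < j \<longrightarrow> \<alpha> j \<le> \<beta> (j - 1)) \<and> (\<beta> j < \<alpha> j \<longrightarrow> ?n \<le> \<beta> j)
       then (1 - (if \<alpha> (Suc j) < \<alpha> j \<and> \<alpha> j \<le> m then x * w (\<alpha> j) else 0)) * (- w ?n) ^ (\<alpha> j - \<beta> j) else 0)
    + (if \<beta> j \<le> Suc (\<alpha> j) \<and> (p < j \<longrightarrow> Suc (\<alpha> j) \<le> \<beta> (j - 1)) \<and> (\<beta> j < Suc (\<alpha> j) \<longrightarrow> ?n \<le> \<beta> j)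
       then x * (- w ?n) ^ (Suc (\<alpha> j) - \<beta> j) else 0)" for j
    unfolding l_def sum_pair by (intro arg_cong2[of _ _ _ _ "(+)"] if_cong) auto
  have k: "k j = (if \<alpha> (Suc j) \<le> \<beta> j \<and> \<beta> j \<le> \<alpha> j \<and> (\<beta> j < \<alpha> j \<longrightarrow> ?n \<le> \<beta> j)
       then (1 - (if \<alpha> (Suc j) < \<beta> j \<and> \<beta> j \<le> ?n then x * w (\<beta> j) else 0)) * (- w ?n) ^ (\<alpha> j - \<beta> j) else 0)
    + (if \<beta> j \<noteq> 0 \<and> \<alpha> (Suc j) \<le> \<beta> j - 1 \<and> \<beta> j - 1 \<le> \<alpha> j \<and> (\<beta> j - 1 < \<alpha> j \<longrightarrow> ?n \<le> \<beta> j - 1)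
       then x * (- w ?n) ^ (\<alpha> j - (\<beta> j - 1)) else 0)" for j
    unfolding k_def sum_pair' by (intro arg_cong2[of _ _ _ _ "(+)"] if_cong) auto
  have "(\<Prod>j\<in>J. l j) = (\<Prod>j\<in>J. k j)"
  proof (cases "\<exists>j\<in>J. Suc (\<alpha> j) < \<beta> j \<or> (\<beta> j < ?n \<and> \<beta> j < \<alpha> j)")
    case True
    \<comment> \<open>A column that would have to grow by two boxes, or to lose a box in a row at
      most \<open>?n\<close>, makes its factor vanish on both sides.\<close>
    then obtain j where j: "j \<in> J" "Suc (\<alpha> j) < \<beta> j \<or> (\<beta> j < ?n \<and> \<beta> j < \<alpha> j)" by blast
    then have "l j = 0" "k j = 0"
      unfolding l k by auto
    with j(1) show ?thesis
      by (metis finite_atLeastLessThan prod_zero)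
  next
    case False
    then have near: "\<beta> j \<le> Suc (\<alpha> j)" "\<beta> j < ?n \<Longrightarrow> \<alpha> j \<le> \<beta> j" if "j \<in> J" for j
      using that by (force simp: not_less)+
    define u where "u = 1 - x * w ?n"
    \<comment> \<open>On the left, u adds up two options for column j: resting, and growing by a box
      that D removes again. Growing is excluded when \<open>\<alpha> j = \<beta> (j - 1)\<close>,
      both options when \<open>\<alpha> j\<close> is larger.\<close>
    define g where "g j = (if p < j then if \<alpha> j < \<beta> (j - 1) then u else if \<alpha> j = \<beta> (j - 1) then 1 else 0 else u)" for j
    have step: "l j = k j" if "j \<in> J" "\<beta> j < ?n" for j
    proof -
      have a: "\<alpha> j \<le> \<beta> j" "\<beta> j \<le> Suc (\<alpha> j)" "\<alpha> (Suc j) \<le> \<alpha> j" "p < j \<Longrightarrow> \<beta> j \<le> \<beta> (j - 1)"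
        using near[OF that(1)] that profiles_Suc[OF \<alpha>] profiles_antimono[OF \<beta>, of "j - 1" j] by auto
      then consider "\<beta> j = \<alpha> j" | "\<beta> j = Suc (\<alpha> j)" by linarith
      then show ?thesis
        by cases (use a that in \<open>auto simp: l k\<close>)
    qed
    have big: "(\<beta> j \<le> \<alpha> j \<and> (\<exists>q. l j = q * g j \<and> k j = q * g (Suc j))) \<or>
        (l j = k j \<and> g j = u \<and> g (Suc j) = u)" if "j \<in> J" "?n \<le> \<beta> j" for j
    proof (cases "\<beta> j \<le> \<alpha> j")
      case True
      have "\<alpha> (Suc j) \<le> \<alpha> j" "p < j \<Longrightarrow> \<beta> j \<le> \<beta> (j - 1)"
        using that profiles_Suc[OF \<alpha>] profiles_antimono[OF \<beta>, of "j - 1" j] by auto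
      then have "l j = (- w ?n) ^ (\<alpha> j - \<beta> j) * g j"
        using True that unfolding l g_def u_def by (auto simp: algebra_simps Suc_diff_le)
      \<comment> \<open>For \<open>\<beta> j > ?n\<close> the value u is the sum of resting and of
        losing one more box that V puts back. For \<open>\<beta> j = ?n\<close> D may not remove the
        box of row \<open>?n\<close>, and the factor \<open>1 - x * w ?n\<close> of V with the
        raised index takes over. This is why the index of V grows by one.\<close>
      moreover have "k j = (- w ?n) ^ (\<alpha> j - \<beta> j) * g (Suc j)"
        using True that near[OF that(1)] unfolding k g_def u_def by (auto simp: algebra_simps Suc_diff_le)
      ultimately show ?thesis using True by blast
    next
      case False
      then have e: "\<beta> j = Suc (\<alpha> j)" using near[OF that(1)] by simp
      moreover have "\<alpha> (Suc j) \<le> \<alpha> j" "p < j \<Longrightarrow> \<beta> j \<le> \<beta> (j - 1)"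
        using that profiles_Suc[OF \<alpha>] profiles_antimono[OF \<beta>, of "j - 1" j] by auto
      ultimately show ?thesis
        using that by (auto simp: l k g_def)
    qed
    define P where "P i = (\<Prod>j=p..<i. l j)" for i
    define Q where "Q i = (\<Prod>j=p..<i. k j)" for i
    have inv: "if p < i \<and> \<beta> (i - 1) < ?n then P i = Q i
         else (\<exists>c. P i = u * c \<and> Q i = g i * c) \<or> (P i = Q i \<and> g i = u)" if "p \<le> i" "i \<le> r" for i
      using that
    proof (induction i rule: dec_induct)
      case base
      then show ?case by (auto simp: P_def Q_def g_def)
    next
      case (step i)
      have PQ: "P (Suc i) = P i * l i" "Q (Suc i) = Q i * k i"
        using step.hyps by (simp_all add: P_def Q_def)
      have i: "i \<in> J" using step by auto
      have dec: "p < i \<Longrightarrow> \<beta> i \<le> \<beta> (i - 1)"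
        using profiles_antimono[OF \<beta>, of "i - 1" i] by auto
      show ?case
      proof (cases "\<beta> i < ?n")
        case True
        \<comment> \<open>Entering a column with \<open>\<beta> i < ?n\<close> from a taller one, or
          at the left end, forces \<open>g i = u\<close>: in the first case
          \<open>\<alpha> i \<le> \<beta> i < ?n \<le> \<beta> (i - 1)\<close>. Both alternatives of
          the invariant then give equal products.\<close>
        have "P i = Q i"
        proof (cases "p < i \<and> \<beta> (i - 1) < ?n")
          case False
          then have "g i = u"
            using near[OF i] True by (auto simp: g_def)
          then show ?thesis using step False by auto
        qed (use step in auto)
        then show ?thesis
          using \<open>\<And>j. j \<in> J \<Longrightarrow> \<beta> j < ?n \<Longrightarrow> l j = k j\<close>[OF i True] True step.hyps PQ by auto
      next
        case False
        then have IH: "(\<exists>c. P i = u * c \<and> Q i = g i * c) \<or> (P i = Q i \<and> g i = u)"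
          using step dec by (auto split: if_splits)
        have n: "?n \<le> \<beta> i" using False by simp
        have "(\<exists>c. P (Suc i) = u * c \<and> Q (Suc i) = g (Suc i) * c) \<or> (P (Suc i) = Q (Suc i) \<and> g (Suc i) = u)"
          using big[OF i n]
        proof
          assume "\<beta> i \<le> \<alpha> i \<and> (\<exists>q. l i = q * g i \<and> k i = q * g (Suc i))"
          then obtain q where q: "l i = q * g i" "k i = q * g (Suc i)" by blast
          from IH show ?thesis
          proof (elim disjE exE conjE)
            fix c assume "P i = u * c" "Q i = g i * c"
            then show ?thesis
              unfolding PQ q by (intro disjI1 exI[of _ "c * g i * q"]) (simp add: ac_simps)
          next
            assume "P i = Q i" "g i = u"
            then show ?thesis
              unfolding PQ q by (intro disjI1 exI[of _ "Q i * q"]) (simp add: ac_simps)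
          qed
        next
          assume "l i = k i \<and> g i = u \<and> g (Suc i) = u"
          then show ?thesis using IH PQ by auto
        qed
        then show ?thesis using False by auto
      qed
    qed
    have "P r = Q r"
    proof (cases "p < r")
      case True
      \<comment> \<open>Column r is empty, so \<open>\<alpha> r = 0\<close> lies below
        \<open>\<beta> (r - 1)\<close>.\<close>
      then have "g r = u" if "?n \<le> \<beta> (r - 1)"
        using that profiles_outside[OF \<alpha>, of r] by (auto simp: g_def)
      then show ?thesis
        using inv[of r] True pr by (cases "\<beta> (r - 1) < ?n") auto
    qed (simp add: P_def Q_def)
    then show ?thesis by (simp add: P_def Q_def)
  qed
  then show ?thesis
    unfolding V_times_D[OF assms] D_times_V[OF \<alpha>' \<beta>] l_def k_def .
qed

section \<open>Chains of transfer matrices: support and commutation\<close>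

abbreviation D_chain :: "nat \<Rightarrow> nat \<Rightarrow> (nat \<Rightarrow> nat) \<Rightarrow> (nat \<Rightarrow> nat) \<Rightarrow> 'a" where
  "D_chain L \<equiv> chain (bounded_profiles p r L) D"

abbreviation H_chain :: "nat \<Rightarrow> nat \<Rightarrow> (nat \<Rightarrow> nat) \<Rightarrow> (nat \<Rightarrow> nat) \<Rightarrow> 'a" where
  "H_chain L \<equiv> chain (bounded_profiles p r L) H"

abbreviation V_chain :: "nat \<Rightarrow> nat \<Rightarrow> (nat \<Rightarrow> 'a) \<Rightarrow> nat \<Rightarrow> (nat \<Rightarrow> nat) \<Rightarrow> (nat \<Rightarrow> nat) \<Rightarrow> 'a" where
  "V_chain L m x \<equiv> chain (bounded_profiles p r L) (\<lambda>i. V m (x i))"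

abbreviation V_above_chain :: "nat \<Rightarrow> (nat \<Rightarrow> nat) \<Rightarrow> (nat \<Rightarrow> 'a) \<Rightarrow> nat \<Rightarrow> (nat \<Rightarrow> nat) \<Rightarrow> (nat \<Rightarrow> nat) \<Rightarrow> 'a" where
  "V_above_chain L t x \<equiv> chain (bounded_profiles p r L) (\<lambda>i. V_above t (x i))"

lemma profiles_leI:
  assumes "\<alpha> \<in> profiles p r" "\<And>j. j \<in> J \<Longrightarrow> \<alpha> j \<le> \<beta> j"
  shows "\<alpha> \<le> (\<beta> :: nat \<Rightarrow> nat)"
proof (rule le_funI)
  show "\<alpha> j \<le> \<beta> j" for j
    using assms(2)[of j] profiles_outside[OF assms(1), of j] by (cases "j \<in> J") auto
qed

lemma D_nonzero: "\<beta> \<in> profiles p r \<Longrightarrow> D m \<gamma> \<beta> \<noteq> 0 \<Longrightarrow> \<beta> \<le> \<gamma>"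
  by (rule profiles_leI) (auto simp: D_def split: if_splits)

lemma H_nonzero:
  assumes "\<alpha> \<in> profiles p r" "H m \<alpha> \<beta> \<noteq> 0"
  shows "\<alpha> \<le> \<beta>"
proof (rule profiles_leI[OF assms(1)])
  fix j assume "j \<in> J"
  then have "\<beta> j = \<alpha> j \<or> \<beta> j = Suc (\<alpha> j)"
    using assms(2) unfolding H_def by meson
  then show "\<alpha> j \<le> \<beta> j" by auto
qed

lemma V_above_nonzero:
  assumes "\<alpha> \<in> profiles p r" "V_above t x \<alpha> \<beta> \<noteq> 0"
  shows "\<alpha> \<le> \<beta>"
proof (rule profiles_leI[OF assms(1)])
  fix j assume "j \<in> J"
  then have "\<beta> j = \<alpha> j \<or> \<beta> j = Suc (\<alpha> j)"
    using assms(2) unfolding V_above_def by meson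
  then show "\<alpha> j \<le> \<beta> j" by auto
qed

lemma V_nonzero:
  assumes "V m x \<alpha> \<beta> \<noteq> 0" "\<beta> \<in> profiles p r"
  shows "\<beta> j \<le> Suc (\<alpha> j)"
  using assms profiles_outside[of \<beta> p r j] by (cases "j \<in> J") (force simp: V_def split: if_splits)+

lemma D_chain_nonzero:
  assumes "D_chain L M \<gamma> \<beta> \<noteq> 0" "\<gamma> \<in> bounded_profiles p r L" "\<beta> \<in> bounded_profiles p r L"
  shows "\<beta> \<le> \<gamma>"
  using assms(1)
  by (rule chain_nonzero[rotated 3])
     (use assms(2,3) D_nonzero bounded_profilesD(1) in \<open>auto intro: reflpI transpI\<close>)

lemma V_chain_nonzero:
  "V_chain L m x N \<alpha> \<beta> \<noteq> 0 \<Longrightarrow> \<beta> \<in> bounded_profiles p r L \<Longrightarrow> \<beta> j \<le> \<alpha> j + N"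
proof (induction N arbitrary: \<beta>)
  case (Suc N)
  from Suc.prems(1) obtain \<gamma> where "\<gamma> \<in> bounded_profiles p r L" "V_chain L m x N \<alpha> \<gamma> \<noteq> 0" "V m (x (Suc N)) \<gamma> \<beta> \<noteq> 0"
    by (auto elim: kernel_mult_nonzeroE)
  then show ?case
    using Suc.IH[of \<gamma>] V_nonzero[of m "x (Suc N)" \<gamma> \<beta> j] Suc.prems(2)[THEN bounded_profilesD(1)] by auto
qed (auto split: if_splits)

lemma H_chain_nonzero:
  assumes "H_chain L M s \<nu> \<noteq> 0" "s \<in> bounded_profiles p r L" "\<nu> \<in> bounded_profiles p r L"
  shows "s \<le> \<nu>"
  using assms(1)
  by (rule chain_nonzero[rotated 3])
     (use assms(2,3) H_nonzero bounded_profilesD(1) in \<open>auto intro: reflpI transpI\<close>)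

lemma V_above_chain_nonzero:
  assumes "V_above_chain L t x N t \<gamma> \<noteq> 0" "t \<in> bounded_profiles p r L" "\<gamma> \<in> bounded_profiles p r L"
  shows "t \<le> \<gamma>"
  using assms(1)
  by (rule chain_nonzero[rotated 3])
     (use assms(2,3) V_above_nonzero bounded_profilesD(1) in \<open>auto intro: reflpI transpI\<close>)

text \<open>Each D that is passed raises the index of V by one, which matches the numbering of the D
  chain. D only lowers profiles, so the room below L needed for every exchange persists.\<close>

lemma V_D_chain_commute:
  assumes "\<alpha> \<in> bounded_profiles p r L" "\<And>j. \<alpha> j < L" "\<beta> \<in> bounded_profiles p r L"
  shows "kernel_mult (bounded_profiles p r L) (V 0 x) (D_chain L M) \<alpha> \<beta> =
    kernel_mult (bounded_profiles p r L) (D_chain L M) (V M x) \<alpha> \<beta>"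
  using assms(3)
proof (induction M arbitrary: \<beta>)
  case 0
  then show ?case
    using assms(1) by (simp add: kernel_mult_id_left kernel_mult_id_right)
next
  case (Suc M)
  let ?S = "bounded_profiles p r L"
  have "kernel_mult ?S (V 0 x) (D_chain L (Suc M)) \<alpha> \<beta> =
      kernel_mult ?S (kernel_mult ?S (V 0 x) (D_chain L M)) (D (Suc M)) \<alpha> \<beta>"
    by (simp add: kernel_mult_assoc)
  also have "\<dots> = kernel_mult ?S (kernel_mult ?S (D_chain L M) (V M x)) (D (Suc M)) \<alpha> \<beta>"
    by (rule kernel_mult_left_cong) (use Suc.IH in blast)
  also have "\<dots> = kernel_mult ?S (D_chain L M) (kernel_mult ?S (V M x) (D (Suc M))) \<alpha> \<beta>"
    by (rule kernel_mult_assoc)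
  also have "\<dots> = kernel_mult ?S (D_chain L M) (kernel_mult ?S (D (Suc M)) (V (Suc M) x)) \<alpha> \<beta>"
  proof (rule kernel_mult_right_cong)
    fix \<delta> assume \<delta>: "\<delta> \<in> ?S" "D_chain L M \<alpha> \<delta> \<noteq> 0"
    have "\<delta> j < L" for j
      using D_chain_nonzero[OF \<delta>(2) assms(1) \<delta>(1)] assms(2)[of j] by (meson le_funD le_less_trans)
    then show "kernel_mult ?S (V M x) (D (Suc M)) \<delta> \<beta> = kernel_mult ?S (D (Suc M)) (V (Suc M) x) \<delta> \<beta>"
      using V_D_commute \<delta>(1) Suc.prems by (auto simp: bounded_profiles_def)
  qed
  also have "\<dots> = kernel_mult ?S (D_chain L (Suc M)) (V (Suc M) x) \<alpha> \<beta>"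
    by (simp add: kernel_mult_assoc)
  finally show ?case .
qed

text \<open>Every V step can use up one unit of height, so N units of room at the start keep all
  exchanges legitimate.\<close>

lemma V_chain_D_chain_commute:
  assumes "\<alpha> \<in> bounded_profiles p r L" "\<And>j. \<alpha> j + N \<le> L" "\<beta> \<in> bounded_profiles p r L"
  shows "kernel_mult (bounded_profiles p r L) (V_chain L 0 x N) (D_chain L M) \<alpha> \<beta> =
    kernel_mult (bounded_profiles p r L) (D_chain L M) (V_chain L M x N) \<alpha> \<beta>"
  using assms(2,3)
proof (induction N arbitrary: \<beta>)
  case 0
  then show ?case
    using assms(1) by (simp add: kernel_mult_id_left kernel_mult_id_right)
next
  case (Suc N)
  let ?S = "bounded_profiles p r L"
  have "kernel_mult ?S (V_chain L 0 x (Suc N)) (D_chain L M) \<alpha> \<beta> =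
      kernel_mult ?S (V_chain L 0 x N) (kernel_mult ?S (V 0 (x (Suc N))) (D_chain L M)) \<alpha> \<beta>"
    by (simp add: kernel_mult_assoc)
  also have "\<dots> = kernel_mult ?S (V_chain L 0 x N) (kernel_mult ?S (D_chain L M) (V M (x (Suc N)))) \<alpha> \<beta>"
  proof (rule kernel_mult_right_cong)
    fix \<gamma> assume \<gamma>: "\<gamma> \<in> ?S" "V_chain L 0 x N \<alpha> \<gamma> \<noteq> 0"
    have "\<gamma> j < L" for j
      using V_chain_nonzero[OF \<gamma>(2,1), of j] Suc.prems(1)[of j] by simp
    then show "kernel_mult ?S (V 0 (x (Suc N))) (D_chain L M) \<gamma> \<beta> =
        kernel_mult ?S (D_chain L M) (V M (x (Suc N))) \<gamma> \<beta>"
      using V_D_chain_commute \<gamma>(1) Suc.prems(2) by blast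
  qed
  also have "\<dots> = kernel_mult ?S (kernel_mult ?S (V_chain L 0 x N) (D_chain L M)) (V M (x (Suc N))) \<alpha> \<beta>"
    by (simp add: kernel_mult_assoc)
  also have "\<dots> = kernel_mult ?S (kernel_mult ?S (D_chain L M) (V_chain L M x N)) (V M (x (Suc N))) \<alpha> \<beta>"
  proof (rule kernel_mult_left_cong)
    fix \<gamma> assume \<gamma>: "\<gamma> \<in> ?S"
    have "\<alpha> j + N \<le> L" for j using Suc.prems(1)[of j] by simp
    then show "kernel_mult ?S (V_chain L 0 x N) (D_chain L M) \<alpha> \<gamma> =
        kernel_mult ?S (D_chain L M) (V_chain L M x N) \<alpha> \<gamma>"
      by (rule Suc.IH[OF _ \<gamma>])
  qed
  also have "\<dots> = kernel_mult ?S (D_chain L M) (V_chain L M x (Suc N)) \<alpha> \<beta>"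
    by (simp add: kernel_mult_assoc)
  finally show ?case .
qed

section \<open>H transposed as the inverse of D\<close>

text \<open>The sum runs over the first argument of both kernels, and for given \<nu> each column of
  the summation profile has only the two candidates \<open>\<nu> j\<close> and
  \<open>\<nu> j - 1\<close>. If \<nu> and \<delta> differ, the two terms cancel, or both vanish, in
  the first column where they do.\<close>

lemma sum_H_D:
  assumes \<nu>: "\<nu> \<in> bounded_profiles p r L" and \<delta>: "\<delta> \<in> bounded_profiles p r L"
  shows "(\<Sum>\<sigma>\<in>bounded_profiles p r L. H m \<sigma> \<nu> * D m \<sigma> \<delta>) = (if \<nu> = \<delta> then 1 else 0)"
proof -
  let ?P = "\<lambda>j u. (\<nu> j \<noteq> u \<longrightarrow> m \<le> u) \<and> \<delta> j \<le> u \<and> (p < j \<longrightarrow> u \<le> \<delta> (j - 1)) \<and> (\<delta> j < u \<longrightarrow> m \<le> \<delta> j)"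
  let ?B = "\<lambda>j. {u. (\<nu> j = u \<or> \<nu> j = Suc u) \<and> ?P j u}"
  let ?f = "\<lambda>j u. (if \<nu> j = u then 1 else w m) * (- w m) ^ (u - \<delta> j)"
  have iff: "\<sigma> \<in> zero_extended p r ?B \<longleftrightarrow> \<sigma> \<in> bounded_profiles p r L \<and> (\<forall>j\<in>J. \<nu> j = \<sigma> j \<or> \<nu> j = Suc (\<sigma> j) \<and> m \<le> \<sigma> j) \<and>
      (\<forall>j\<in>J. \<sigma> (Suc j) \<le> \<delta> j \<and> \<delta> j \<le> \<sigma> j \<and> (\<delta> j < \<sigma> j \<longrightarrow> m \<le> \<delta> j))" (is "?l \<longleftrightarrow> ?r") for \<sigma>
  proof
    assume ?l
    then have 1: "\<And>j. j \<in> J \<Longrightarrow> \<sigma> j \<in> ?B j" "\<And>j. j \<notin> J \<Longrightarrow> \<sigma> j = 0"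
      by (auto simp: zero_extended_def)
    have 2: "\<sigma> (Suc j) \<le> \<delta> j" if "j \<in> J" for j
      using 1(1)[of "Suc j"] 1(2)[of "Suc j"] that by (cases "Suc j < r") auto
    have "\<sigma> (Suc j) \<le> \<sigma> j" if "p \<le> j" for j
      using 1(1)[of j] 1(2)[of "Suc j"] 2[of j] that by (cases "j < r") auto
    moreover have "\<sigma> j \<le> L" for j
      using 1(1)[of j] 1(2)[of j] bounded_profilesD(2)[OF \<nu>, of j] by (cases "j \<in> J") auto
    moreover have "\<nu> j = \<sigma> j \<or> \<nu> j = Suc (\<sigma> j) \<and> m \<le> \<sigma> j" if "j \<in> J" for j
      using 1(1)[OF that] by auto
    ultimately show ?r
      using 1 2 by (auto simp: bounded_profiles_def profiles_def)
  next
    assume ?r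
    then have *: "\<And>j. j \<in> J \<Longrightarrow> \<sigma> (Suc j) \<le> \<delta> j" by auto
    have "\<sigma> j \<le> \<delta> (j - 1)" if "j \<in> J" "p < j" for j
      using *[of "j - 1"] that by (cases j) auto
    with \<open>?r\<close> show ?l
      by (auto simp: zero_extended_def bounded_profiles_def profiles_def)
  qed
  have "(\<Sum>\<sigma>\<in>bounded_profiles p r L. H m \<sigma> \<nu> * D m \<sigma> \<delta>) =
      (\<Sum>\<sigma>\<in>zero_extended p r ?B. \<Prod>j\<in>J. ?f j (\<sigma> j))"
  proof (rule sum.mono_neutral_cong_right)
    fix \<sigma> assume "\<sigma> \<in> zero_extended p r ?B"
    then show "H m \<sigma> \<nu> * D m \<sigma> \<delta> = (\<Prod>j\<in>J. ?f j (\<sigma> j))"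
      unfolding iff H_def D_def by (simp add: prod.distrib)
  qed (use iff in \<open>auto simp: H_def D_def\<close>)
  also have "\<dots> = (\<Prod>j\<in>J. \<Sum>u\<in>?B j. ?f j u)"
    by (rule sum_prod_zero_extended[OF pr]) (auto intro: finite_subset[of _ "{.._}"])
  also have "\<dots> = (\<Prod>j\<in>J. (if ?P j (\<nu> j) then (- w m) ^ (\<nu> j - \<delta> j) else 0) +
      (if \<nu> j \<noteq> 0 \<and> ?P j (\<nu> j - 1) then w m * (- w m) ^ (\<nu> j - 1 - \<delta> j) else 0))" (is "_ = (\<Prod>j\<in>J. ?g j)")
    unfolding sum_pair' by (intro prod.cong[OF refl] arg_cong2[of _ _ _ _ "(+)"] if_cong) auto
  also have "\<dots> = (if \<nu> = \<delta> then 1 else 0)"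
  proof (cases "\<nu> = \<delta>")
    case True
    have "\<delta> j \<le> \<delta> (j - 1)" if "j \<in> J" "p < j" for j
      using profiles_antimono[OF bounded_profilesD(1)[OF \<delta>], of "j - 1" j] that by auto
    then have "?g j = 1" if "j \<in> J" for j
      using True that by auto
    then show ?thesis using True by simp
  next
    case False
    then obtain i where "\<nu> i \<noteq> \<delta> i" by blast
    \<comment> \<open>In the leftmost differing column the constraint by
      \<open>\<delta> (j - 1)\<close> is automatic, because
      \<open>\<delta> (j - 1) = \<nu> (j - 1) \<ge> \<nu> j\<close>. Further to the right it could
      suppress just one of the two cancelling terms.\<close>
    define j where "j = (LEAST i. \<nu> i \<noteq> \<delta> i)"
    have j: "\<nu> j \<noteq> \<delta> j" "\<And>i. i < j \<Longrightarrow> \<nu> i = \<delta> i"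
      unfolding j_def using LeastI[of "\<lambda>i. \<nu> i \<noteq> \<delta> i", OF \<open>\<nu> i \<noteq> \<delta> i\<close>] not_less_Least
    by blast+
    have jJ: "j \<in> J"
      using j(1) profiles_outside[OF bounded_profilesD(1)[OF \<nu>]] profiles_outside[OF bounded_profilesD(1)[OF \<delta>]]
      by metis
    have le: "p < j \<Longrightarrow> \<nu> j \<le> \<delta> (j - 1)"
      using profiles_antimono[OF bounded_profilesD(1)[OF \<nu>], of "j - 1" j] j(2)[of "j - 1"] jJ by auto
    have "?g j = 0"
    proof (cases "\<delta> j < \<nu> j")
      case True
      then have "\<nu> j - \<delta> j = Suc (\<nu> j - 1 - \<delta> j)" by simp
      then show ?thesis using le True by auto
    qed (use j(1) in auto)
    then show ?thesis
      using False jJ by (metis (no_types, lifting) finite_atLeastLessThan prod_zero)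
  qed
  finally show ?thesis .
qed

text \<open>Both chains start at the summation profile with their kernels of index 1, so the pairs
  of equal index cancel from the inside outwards.\<close>

lemma sum_H_chain_D_chain:
  assumes "\<nu> \<in> bounded_profiles p r L" "\<delta> \<in> bounded_profiles p r L"
  shows "(\<Sum>\<alpha>\<in>bounded_profiles p r L. H_chain L M \<alpha> \<nu> * D_chain L M \<alpha> \<delta>) = (if \<nu> = \<delta> then 1 else 0)"
  using assms
proof (induction M arbitrary: \<nu> \<delta>)
  case 0
  then show ?case by (simp add: if_distrib[of "\<lambda>x. x * _"] cong: if_cong)
next
  case (Suc M)
  let ?S = "bounded_profiles p r L"
  have "(\<Sum>\<alpha>\<in>?S. H_chain L (Suc M) \<alpha> \<nu> * D_chain L (Suc M) \<alpha> \<delta>) =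
      (\<Sum>\<alpha>\<in>?S. \<Sum>\<sigma>\<in>?S. \<Sum>\<gamma>\<in>?S. (H_chain L M \<alpha> \<sigma> * D_chain L M \<alpha> \<gamma>) * (H (Suc M) \<sigma> \<nu> * D (Suc M) \<gamma> \<delta>))"
    unfolding chain.simps kernel_mult_def sum_product by (intro sum.cong refl) (simp only: mult_ac)
  also have "\<dots> = (\<Sum>\<sigma>\<in>?S. \<Sum>\<gamma>\<in>?S. \<Sum>\<alpha>\<in>?S. (H_chain L M \<alpha> \<sigma> * D_chain L M \<alpha> \<gamma>) * (H (Suc M) \<sigma> \<nu> * D (Suc M) \<gamma> \<delta>))"
    by (subst sum.swap, rule sum.cong[OF refl], rule sum.swap)
  also have "\<dots> = (\<Sum>\<sigma>\<in>?S. \<Sum>\<gamma>\<in>?S. (if \<sigma> = \<gamma> then 1 else 0) * (H (Suc M) \<sigma> \<nu> * D (Suc M) \<gamma> \<delta>))"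
    by (intro sum.cong refl) (simp add: Suc.IH flip: sum_distrib_right)
  also have "\<dots> = (\<Sum>\<sigma>\<in>?S. H (Suc M) \<sigma> \<nu> * D (Suc M) \<sigma> \<delta>)"
    by (simp add: if_distrib[of "\<lambda>x. x * _"] cong: if_cong)
  also have "\<dots> = (if \<nu> = \<delta> then 1 else 0)"
    by (rule sum_H_D[OF Suc.prems])
  finally show ?case .
qed

section \<open>Forgetting the heights hidden above the upper boundary\<close>

text \<open>The monomial of the boxes between \<beta> and \<open>t\<close> when each is labelled by
  its own row. Columns where \<beta> reaches \<open>t\<close> or goes below it contribute 1.\<close>

definition row_weight :: "(nat \<Rightarrow> nat) \<Rightarrow> (nat \<Rightarrow> nat) \<Rightarrow> 'a" where
  "row_weight t \<beta> = (\<Prod>j\<in>J. \<Prod>i\<in>{\<beta> j<..t j}. w i)"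

text \<open>
  Summing over the heights that are hidden above t removes exactly the factors \<open>1 - x w\<close> that
  \<open>V\<close> has and \<open>V_above t\<close> lacks: in a column with \<open>b j \<le> t j\<close> the two possible heights
  \<open>b j\<close> and \<open>b j - 1\<close> contribute \<open>1 - x w\<close> and \<open>x w\<close>.
\<close>

lemma sum_row_weight_V:
  assumes t: "t \<in> bounded_profiles p r L" and \<gamma>: "\<gamma> \<in> bounded_profiles p r L" "t \<le> \<gamma>"
    and b: "b \<in> bounded_profiles p r L" and M: "L \<le> M"
  shows "(\<Sum>\<beta> | \<beta> \<in> bounded_profiles p r L \<and> sup t \<beta> = \<gamma>. row_weight t \<beta> * V M x \<beta> b) =
    row_weight t b * V_above t x \<gamma> (sup t b)"
proof -
  note tp = bounded_profilesD(1)[OF t] and gp = bounded_profilesD(1)[OF \<gamma>(1)] and bp = bounded_profilesD(1)[OF b]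
  let ?B = "\<lambda>j. {u. (b j = u \<or> b j = Suc u) \<and> max (t j) u = \<gamma> j}"
  let ?h = "\<lambda>j u v. (\<Prod>i\<in>{u<..t j}. w i) * (if b j = u then 1 - (if v < u then x * w u else 0) else x)"
  \<comment> \<open>The monotonicity \<open>v \<le> u\<close> of the profile moves into the summand.
    The sum may then range over all zero-extended functions, and it remains to see that the sum over
    one column does not depend on the height v of the next.\<close>
  let ?f = "\<lambda>j u v. if v \<le> u then ?h j u v else 0"
  let ?c = "\<lambda>j. (\<Prod>i\<in>{b j<..t j}. w i) * (if max (t j) (b j) = \<gamma> j
      then 1 - (if \<gamma> (Suc j) < \<gamma> j \<and> t j < \<gamma> j then x * w (\<gamma> j) else 0)
      else if max (t j) (b j) = Suc (\<gamma> j) then x else 0)"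
  have bL: "\<beta> j \<le> L" if "\<beta> \<in> zero_extended p r ?B" for \<beta> j
  proof (cases "j \<in> J")
    case True
    then have "\<beta> j \<in> ?B j" using that by (simp add: zero_extended_def)
    then show ?thesis using bounded_profilesD(2)[OF b, of j] by auto
  next
    case False
    then show ?thesis using that by (simp add: zero_extended_def)
  qed
  have iff: "\<beta> \<in> bounded_profiles p r L \<and> sup t \<beta> = \<gamma> \<and> (\<forall>j\<in>J. b j = \<beta> j \<or> b j = Suc (\<beta> j)) \<longleftrightarrow>
      \<beta> \<in> zero_extended p r ?B \<and> (\<forall>j\<in>J. \<beta> (Suc j) \<le> \<beta> j)" (is "?l \<longleftrightarrow> ?r") for \<beta>
  proof
    assume ?l
    then show ?r
      by (auto simp: zero_extended_def bounded_profiles_def profiles_def sup_fun_def sup_max)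
  next
    assume ?r
    then have 1: "\<And>j. j \<in> J \<Longrightarrow> \<beta> j \<in> ?B j" "\<And>j. j \<notin> J \<Longrightarrow> \<beta> j = 0" "\<And>j. j \<in> J \<Longrightarrow> \<beta> (Suc j) \<le> \<beta> j"
      by (auto simp: zero_extended_def)
    have "sup (t j) (\<beta> j) = \<gamma> j" for j
      using 1(1,2)[of j] profiles_outside[OF tp, of j] profiles_outside[OF gp, of j]
      by (cases "j \<in> J") (auto simp: sup_max)
    moreover have "\<beta> (Suc j) \<le> \<beta> j" if "p \<le> j" for j
      using 1(2)[of "Suc j"] 1(3)[of j] that by (cases "j < r") auto
    ultimately show ?l
      using 1 \<open>?r\<close> bL[of \<beta>] by (auto simp: bounded_profiles_def profiles_def)
  qed
  have "(\<Sum>\<beta> | \<beta> \<in> bounded_profiles p r L \<and> sup t \<beta> = \<gamma>. row_weight t \<beta> * V M x \<beta> b) =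
      (\<Sum>\<beta> | \<beta> \<in> zero_extended p r ?B \<and> (\<forall>j\<in>J. \<beta> (Suc j) \<le> \<beta> j). \<Prod>j\<in>J. ?f j (\<beta> j) (\<beta> (Suc j)))"
  proof (rule sum.mono_neutral_cong_right)
    show "\<forall>\<beta>\<in>{\<beta> \<in> bounded_profiles p r L. sup t \<beta> = \<gamma>} - {\<beta> \<in> zero_extended p r ?B. \<forall>j\<in>J. \<beta> (Suc j) \<le> \<beta> j}.
        row_weight t \<beta> * V M x \<beta> b = 0"
    proof
      fix \<beta> assume *: "\<beta> \<in> {\<beta> \<in> bounded_profiles p r L. sup t \<beta> = \<gamma>} - {\<beta> \<in> zero_extended p r ?B. \<forall>j\<in>J. \<beta> (Suc j) \<le> \<beta> j}"
      then have "\<not> (\<forall>j\<in>J. b j = \<beta> j \<or> b j = Suc (\<beta> j))"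
        using iff[of \<beta>] by blast
      then show "row_weight t \<beta> * V M x \<beta> b = 0" unfolding V_def by (simp only: if_False mult_zero_right)
    qed
    fix \<beta> assume *: "\<beta> \<in> {\<beta> \<in> zero_extended p r ?B. \<forall>j\<in>J. \<beta> (Suc j) \<le> \<beta> j}"
    then have "\<beta> \<in> zero_extended p r ?B \<and> (\<forall>j\<in>J. \<beta> (Suc j) \<le> \<beta> j)" by (rule CollectD)
    from iff[THEN iffD2, OF this] have "\<forall>j\<in>J. b j = \<beta> j \<or> b j = Suc (\<beta> j)" by (elim conjE)
    then have "row_weight t \<beta> * V M x \<beta> b = (\<Prod>j\<in>J. \<Prod>i\<in>{\<beta> j<..t j}. w i) *
       (\<Prod>j\<in>J. if b j = \<beta> j then 1 - (if \<beta> (Suc j) < \<beta> j \<and> \<beta> j \<le> M then x * w (\<beta> j) else 0) else x)"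
      by (simp add: V_def row_weight_def)
    also have "\<dots> = (\<Prod>j\<in>J. ?f j (\<beta> j) (\<beta> (Suc j)))"
      unfolding prod.distrib[symmetric]
    proof (rule prod.cong[OF refl])
      fix j assume "j \<in> J"
      moreover have "\<beta> j \<le> M" using bL[of \<beta> j] * M by simp
      ultimately show "(\<Prod>i\<in>{\<beta> j<..t j}. w i) *
          (if b j = \<beta> j then 1 - (if \<beta> (Suc j) < \<beta> j \<and> \<beta> j \<le> M then x * w (\<beta> j) else 0) else x) =
          ?f j (\<beta> j) (\<beta> (Suc j))"
        using * by simp
    qed
    finally show "row_weight t \<beta> * V M x \<beta> b = (\<Prod>j\<in>J. ?f j (\<beta> j) (\<beta> (Suc j)))" .
  next
    show "{\<beta> \<in> zero_extended p r ?B. \<forall>j\<in>J. \<beta> (Suc j) \<le> \<beta> j} \<subseteq> {\<beta> \<in> bounded_profiles p r L. sup t \<beta> = \<gamma>}"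
      using iff by blast
  qed simp
  also have "\<dots> = (\<Sum>\<beta>\<in>zero_extended p r ?B. \<Prod>j\<in>J. ?f j (\<beta> j) (\<beta> (Suc j)))"
  proof (rule sum.mono_neutral_left)
    show "finite (zero_extended p r ?B)"
      by (rule finite_zero_extended) (auto intro: finite_subset[of _ "{.._}"])
    show "\<forall>\<beta>\<in>zero_extended p r ?B - {\<beta> \<in> zero_extended p r ?B. \<forall>j\<in>J. \<beta> (Suc j) \<le> \<beta> j}.
        (\<Prod>j\<in>J. ?f j (\<beta> j) (\<beta> (Suc j))) = 0"
    proof
      fix \<beta> assume "\<beta> \<in> zero_extended p r ?B - {\<beta> \<in> zero_extended p r ?B. \<forall>j\<in>J. \<beta> (Suc j) \<le> \<beta> j}"
      then obtain j where "j \<in> J" "\<not> \<beta> (Suc j) \<le> \<beta> j" by blast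
      then show "(\<Prod>j\<in>J. ?f j (\<beta> j) (\<beta> (Suc j))) = 0"
        by (intro prod_zero bexI[of _ j]) simp_all
    qed
  qed auto
  also have "\<dots> = (\<Prod>j\<in>J. ?c j)"
  proof (rule sum_prod_coupled[OF pr])
    fix j v assume j: "j \<in> J" and v: "v \<in> (if Suc j < r then ?B (Suc j) else {0})"
    have v': "v \<le> b (Suc j)" "max (t (Suc j)) v = \<gamma> (Suc j)"
      using v profiles_outside[OF tp, of "Suc j"] profiles_outside[OF gp, of "Suc j"]
      by (auto split: if_splits)
    have mono: "t (Suc j) \<le> t j" "b (Suc j) \<le> b j" "\<gamma> (Suc j) \<le> \<gamma> j" "t j \<le> \<gamma> j"
      using j tp bp gp \<gamma>(2) by (auto intro: profiles_Suc le_funD)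
    have eq: "(\<Sum>u\<in>?B j. ?f j u v) = (if max (t j) (b j) = \<gamma> j then ?f j (b j) v else 0) +
        (if b j \<noteq> 0 \<and> max (t j) (b j - 1) = \<gamma> j then ?f j (b j - 1) v else 0)"
      by (rule sum_pair')
    show "(\<Sum>u\<in>?B j. ?f j u v) = ?c j"
    proof (cases "t j < \<gamma> j")
      case True
      then have "v < \<gamma> j \<longleftrightarrow> \<gamma> (Suc j) < \<gamma> j" "v \<le> \<gamma> j"
        using v' mono by auto
      then show ?thesis
        unfolding eq using True v' mono by (auto simp: max_def)
    next
      case False
      then have g: "\<gamma> j = t j" using mono by simp
      have vt: "v \<le> t j" using v' mono g by simp
      consider "b j \<le> t j" | "b j = Suc (t j)" | "Suc (t j) < b j" by linarith
      then show ?thesis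
      proof cases
        case 3
        then show ?thesis unfolding eq unfolding g by (auto simp: max_def)
      next
        case 2
        then show ?thesis unfolding eq unfolding g using vt by (auto simp: max_def)
      next
        case 1
        have m: "max (t j) (b j) = t j" "max (t j) (b j - 1) = t j" using 1 by auto
        show ?thesis
        proof (cases "b j")
          case 0
          then have "v = 0" using v' mono by simp
          then show ?thesis unfolding eq unfolding g using 0 m by simp
        next
          case (Suc k)
          have "{k<..t j} = insert (Suc k) {Suc k<..t j}" using 1 Suc by auto
          then have ins: "(\<Prod>i\<in>{k<..t j}. w i) = w (Suc k) * (\<Prod>i\<in>{Suc k<..t j}. w i)"
            by simp
          \<comment> \<open>For \<open>v \<le> k\<close> the term \<open>x * w (Suc k)\<close> of
            height k cancels the defect of height \<open>Suc k\<close>. For \<open>v = Suc k\<close>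
            height k would violate monotonicity, and height \<open>Suc k\<close> has no corner and
            hence no defect. Both cases leave the same value.\<close>
          have "v \<le> k \<or> v = Suc k" using v' mono Suc by auto
          then show ?thesis unfolding eq unfolding g m using Suc
            by (elim disjE) (simp_all add: ins algebra_simps)
        qed
      qed
    qed
  qed (auto intro: finite_subset[of _ "{.._}"])
  also have "\<dots> = row_weight t b * V_above t x \<gamma> (sup t b)"
  proof (cases "\<forall>j\<in>J. max (t j) (b j) = \<gamma> j \<or> max (t j) (b j) = Suc (\<gamma> j)")
    case True
    then have "V_above t x \<gamma> (sup t b) = (\<Prod>j\<in>J. if max (t j) (b j) = \<gamma> j
        then 1 - (if \<gamma> (Suc j) < \<gamma> j \<and> t j < \<gamma> j then x * w (\<gamma> j) else 0) else x)"
      unfolding V_above_def sup_fun_def sup_nat_def by (rule if_P)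
    moreover have "(\<Prod>j\<in>J. ?c j) = (\<Prod>j\<in>J. (\<Prod>i\<in>{b j<..t j}. w i) * (if max (t j) (b j) = \<gamma> j
        then 1 - (if \<gamma> (Suc j) < \<gamma> j \<and> t j < \<gamma> j then x * w (\<gamma> j) else 0) else x))"
    proof (rule prod.cong[OF refl])
      fix j assume "j \<in> J"
      then have "max (t j) (b j) = \<gamma> j \<or> max (t j) (b j) = Suc (\<gamma> j)"
        using True by blast
      then show "?c j = (\<Prod>i\<in>{b j<..t j}. w i) * (if max (t j) (b j) = \<gamma> j
          then 1 - (if \<gamma> (Suc j) < \<gamma> j \<and> t j < \<gamma> j then x * w (\<gamma> j) else 0) else x)"
        by auto
    qed
    ultimately show ?thesis
      by (simp only: row_weight_def prod.distrib)
  next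
    case False
    then have "V_above t x \<gamma> (sup t b) = 0"
      unfolding V_above_def sup_fun_def sup_nat_def by (rule if_not_P)
    moreover from False obtain j where "j \<in> J" "max (t j) (b j) \<noteq> \<gamma> j" "max (t j) (b j) \<noteq> Suc (\<gamma> j)" by blast
    then have "(\<Prod>j\<in>J. ?c j) = 0"
      by (intro prod_zero bexI[of _ j]) simp_all
    ultimately show ?thesis by (simp only: mult_zero_right)
  qed
  finally show ?thesis .
qed

lemma sup_bounded_profiles:
  "s \<in> bounded_profiles p r L \<Longrightarrow> t \<in> bounded_profiles p r L \<Longrightarrow> sup s t \<in> bounded_profiles p r L"
  by (auto simp: bounded_profiles_def profiles_def sup_max)

text \<open>A lumping argument, as for Markov chains: the visible part \<open>sup t \<beta>\<close>
  of a profile evolves by \<open>V_above\<close>, while the hidden part only keeps the total weight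
  \<open>row_weight t\<close>. The bound \<open>L \<le> M\<close> puts all occurring heights under
  the index of \<open>V\<close>, so that every corner is deformed.\<close>

lemma sum_row_weight_V_chain:
  assumes t: "t \<in> bounded_profiles p r L" and b: "b \<in> bounded_profiles p r L" and M: "L \<le> M"
  shows "(\<Sum>\<delta> | \<delta> \<in> bounded_profiles p r L \<and> \<delta> \<le> t. row_weight t \<delta> * V_chain L M x N \<delta> b) =
    row_weight t b * V_above_chain L t x N t (sup t b)"
  using b
proof (induction N arbitrary: b)
  case 0
  have "(\<Sum>\<delta> | \<delta> \<in> bounded_profiles p r L \<and> \<delta> \<le> t. row_weight t \<delta> * (if \<delta> = b then 1 else 0)) =
      (\<Sum>\<delta> | \<delta> \<in> bounded_profiles p r L \<and> \<delta> \<le> t. if \<delta> = b then row_weight t b else 0)"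
    by (rule sum.cong) auto
  also have "\<dots> = (if b \<le> t then row_weight t b else 0)"
    using 0 by (subst sum.delta) auto
  also have "\<dots> = row_weight t b * (if t = sup t b then 1 else 0)"
  proof -
    have "t = sup t b \<longleftrightarrow> b \<le> t"
      using sup.absorb_iff1[of b t] by (simp only: eq_commute[of t])
    then show ?thesis by simp
  qed
  finally show ?case
    unfolding chain.simps(1) .
next
  case (Suc N)
  let ?S = "bounded_profiles p r L"
  let ?F = "V_above_chain L t x N t"
  have "(\<Sum>\<delta> | \<delta> \<in> ?S \<and> \<delta> \<le> t. row_weight t \<delta> * V_chain L M x (Suc N) \<delta> b) =
      (\<Sum>\<beta>\<in>?S. (\<Sum>\<delta> | \<delta> \<in> ?S \<and> \<delta> \<le> t. row_weight t \<delta> * V_chain L M x N \<delta> \<beta>) * V M (x (Suc N)) \<beta> b)"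
    unfolding chain.simps kernel_mult_def sum_distrib_left sum_distrib_right mult.assoc
    by (rule sum.swap)
  also have "\<dots> = (\<Sum>\<beta>\<in>?S. ?F (sup t \<beta>) * (row_weight t \<beta> * V M (x (Suc N)) \<beta> b))"
    by (intro sum.cong refl) (simp only: Suc.IH mult_ac)
  \<comment> \<open>The last intermediate profile is grouped by its visible part, on which alone the
    induction hypothesis depends apart from the weight.\<close>
  also have "\<dots> = (\<Sum>\<gamma> | \<gamma> \<in> ?S \<and> t \<le> \<gamma>. \<Sum>\<beta> | \<beta> \<in> ?S \<and> sup t \<beta> = \<gamma>. ?F (sup t \<beta>) * (row_weight t \<beta> * V M (x (Suc N)) \<beta> b))"
    by (rule sum.group[symmetric]) (use sup_bounded_profiles[OF t] in auto)
  also have "\<dots> = (\<Sum>\<gamma> | \<gamma> \<in> ?S \<and> t \<le> \<gamma>. ?F \<gamma> * (\<Sum>\<beta> | \<beta> \<in> ?S \<and> sup t \<beta> = \<gamma>. row_weight t \<beta> * V M (x (Suc N)) \<beta> b))"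
    unfolding sum_distrib_left by (intro sum.cong refl) auto
  also have "\<dots> = (\<Sum>\<gamma> | \<gamma> \<in> ?S \<and> t \<le> \<gamma>. ?F \<gamma> * (row_weight t b * V_above t (x (Suc N)) \<gamma> (sup t b)))"
    by (intro sum.cong refl) (simp add: sum_row_weight_V[OF t _ _ Suc.prems M])
  also have "\<dots> = (\<Sum>\<gamma>\<in>?S. ?F \<gamma> * (row_weight t b * V_above t (x (Suc N)) \<gamma> (sup t b)))"
  proof (rule sum.mono_neutral_left)
    show "\<forall>\<gamma>\<in>?S - {\<gamma> \<in> ?S. t \<le> \<gamma>}. ?F \<gamma> * (row_weight t b * V_above t (x (Suc N)) \<gamma> (sup t b)) = 0"
    proof
      fix \<gamma> assume "\<gamma> \<in> ?S - {\<gamma> \<in> ?S. t \<le> \<gamma>}"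
      then have "?F \<gamma> = 0" using V_above_chain_nonzero[OF _ t] by blast
      then show "?F \<gamma> * (row_weight t b * V_above t (x (Suc N)) \<gamma> (sup t b)) = 0" by simp
    qed
  qed auto
  also have "\<dots> = row_weight t b * V_above_chain L t x (Suc N) t (sup t b)"
    unfolding chain.simps kernel_mult_def sum_distrib_left by (intro sum.cong refl) (simp only: mult_ac)
  finally show ?case .
qed

text \<open>Read from right to left: D moves to the left through the V steps, and the sum over s
  cancels it against H. What remains is the chain of fully deformed steps from all \<nu> below
  \<open>t\<close>, weighted by \<open>row_weight t\<close>, which lumps to \<open>V_above\<close>.
  The chains of D and H have length L because heights up to L involve the variables up to
  \<open>w L\<close>.\<close>

lemma V_above_chain_expansion:
  assumes t: "t \<in> bounded_profiles p r L" and b: "b \<in> bounded_profiles p r L" and "t \<le> b"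
    and L: "\<And>j. t j + N \<le> L"
  shows "V_above_chain L t x N t b =
    (\<Sum>s\<in>bounded_profiles p r L. \<Sum>c\<in>bounded_profiles p r L.
       (\<Sum>\<nu> | \<nu> \<in> bounded_profiles p r L \<and> \<nu> \<le> t. row_weight t \<nu> * H_chain L L s \<nu>) *
       V_chain L 0 x N s c * D_chain L L c b)"
proof -
  let ?S = "bounded_profiles p r L"
  let ?T = "{\<nu> \<in> ?S. \<nu> \<le> t}"
  let ?A = "\<lambda>s. \<Sum>\<nu>\<in>?T. row_weight t \<nu> * H_chain L L s \<nu>"
  have "(\<Sum>s\<in>?S. \<Sum>c\<in>?S. ?A s * V_chain L 0 x N s c * D_chain L L c b) =
      (\<Sum>s\<in>?S. ?A s * kernel_mult ?S (V_chain L 0 x N) (D_chain L L) s b)"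
    by (simp add: kernel_mult_def sum_distrib_left mult.assoc)
  also have "\<dots> = (\<Sum>s\<in>?S. ?A s * kernel_mult ?S (D_chain L L) (V_chain L L x N) s b)"
  proof (rule sum.cong[OF refl])
    fix s assume s: "s \<in> ?S"
    show "?A s * kernel_mult ?S (V_chain L 0 x N) (D_chain L L) s b =
        ?A s * kernel_mult ?S (D_chain L L) (V_chain L L x N) s b"
    proof (cases "?A s = 0")
      case False
      then obtain \<nu> where "\<nu> \<in> ?T" "H_chain L L s \<nu> \<noteq> 0"
        by (metis (no_types, lifting) mult_zero_right sum.neutral)
      \<comment> \<open>Only profiles s below \<open>t\<close> carry weight, and for them the room
        of N below L required by the commutation is available.\<close>
      then have "s \<le> t" using H_chain_nonzero[of L L s \<nu>] s by force
      then have "s j + N \<le> L" for j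
        using L[of j] le_funD[of s t j] by simp
      then show ?thesis
        by (simp add: V_chain_D_chain_commute[OF s _ b])
    qed simp
  qed
  also have "\<dots> = (\<Sum>s\<in>?S. \<Sum>\<delta>\<in>?S. \<Sum>\<nu>\<in>?T. row_weight t \<nu> * (H_chain L L s \<nu> * D_chain L L s \<delta>) * V_chain L L x N \<delta> b)"
    by (simp add: kernel_mult_def sum_distrib_left sum_distrib_right mult_ac)
  also have "\<dots> = (\<Sum>\<delta>\<in>?S. \<Sum>\<nu>\<in>?T. \<Sum>s\<in>?S. row_weight t \<nu> * (H_chain L L s \<nu> * D_chain L L s \<delta>) * V_chain L L x N \<delta> b)"
    by (subst sum.swap, rule sum.cong[OF refl], rule sum.swap)
  also have "\<dots> = (\<Sum>\<delta>\<in>?S. \<Sum>\<nu>\<in>?T. if \<nu> = \<delta> then row_weight t \<delta> * V_chain L L x N \<delta> b else 0)"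
    by (intro sum.cong refl) (simp add: sum_H_chain_D_chain flip: sum_distrib_right sum_distrib_left)
  also have "\<dots> = (\<Sum>\<nu>\<in>?T. \<Sum>\<delta>\<in>?S. if \<nu> = \<delta> then row_weight t \<delta> * V_chain L L x N \<delta> b else 0)"
    by (rule sum.swap)
  also have "\<dots> = (\<Sum>\<nu>\<in>?T. row_weight t \<nu> * V_chain L L x N \<nu> b)"
    by (intro sum.cong refl) simp
  also have "\<dots> = row_weight t b * V_above_chain L t x N t (sup t b)"
    by (rule sum_row_weight_V_chain[OF t b order.refl])
  also have "row_weight t b = 1"
    using \<open>t \<le> b\<close> by (simp add: row_weight_def le_fun_def)
  finally show ?thesis
    using \<open>t \<le> b\<close> by (simp add: sup_absorb2)
qed

end

section \<open>Regions between profiles\<close>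

definition region :: "(nat \<Rightarrow> nat) \<Rightarrow> (nat \<Rightarrow> nat) \<Rightarrow> box set" where
  "region t b = {(i, j). t j < i \<and> i \<le> b j}"

lemma in_region [simp]: "(i, j) \<in> region t b \<longleftrightarrow> t j < i \<and> i \<le> b j"
  by (simp add: region_def)

lemma region_eq_Sigma:
  assumes "b \<in> profiles p r"
  shows "region t b = prod.swap ` (SIGMA j:{p..<r}. {t j<..b j})"
proof -
  have "j \<in> {p..<r}" if "t j < i" "i \<le> b j" for i j
    using profiles_outside[OF assms, of j] that by force
  then show ?thesis
    by (auto simp: region_def image_iff)
qed

lemma finite_region: "b \<in> profiles p r \<Longrightarrow> finite (region t b)"
  by (simp add: region_eq_Sigma)

lemma region_column: "b \<in> profiles p r \<Longrightarrow> (i, j) \<in> region t b \<Longrightarrow> j \<in> {p..<r}"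
  by (auto simp: region_eq_Sigma)

lemma prod_region:
  assumes "b \<in> profiles p r"
  shows "(\<Prod>x\<in>region t b. f x) = (\<Prod>j=p..<r. \<Prod>i\<in>{t j<..b j}. f (i, j))"
proof -
  have "(\<Prod>x\<in>region t b. f x) = (\<Prod>x\<in>(SIGMA j:{p..<r}. {t j<..b j}). f (prod.swap x))"
    unfolding region_eq_Sigma[OF assms] by (subst prod.reindex) (auto simp: inj_on_def)
  also have "\<dots> = (\<Prod>j=p..<r. \<Prod>i\<in>{t j<..b j}. f (i, j))"
    by (subst prod.Sigma) (auto intro!: prod.cong)
  finally show ?thesis .
qed

lemma region_Diff:
  assumes "t \<le> \<beta>" "\<beta> \<le> b"
  shows "region t b - region t \<beta> = region \<beta> b" "region t b - region \<beta> b = region t \<beta>"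
    "region t \<beta> \<subseteq> region t b" "region \<beta> b \<subseteq> region t b"
proof -
  have "(i, j) \<in> region t b - region t \<beta> \<longleftrightarrow> (i, j) \<in> region \<beta> b"
    "(i, j) \<in> region t b - region \<beta> b \<longleftrightarrow> (i, j) \<in> region t \<beta>"
    "(i, j) \<in> region t \<beta> \<Longrightarrow> (i, j) \<in> region t b" "(i, j) \<in> region \<beta> b \<Longrightarrow> (i, j) \<in> region t b" for i j
    using le_funD[OF assms(1), of j] le_funD[OF assms(2), of j] by auto
  then show "region t b - region t \<beta> = region \<beta> b" "region t b - region \<beta> b = region t \<beta>"
    "region t \<beta> \<subseteq> region t b" "region \<beta> b \<subseteq> region t b"
    by (auto simp only: set_eq_iff subset_iff split_paired_All)
qed

lemma region_inject:
  assumes "region t \<beta> = region t \<gamma>" "t \<le> \<beta>" "t \<le> \<gamma>"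
  shows "\<beta> = \<gamma>"
proof (rule ext)
  fix j
  have "(\<beta> j, j) \<in> region t \<beta> \<longleftrightarrow> (\<beta> j, j) \<in> region t \<gamma>" "(\<gamma> j, j) \<in> region t \<beta> \<longleftrightarrow> (\<gamma> j, j) \<in> region t \<gamma>"
    using assms(1) by auto
  then show "\<beta> j = \<gamma> j"
    using le_funD[OF assms(2), of j] le_funD[OF assms(3), of j] by auto
qed

lemma region_inject':
  assumes "region \<beta> b = region \<gamma> b" "\<beta> \<le> b" "\<gamma> \<le> b"
  shows "\<beta> = \<gamma>"
proof (rule ext)
  fix j
  have "(Suc (\<beta> j), j) \<in> region \<beta> b \<longleftrightarrow> (Suc (\<beta> j), j) \<in> region \<gamma> b"
    "(Suc (\<gamma> j), j) \<in> region \<beta> b \<longleftrightarrow> (Suc (\<gamma> j), j) \<in> region \<gamma> b"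
    using assms(1) by auto
  then show "\<beta> j = \<gamma> j"
    using le_funD[OF assms(2), of j] le_funD[OF assms(3), of j] by auto
qed

lemma region_self [simp]: "region t t = {}"
  by (force simp: region_def)

lemma region_empty_iff: "t \<le> b \<Longrightarrow> region t b = {} \<longleftrightarrow> t = b"
  using region_inject[of t t b] by (metis order_refl region_self)

text \<open>Provides the box through which the labels of two comparable boxes are compared: along
  the upper row, then down the right column.\<close>

lemma region_corner:
  assumes "t \<in> profiles p r" "b \<in> profiles p r" "(i', j') \<in> region t b" "(i, j) \<in> region t b" "i' \<le> i" "j' \<le> j"
  shows "(i', j) \<in> region t b"
proof -
  have "p \<le> j'" using region_column[OF assms(2,3)] by simp
  then have "t j \<le> t j'" by (rule profiles_antimono[OF assms(1) _ assms(6)])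
  then show ?thesis using assms(3-5) by auto
qed

text \<open>This is the passage from tableaux to chains of profiles: the boxes on one side of a
  label threshold form a lower set. The profile records the lowest row of Z in each column, or
  \<open>t j\<close> where Z misses column j.\<close>

lemma lower_set_eq_region:
  assumes t: "t \<in> bounded_profiles p r L" and b: "b \<in> bounded_profiles p r L" and tb: "t \<le> b"
    and Z: "Z \<subseteq> region t b"
    and lower: "\<And>i j i' j'. (i, j) \<in> Z \<Longrightarrow> (i', j') \<in> region t b \<Longrightarrow> i' \<le> i \<Longrightarrow> j' \<le> j \<Longrightarrow> (i', j') \<in> Z"
  obtains \<beta> where "\<beta> \<in> bounded_profiles p r L" "t \<le> \<beta>" "\<beta> \<le> b" "Z = region t \<beta>"
proof -
  define \<beta> where "\<beta> j = Max (insert (t j) {i. (i, j) \<in> Z})" for j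
  have fin: "finite {i. (i, j) \<in> Z}" for j
    using Z by (rule_tac finite_subset[of _ "{..b j}"]) auto
  have tj: "t j \<le> b j" for j using tb by (rule le_funD)
  have cases: "\<beta> j = t j \<or> (\<beta> j, j) \<in> Z" for j
    using Max_in[of "insert (t j) {i. (i, j) \<in> Z}"] fin by (auto simp: \<beta>_def)
  have ge: "i \<le> \<beta> j" if "(i, j) \<in> Z" for i j
    unfolding \<beta>_def using fin that by (intro Max_ge) auto
  have t\<beta>: "t j \<le> \<beta> j" for j
    unfolding \<beta>_def using fin by (intro Max_ge) auto
  have \<beta>b: "\<beta> j \<le> b j" for j
    using cases[of j] Z tj[of j] by auto
  have le: "t \<le> \<beta>" "\<beta> \<le> b" using t\<beta> \<beta>b by (auto simp: le_fun_def)
  have Z_eq: "Z = region t \<beta>"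
  proof safe
    fix i j assume "(i, j) \<in> Z"
    then show "(i, j) \<in> region t \<beta>" using Z ge by auto
  next
    fix i j assume *: "(i, j) \<in> region t \<beta>"
    then have "(\<beta> j, j) \<in> Z" using cases[of j] by auto
    from lower[OF this] show "(i, j) \<in> Z" using * \<beta>b[of j] by auto
  qed
  have "\<beta> (Suc j) \<le> \<beta> j" if "p \<le> j" for j
  proof (rule ccontr)
    assume *: "\<not> \<beta> (Suc j) \<le> \<beta> j"
    have mono: "t (Suc j) \<le> t j" "b (Suc j) \<le> b j"
      using profiles_Suc that t b bounded_profilesD(1) by blast+
    from * have "(\<beta> (Suc j), Suc j) \<in> Z"
      using cases[of "Suc j"] mono t\<beta>[of j] by auto
    \<comment> \<open>The left neighbour of the lowest box in column j + 1 is in the region, since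
      \<open>t j \<le> \<beta> j < \<beta> (Suc j) \<le> b (Suc j) \<le> b j\<close>.\<close>
    from lower[OF this] have "(\<beta> (Suc j), j) \<in> Z"
      using * mono t\<beta>[of j] \<beta>b[of "Suc j"] by auto
    then show False using ge * by auto
  qed
  moreover have "\<beta> j \<le> L" for j
    using \<beta>b[of j] bounded_profilesD(2)[OF b, of j] by simp
  moreover have "\<beta> j = 0" if "j \<notin> {p..<r}" for j
    using \<beta>b[of j] profiles_outside[OF bounded_profilesD(1)[OF b] that] by simp
  ultimately have "\<beta> \<in> bounded_profiles p r L"
    by (auto simp: bounded_profiles_def profiles_def)
  with le Z_eq show ?thesis by (rule_tac that)
qed


section \<open>Splitting tableaux by a label\<close>

text \<open>A filling is determined by the set Z of boxes that do not carry the prescribed label and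
  by its restriction to Z. With a constant \<open>lab\<close> this peels off the largest label; with
  \<open>lab = fst\<close> it peels off the boxes labelled by their own row.\<close>

lemma sum_split_label:
  fixes g :: "'b \<Rightarrow> 'c \<Rightarrow> 'a::comm_semiring_1"
  assumes "finite R" "finite Zs" "\<And>Z. Z \<in> Zs \<Longrightarrow> finite (Y Z)" "\<And>Z. Z \<in> Zs \<Longrightarrow> Z \<subseteq> R"
    and F: "F \<subseteq> extensional R"
      "\<And>T. T \<in> extensional R \<Longrightarrow> T \<in> F \<longleftrightarrow>
         {x \<in> R. T x \<noteq> lab x} \<in> Zs \<and> restrict T {x \<in> R. T x \<noteq> lab x} \<in> Y {x \<in> R. T x \<noteq> lab x}"
    and Y: "\<And>Z T. Z \<in> Zs \<Longrightarrow> T \<in> Y Z \<Longrightarrow> T \<in> extensional Z"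
      "\<And>Z T x. Z \<in> Zs \<Longrightarrow> T \<in> Y Z \<Longrightarrow> x \<in> Z \<Longrightarrow> T x \<noteq> lab x"
  shows "(\<Sum>T\<in>F. \<Prod>x\<in>R. g x (T x)) =
    (\<Sum>Z\<in>Zs. (\<Prod>x\<in>R - Z. g x (lab x)) * (\<Sum>T\<in>Y Z. \<Prod>x\<in>Z. g x (T x)))"
proof -
  let ?Z = "\<lambda>T. {x \<in> R. T x \<noteq> lab x}"
  let ?ext = "\<lambda>(Z, T). \<lambda>x\<in>R. if x \<in> Z then T x else lab x"
  have Z_ext: "?Z (?ext (Z, T)) = Z" and restrict_ext: "restrict (?ext (Z, T)) Z = T"
    if "Z \<in> Zs" "T \<in> Y Z" for Z T
    using assms(4)[OF that(1)] Y[OF that] by (auto simp: fun_eq_iff extensional_def)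
  have "(\<Sum>T\<in>F. \<Prod>x\<in>R. g x (T x)) =
      (\<Sum>(Z, T)\<in>Sigma Zs Y. (\<Prod>x\<in>R - Z. g x (lab x)) * (\<Prod>x\<in>Z. g x (T x)))"
  proof (rule sum.reindex_bij_witness[where j = "\<lambda>T. (?Z T, restrict T (?Z T))" and i = ?ext])
    fix T assume T: "T \<in> F"
    then have ext: "T \<in> extensional R" using F(1) by blast
    show "?ext (?Z T, restrict T (?Z T)) = T"
      using ext by (auto simp: fun_eq_iff extensional_def)
    show "(?Z T, restrict T (?Z T)) \<in> Sigma Zs Y"
      using T F(2)[OF ext] by auto
    have "(\<Prod>x\<in>R. g x (T x)) = (\<Prod>x\<in>R - ?Z T. g x (T x)) * (\<Prod>x\<in>?Z T. g x (T x))"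
      by (rule prod.subset_diff) (use \<open>finite R\<close> in auto)
    then show "(case (?Z T, restrict T (?Z T)) of (Z, T) \<Rightarrow> (\<Prod>x\<in>R - Z. g x (lab x)) * (\<Prod>x\<in>Z. g x (T x))) = (\<Prod>x\<in>R. g x (T x))"
      by (auto intro!: arg_cong2[of _ _ _ _ "(*)"] prod.cong)
  next
    fix ZT assume "ZT \<in> Sigma Zs Y"
    then obtain Z T where ZT: "ZT = (Z, T)" "Z \<in> Zs" "T \<in> Y Z" by blast
    note eqs = Z_ext[OF ZT(2,3)] restrict_ext[OF ZT(2,3)]
    show "(?Z (?ext ZT), restrict (?ext ZT) (?Z (?ext ZT))) = ZT"
      unfolding ZT(1) eqs ..
    have "?ext (Z, T) \<in> extensional R" by simp
    from F(2)[OF this] show "?ext ZT \<in> F"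
      unfolding ZT(1) eqs using ZT(2,3) by blast
  qed
  also have "\<dots> = (\<Sum>Z\<in>Zs. (\<Prod>x\<in>R - Z. g x (lab x)) * (\<Sum>T\<in>Y Z. \<Prod>x\<in>Z. g x (T x)))"
    unfolding sum_distrib_left by (rule sum.Sigma[symmetric]) (use assms in auto)
  finally show ?thesis .
qed

text \<open>\<open>ok k i\<close> permits label k in row i. The instances are no condition for Schur
  functions, \<open>k < i\<close> for the chain of H, and \<open>k \<le> i\<close> for
  row-weakly-bounded tableaux.\<close>

definition bounded_tableaux :: "(nat \<Rightarrow> nat \<Rightarrow> bool) \<Rightarrow> nat \<Rightarrow> box set \<Rightarrow> (box \<Rightarrow> nat) set" where
  "bounded_tableaux ok M \<sigma> = {T \<in> semistandard_tableaux \<sigma>. \<forall>(i, j)\<in>\<sigma>. T (i, j) \<le> M \<and> ok (T (i, j)) i}"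

definition bounded_reverse_tableaux :: "nat \<Rightarrow> box set \<Rightarrow> (box \<Rightarrow> nat) set" where
  "bounded_reverse_tableaux M \<sigma> = {T \<in> reverse_row_strict_tableaux \<sigma>. \<forall>(i, j)\<in>\<sigma>. T (i, j) \<le> M \<and> T (i, j) < i}"

lemma finite_PiE_labels: "finite \<sigma> \<Longrightarrow> A \<subseteq> \<sigma> \<rightarrow>\<^sub>E {1..M::nat} \<Longrightarrow> finite A"
  by (erule finite_subset) (intro finite_PiE, auto)

lemma finite_bounded_tableaux: "finite \<sigma> \<Longrightarrow> finite (bounded_tableaux ok M \<sigma>)"
  by (erule finite_PiE_labels)
     (auto simp: bounded_tableaux_def semistandard_tableaux_def tableaux_def PiE_iff intro: extensional_arb)

lemma finite_bounded_reverse_tableaux: "finite \<sigma> \<Longrightarrow> finite (bounded_reverse_tableaux M \<sigma>)"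
  by (erule finite_PiE_labels)
     (auto simp: bounded_reverse_tableaux_def reverse_row_strict_tableaux_def tableaux_def PiE_iff intro: extensional_arb)

lemma tableaux_no_labels:
  assumes "\<sigma> \<noteq> {}" "\<And>T. T \<in> F \<Longrightarrow> T \<in> tableaux \<sigma> \<and> (\<forall>x\<in>\<sigma>. T x \<le> 0)"
  shows "F = {}"
proof -
  obtain x where "x \<in> \<sigma>" using assms(1) by blast
  then have "T x \<ge> 1 \<and> T x \<le> 0" if "T \<in> F" for T
    using assms(2)[OF that] by (auto simp: tableaux_def PiE_iff)
  then show ?thesis by fastforce
qed

lemma semistandardD:
  assumes "T \<in> semistandard_tableaux \<sigma>"
  shows "T \<in> tableaux \<sigma>" "T \<in> extensional \<sigma>"
    "(i, j) \<in> \<sigma> \<Longrightarrow> (i, j') \<in> \<sigma> \<Longrightarrow> j \<le> j' \<Longrightarrow> T (i, j) \<le> T (i, j')"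
    "(i, j) \<in> \<sigma> \<Longrightarrow> (i', j) \<in> \<sigma> \<Longrightarrow> i < i' \<Longrightarrow> T (i, j) < T (i', j)"
  using assms by (auto simp: semistandard_tableaux_def tableaux_def PiE_iff le_less)

lemma reverse_row_strictD:
  assumes "T \<in> reverse_row_strict_tableaux \<sigma>"
  shows "T \<in> tableaux \<sigma>" "T \<in> extensional \<sigma>"
    "(i, j) \<in> \<sigma> \<Longrightarrow> (i, j') \<in> \<sigma> \<Longrightarrow> j < j' \<Longrightarrow> T (i, j) > T (i, j')"
    "(i, j) \<in> \<sigma> \<Longrightarrow> (i', j) \<in> \<sigma> \<Longrightarrow> i \<le> i' \<Longrightarrow> T (i, j) \<ge> T (i', j)"
  using assms by (auto simp: reverse_row_strict_tableaux_def tableaux_def PiE_iff)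
    (metis nat_less_le order_refl)

lemma semistandard_restrict:
  "T \<in> semistandard_tableaux \<sigma> \<Longrightarrow> Z \<subseteq> \<sigma> \<Longrightarrow> restrict T Z \<in> semistandard_tableaux Z"
  by (auto simp: semistandard_tableaux_def tableaux_def PiE_iff) blast+

lemma reverse_row_strict_restrict:
  "T \<in> reverse_row_strict_tableaux \<sigma> \<Longrightarrow> Z \<subseteq> \<sigma> \<Longrightarrow> restrict T Z \<in> reverse_row_strict_tableaux Z"
  by (auto simp: reverse_row_strict_tableaux_def tableaux_def PiE_iff) blast+

text \<open>Columns of a region have no gaps, so strictness accumulates. Consequently a label
  smaller than its row stays so further up its column, and labels up to N cannot fill a column of
  more than N boxes.\<close>

lemma semistandard_column_growth:
  assumes "T \<in> semistandard_tableaux (region t b)" "(i', j) \<in> region t b" "(i, j) \<in> region t b" "i' \<le> i"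
  shows "T (i', j) + (i - i') \<le> T (i, j)"
  using assms(4,3)
proof (induction i rule: dec_induct)
  case (step i)
  then have "(i, j) \<in> region t b" using assms(2) by auto
  with step semistandardD(4)[OF assms(1) this step.prems] show ?case by auto
qed simp

section \<open>Single-valued tableaux as chains\<close>

context transfer_kernels
begin

text \<open>The common form of the undeformed V and of H: horizontal strips whose boxes lie in rows
  permitted by \<open>ok\<close>.\<close>

definition strip :: "(nat \<Rightarrow> bool) \<Rightarrow> 'a \<Rightarrow> (nat \<Rightarrow> nat) \<Rightarrow> (nat \<Rightarrow> nat) \<Rightarrow> 'a" where
  "strip ok c \<alpha> \<beta> = (if \<forall>j\<in>J. \<beta> j = \<alpha> j \<or> \<beta> j = Suc (\<alpha> j) \<and> ok (Suc (\<alpha> j))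
     then \<Prod>j\<in>J. if \<beta> j = \<alpha> j then 1 else c else 0)"

lemma strip_nonzero:
  assumes "\<alpha> \<in> profiles p r" "strip ok c \<alpha> \<beta> \<noteq> 0"
  shows "\<alpha> \<le> \<beta>"
proof (rule profiles_leI[OF assms(1)])
  fix j assume "j \<in> J"
  then have "\<beta> j = \<alpha> j \<or> \<beta> j = Suc (\<alpha> j)"
    using assms(2) unfolding strip_def by meson
  then show "\<alpha> j \<le> \<beta> j" by auto
qed

lemma V_0_eq_strip: "V 0 x = strip (\<lambda>_. True) x"
  by (intro ext) (auto simp: V_def strip_def intro!: prod.cong)

lemma H_eq_strip: "H m = strip (\<lambda>i. m < i) (w m)"
  by (intro ext) (simp add: H_def strip_def less_Suc_eq_le)

text \<open>Boxes with labels below \<open>Suc M\<close> form a lower set, hence a region from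
  \<open>t\<close> to some \<beta>. Strict columns leave room for at most one box labelled
  \<open>Suc M\<close> in each column, directly below \<beta>.\<close>

lemma sum_bounded_tableaux_Suc:
  assumes t: "t \<in> bounded_profiles p r L" and b: "b \<in> bounded_profiles p r L" and tb: "t \<le> b"
  shows "(\<Sum>T\<in>bounded_tableaux ok (Suc M) (region t b). \<Prod>x\<in>region t b. y (T x)) =
    (\<Sum>\<beta> | \<beta> \<in> bounded_profiles p r L \<and> t \<le> \<beta> \<and> \<beta> \<le> b.
       (\<Sum>T\<in>bounded_tableaux ok M (region t \<beta>). \<Prod>x\<in>region t \<beta>. y (T x)) *
       strip (ok (Suc M)) (y (Suc M)) \<beta> b)"
proof -
  note tp = bounded_profilesD(1)[OF t] and bp = bounded_profilesD(1)[OF b]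
  let ?R = "region t b"
  let ?Bs = "{\<beta> \<in> bounded_profiles p r L. t \<le> \<beta> \<and> \<beta> \<le> b \<and>
    (\<forall>j\<in>J. b j = \<beta> j \<or> b j = Suc (\<beta> j) \<and> ok (Suc M) (Suc (\<beta> j)))}"
  have iff: "T \<in> bounded_tableaux ok (Suc M) ?R \<longleftrightarrow>
         {x \<in> ?R. T x \<noteq> Suc M} \<in> region t ` ?Bs \<and>
         restrict T {x \<in> ?R. T x \<noteq> Suc M} \<in> bounded_tableaux ok M {x \<in> ?R. T x \<noteq> Suc M}"
    (is "?l \<longleftrightarrow> ?r") if ext: "T \<in> extensional ?R" for T
  proof
    assume l: ?l
    then have ss: "T \<in> semistandard_tableaux ?R"
      and le: "\<And>i j. (i, j) \<in> ?R \<Longrightarrow> T (i, j) \<le> Suc M \<and> ok (T (i, j)) i"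
      by (auto simp: bounded_tableaux_def)
    let ?Z = "{x \<in> ?R. T x \<noteq> Suc M}"
    obtain \<beta> where \<beta>: "\<beta> \<in> bounded_profiles p r L" "t \<le> \<beta>" "\<beta> \<le> b" "?Z = region t \<beta>"
    proof (rule lower_set_eq_region[OF t b tb, of ?Z])
      fix i j i' j' assume *: "(i, j) \<in> ?Z" "(i', j') \<in> ?R" "i' \<le> i" "j' \<le> j"
      then have c: "(i', j) \<in> ?R" using region_corner[OF tp bp] by blast
      have "T (i', j') \<le> T (i', j)" using semistandardD(3)[OF ss *(2) c *(4)] .
      also have "\<dots> \<le> T (i, j)" using semistandardD(4)[OF ss c, of i] * by (cases "i = i'") auto
      also have "\<dots> < Suc M" using le[of i j] * by auto
      finally show "(i', j') \<in> ?Z" using * by simp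
    qed auto
    have lab: "T (i, j) = Suc M" if "\<beta> j < i" "i \<le> b j" for i j
    proof -
      have "(i, j) \<in> ?R - ?Z"
        unfolding \<beta>(4) region_Diff(1)[OF \<beta>(2,3)] using that by simp
      then show ?thesis by blast
    qed
    have "b j = \<beta> j \<or> b j = Suc (\<beta> j) \<and> ok (Suc M) (Suc (\<beta> j))" for j
    proof (cases "b j = \<beta> j")
      case False
      then have "\<beta> j < b j" "t j \<le> \<beta> j" using \<beta>(2,3) by (auto simp: le_fun_def nat_less_le)
      moreover have "b j = Suc (\<beta> j)"
      proof (rule ccontr)
        assume "b j \<noteq> Suc (\<beta> j)"
        then have "T (Suc (\<beta> j), j) < T (Suc (Suc (\<beta> j)), j)"
          using \<open>\<beta> j < b j\<close> \<open>t j \<le> \<beta> j\<close> by (intro semistandardD(4)[OF ss]) auto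
        then show False
          using lab[of j "Suc (\<beta> j)"] lab[of j "Suc (Suc (\<beta> j))"] \<open>\<beta> j < b j\<close> \<open>b j \<noteq> Suc (\<beta> j)\<close> by auto
      qed
      ultimately show ?thesis
        using lab[of j "b j"] le[of "b j" j] by auto
    qed simp
    then have "\<beta> \<in> ?Bs" using \<beta> by blast
    then have "?Z \<in> region t ` ?Bs" using \<beta>(4) by blast
    moreover have "restrict T ?Z \<in> bounded_tableaux ok M ?Z"
      using semistandard_restrict[OF ss, of ?Z] le by (fastforce simp: bounded_tableaux_def le_Suc_eq)
    ultimately show ?r ..
  next
    assume ?r
    then obtain \<beta> where \<beta>: "\<beta> \<in> ?Bs" and Z: "{x \<in> ?R. T x \<noteq> Suc M} = region t \<beta>"
      and T: "restrict T (region t \<beta>) \<in> bounded_tableaux ok M (region t \<beta>)"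
      by auto
    have \<beta>': "t j \<le> \<beta> j" "\<beta> j \<le> b j" for j using \<beta> by (auto simp: le_fun_def)
    have \<beta>p: "\<beta> \<in> profiles p r" using \<beta> bounded_profilesD(1) by blast
    have lab: "T (i, j) = Suc M" if "\<beta> j < i" "(i, j) \<in> ?R" for i j
    proof -
      have "(i, j) \<notin> {x \<in> ?R. T x \<noteq> Suc M}" unfolding Z using that by simp
      then show ?thesis using that by simp
    qed
    have T_eq: "restrict T (region t \<beta>) (i, j) = T (i, j)" if "(i, j) \<in> region t \<beta>" for i j
      using that by (rule restrict_apply')
    have ss: "restrict T (region t \<beta>) \<in> semistandard_tableaux (region t \<beta>)"
      using T by (simp add: bounded_tableaux_def)
    have inZ: "T (i, j) \<le> M" "ok (T (i, j)) i" "1 \<le> T (i, j)" if "(i, j) \<in> region t \<beta>" for i j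
      using T semistandardD(1)[OF ss] that T_eq[OF that]
      unfolding bounded_tableaux_def tableaux_def PiE_iff by fastforce+
    have col: "j \<in> J" if "(i, j) \<in> ?R" for i j using region_column[OF bp that] .
    have step: "b j \<le> Suc (\<beta> j)" "b j = Suc (\<beta> j) \<Longrightarrow> ok (Suc M) (Suc (\<beta> j))" if "j \<in> J" for j
      using \<beta> that by fastforce+
    have all: "1 \<le> T (i, j) \<and> T (i, j) \<le> Suc M \<and> ok (T (i, j)) i" if "(i, j) \<in> ?R" for i j
    proof (cases "i \<le> \<beta> j")
      case True
      then show ?thesis using inZ[of i j] that by auto
    next
      case False
      then have "i = Suc (\<beta> j)" "b j = Suc (\<beta> j)" using step(1)[OF col[OF that]] that by auto
      then show ?thesis using lab[of j i] that False step(2)[OF col[OF that]] by auto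
    qed
    have "T (i, j) \<le> T (i, j')" if "(i, j) \<in> ?R" "(i, j') \<in> ?R" "j < j'" for i j j'
    proof (cases "i \<le> \<beta> j'")
      case True
      moreover have "\<beta> j' \<le> \<beta> j"
        using profiles_antimono[OF \<beta>p] col[OF that(1)] that(3) by auto
      ultimately show ?thesis
        using semistandardD(3)[OF ss, of i j j'] T_eq[of i j] T_eq[of i j'] that by auto
    next
      case False
      then show ?thesis using lab[of j' i] all[OF that(1)] that by auto
    qed
    moreover have "T (i, j) < T (i', j)" if "(i, j) \<in> ?R" "(i', j) \<in> ?R" "i < i'" for i i' j
    proof (cases "i' \<le> \<beta> j")
      case True
      then show ?thesis
        using semistandardD(4)[OF ss, of i j i'] T_eq[of i j] T_eq[of i' j] that by auto
    next
      case False
      then show ?thesis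
        using lab[of j i'] inZ(1)[of i j] step(1)[OF col[OF that(1)]] that by auto
    qed
    ultimately show ?l
      using ext all unfolding bounded_tableaux_def semistandard_tableaux_def tableaux_def PiE_iff by auto
  qed
  have "(\<Sum>T\<in>bounded_tableaux ok (Suc M) ?R. \<Prod>x\<in>?R. y (T x)) =
      (\<Sum>Z\<in>region t ` ?Bs. (\<Prod>x\<in>?R - Z. y (Suc M)) * (\<Sum>T\<in>bounded_tableaux ok M Z. \<Prod>x\<in>Z. y (T x)))"
  proof (rule sum_split_label[where lab = "\<lambda>_. Suc M" and g = "\<lambda>_. y" and Y = "bounded_tableaux ok M"])
    show "finite (bounded_tableaux ok M Z)" if "Z \<in> region t ` ?Bs" for Z
      using that by (auto intro!: finite_bounded_tableaux finite_region simp: bounded_profiles_def)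
    show "Z \<subseteq> ?R" if "Z \<in> region t ` ?Bs" for Z
      using that region_Diff(3) by blast
    show "T x \<noteq> Suc M" if "T \<in> bounded_tableaux ok M Z" "x \<in> Z" for Z T x
      using that by (cases x) (fastforce simp: bounded_tableaux_def)
  qed (use iff in \<open>auto simp: finite_region[OF bp] bounded_tableaux_def dest: semistandardD(2)\<close>)
  also have "\<dots> = (\<Sum>\<beta>\<in>?Bs. (\<Prod>x\<in>?R - region t \<beta>. y (Suc M)) *
      (\<Sum>T\<in>bounded_tableaux ok M (region t \<beta>). \<Prod>x\<in>region t \<beta>. y (T x)))"
    by (rule sum.reindex[unfolded comp_def]) (auto intro!: inj_onI dest: region_inject)
  also have "\<dots> = (\<Sum>\<beta>\<in>?Bs. (\<Sum>T\<in>bounded_tableaux ok M (region t \<beta>). \<Prod>x\<in>region t \<beta>. y (T x)) *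
      strip (ok (Suc M)) (y (Suc M)) \<beta> b)"
  proof (rule sum.cong[OF refl])
    fix \<beta> assume \<beta>: "\<beta> \<in> ?Bs"
    then have "(\<Prod>x\<in>?R - region t \<beta>. y (Suc M)) = (\<Prod>j\<in>J. \<Prod>i\<in>{\<beta> j<..b j}. y (Suc M))"
      using prod_region[OF bp, of "\<lambda>_. y (Suc M)" \<beta>] by (simp add: region_Diff del: prod_constant)
    also have "\<dots> = strip (ok (Suc M)) (y (Suc M)) \<beta> b"
      using \<beta> unfolding strip_def by (auto intro!: prod.cong)
    finally show "(\<Prod>x\<in>?R - region t \<beta>. y (Suc M)) * (\<Sum>T\<in>bounded_tableaux ok M (region t \<beta>). \<Prod>x\<in>region t \<beta>. y (T x)) =
      (\<Sum>T\<in>bounded_tableaux ok M (region t \<beta>). \<Prod>x\<in>region t \<beta>. y (T x)) * strip (ok (Suc M)) (y (Suc M)) \<beta> b"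
      by (simp only: mult.commute)
  qed
  also have "\<dots> = (\<Sum>\<beta> | \<beta> \<in> bounded_profiles p r L \<and> t \<le> \<beta> \<and> \<beta> \<le> b.
       (\<Sum>T\<in>bounded_tableaux ok M (region t \<beta>). \<Prod>x\<in>region t \<beta>. y (T x)) *
       strip (ok (Suc M)) (y (Suc M)) \<beta> b)"
  proof (rule sum.mono_neutral_left)
    show "\<forall>\<beta>\<in>{\<beta>. \<beta> \<in> bounded_profiles p r L \<and> t \<le> \<beta> \<and> \<beta> \<le> b} - ?Bs.
       (\<Sum>T\<in>bounded_tableaux ok M (region t \<beta>). \<Prod>x\<in>region t \<beta>. y (T x)) *
       strip (ok (Suc M)) (y (Suc M)) \<beta> b = 0"
    proof
      fix \<beta> assume "\<beta> \<in> {\<beta>. \<beta> \<in> bounded_profiles p r L \<and> t \<le> \<beta> \<and> \<beta> \<le> b} - ?Bs"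
      then have "\<not> (\<forall>j\<in>J. b j = \<beta> j \<or> b j = Suc (\<beta> j) \<and> ok (Suc M) (Suc (\<beta> j)))" by blast
      then have "strip (ok (Suc M)) (y (Suc M)) \<beta> b = 0"
        unfolding strip_def by (rule if_not_P)
      then show "(\<Sum>T\<in>bounded_tableaux ok M (region t \<beta>). \<Prod>x\<in>region t \<beta>. y (T x)) *
       strip (ok (Suc M)) (y (Suc M)) \<beta> b = 0" by simp
    qed
  qed auto
  finally show ?thesis .
qed

lemma strip_chain_eq_tableaux:
  assumes t: "t \<in> bounded_profiles p r L" and "b \<in> bounded_profiles p r L" and "t \<le> b"
  shows "chain (bounded_profiles p r L) (\<lambda>k. strip (ok k) (y k)) M t b =
    (\<Sum>T\<in>bounded_tableaux ok M (region t b). \<Prod>x\<in>region t b. y (T x))"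
  using assms(2,3)
proof (induction M arbitrary: b)
  case 0
  show ?case
  proof (cases "t = b")
    case True
    then have "region t b = {}" by simp
    moreover have "bounded_tableaux ok 0 {} = {\<lambda>x. undefined}"
      by (auto simp: bounded_tableaux_def semistandard_tableaux_def tableaux_def)
    ultimately show ?thesis using True by simp
  next
    case False
    then have "region t b \<noteq> {}" using region_empty_iff[OF \<open>t \<le> b\<close>] by simp
    then have "bounded_tableaux ok 0 (region t b) = {}"
      by (rule tableaux_no_labels) (auto simp: bounded_tableaux_def semistandard_tableaux_def)
    then show ?thesis using False by simp
  qed
next
  case (Suc M)
  let ?S = "bounded_profiles p r L"
  let ?K = "\<lambda>k. strip (ok k) (y k)"
  have "chain ?S ?K (Suc M) t b = (\<Sum>\<beta>\<in>?S. chain ?S ?K M t \<beta> * ?K (Suc M) \<beta> b)"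
    by (simp add: kernel_mult_def)
  also have "\<dots> = (\<Sum>\<beta> | \<beta> \<in> ?S \<and> t \<le> \<beta> \<and> \<beta> \<le> b. chain ?S ?K M t \<beta> * ?K (Suc M) \<beta> b)"
  proof (rule sum.mono_neutral_right)
    show "\<forall>\<beta>\<in>?S - {\<beta>. \<beta> \<in> ?S \<and> t \<le> \<beta> \<and> \<beta> \<le> b}. chain ?S ?K M t \<beta> * ?K (Suc M) \<beta> b = 0"
    proof
      fix \<beta> assume \<beta>: "\<beta> \<in> ?S - {\<beta>. \<beta> \<in> ?S \<and> t \<le> \<beta> \<and> \<beta> \<le> b}"
      show "chain ?S ?K M t \<beta> * ?K (Suc M) \<beta> b = 0"
      proof (rule ccontr)
        assume "chain ?S ?K M t \<beta> * ?K (Suc M) \<beta> b \<noteq> 0"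
        then have "chain ?S ?K M t \<beta> \<noteq> 0" "?K (Suc M) \<beta> b \<noteq> 0" by auto
        moreover from this(1) have "t \<le> \<beta>"
        proof (rule chain_nonzero[rotated 3])
          show "\<alpha> \<le> \<beta>" if "\<alpha> \<in> ?S" "strip (ok k) (y k) \<alpha> \<beta> \<noteq> 0" for k \<alpha> \<beta>
            using strip_nonzero bounded_profilesD(1) that by blast
        qed (use t \<beta> in \<open>auto intro: reflpI transpI\<close>)
        ultimately show False
          using \<beta> strip_nonzero bounded_profilesD(1) by blast
      qed
    qed
  qed auto
  also have "\<dots> = (\<Sum>T\<in>bounded_tableaux ok (Suc M) (region t b). \<Prod>x\<in>region t b. y (T x))"
    unfolding sum_bounded_tableaux_Suc[OF t Suc.prems]
    by (rule sum.cong[OF refl]) (use Suc.IH in simp)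
  finally show ?case .
qed

text \<open>The deficit \<open>i - T (i, j)\<close> weakly decreases along rows and down columns,
  because a column grows by at least one per row. So the boxes with positive deficit form a lower
  set, where labels are smaller than the row, and the others are labelled by their row and
  contribute \<open>row_weight\<close>.\<close>

lemma sum_row_weakly_bounded:
  assumes s: "s \<in> bounded_profiles p r L" and t: "t \<in> bounded_profiles p r L" and st: "s \<le> t"
  shows "(\<Sum>T | T \<in> semistandard_tableaux (region s t) \<and> row_weakly_bounded (region s t) T. \<Prod>x\<in>region s t. w (T x)) =
    (\<Sum>\<nu> | \<nu> \<in> bounded_profiles p r L \<and> s \<le> \<nu> \<and> \<nu> \<le> t. row_weight t \<nu> *
       (\<Sum>T\<in>bounded_tableaux (\<lambda>k i. k < i) L (region s \<nu>). \<Prod>x\<in>region s \<nu>. w (T x)))"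
proof -
  note sp = bounded_profilesD(1)[OF s] and tp = bounded_profilesD(1)[OF t]
  let ?R = "region s t"
  let ?Y = "bounded_tableaux (\<lambda>k i. k < i) L"
  let ?F = "{T \<in> semistandard_tableaux ?R. row_weakly_bounded ?R T}"
  let ?Bs = "{\<beta> \<in> bounded_profiles p r L. s \<le> \<beta> \<and> \<beta> \<le> t}"
  have iff: "T \<in> ?F \<longleftrightarrow> {x \<in> ?R. T x \<noteq> fst x} \<in> region s ` ?Bs \<and>
         restrict T {x \<in> ?R. T x \<noteq> fst x} \<in> ?Y {x \<in> ?R. T x \<noteq> fst x}"
    (is "?l \<longleftrightarrow> ?r") if ext: "T \<in> extensional ?R" for T
  proof
    assume l: ?l
    then have ss: "T \<in> semistandard_tableaux ?R"
      and le: "\<And>i j. (i, j) \<in> ?R \<Longrightarrow> T (i, j) \<le> i"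
      by (auto simp: row_weakly_bounded_def)
    let ?Z = "{x \<in> ?R. T x \<noteq> fst x}"
    obtain \<beta> where \<beta>: "\<beta> \<in> bounded_profiles p r L" "s \<le> \<beta>" "\<beta> \<le> t" "?Z = region s \<beta>"
    proof (rule lower_set_eq_region[OF s t st, of ?Z])
      fix i j i' j' assume *: "(i, j) \<in> ?Z" "(i', j') \<in> ?R" "i' \<le> i" "j' \<le> j"
      then have c: "(i', j) \<in> ?R" using region_corner[OF sp tp] by blast
      have "T (i', j') \<le> T (i', j)" using semistandardD(3)[OF ss *(2) c *(4)] .
      also have "T (i', j) + (i - i') \<le> T (i, j)"
        using * by (intro semistandard_column_growth[OF ss c]) auto
      then have "T (i', j) < i'" using le[of i j] * by auto
      finally show "(i', j') \<in> ?Z" using * by simp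
    qed auto
    have "T (i, j) \<le> L" if "(i, j) \<in> ?R" for i j
      using le[OF that] that bounded_profilesD(2)[OF t, of j] by simp
    then have "restrict T ?Z \<in> ?Y ?Z"
      using semistandard_restrict[OF ss, of ?Z] le by (fastforce simp: bounded_tableaux_def nat_less_le)
    then show ?r using \<beta> by blast
  next
    assume ?r
    then obtain \<beta> where \<beta>: "\<beta> \<in> ?Bs" and Z: "{x \<in> ?R. T x \<noteq> fst x} = region s \<beta>"
      and T: "restrict T (region s \<beta>) \<in> ?Y (region s \<beta>)"
      by auto
    have \<beta>': "s j \<le> \<beta> j" "\<beta> j \<le> t j" for j using \<beta> by (auto simp: le_fun_def)
    have \<beta>p: "\<beta> \<in> profiles p r" using \<beta> bounded_profilesD(1) by blast
    have lab: "T (i, j) = i" if "\<beta> j < i" "(i, j) \<in> ?R" for i j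
    proof -
      have "(i, j) \<notin> {x \<in> ?R. T x \<noteq> fst x}" unfolding Z using that by simp
      then show ?thesis using that by simp
    qed
    have T_eq: "restrict T (region s \<beta>) (i, j) = T (i, j)" if "(i, j) \<in> region s \<beta>" for i j
      using that by (rule restrict_apply')
    have ss: "restrict T (region s \<beta>) \<in> semistandard_tableaux (region s \<beta>)"
      using T by (simp add: bounded_tableaux_def)
    have inZ: "T (i, j) < i" "1 \<le> T (i, j)" if "(i, j) \<in> region s \<beta>" for i j
      using T semistandardD(1)[OF ss] that T_eq[OF that]
      unfolding bounded_tableaux_def tableaux_def PiE_iff by fastforce+
    have all: "1 \<le> T (i, j) \<and> T (i, j) \<le> i" if "(i, j) \<in> ?R" for i j
    proof (cases "i \<le> \<beta> j")
      case True
      then show ?thesis using inZ[of i j] that by auto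
    next
      case False
      then show ?thesis using lab[of j i] that by auto
    qed
    have "T (i, j) \<le> T (i, j')" if "(i, j) \<in> ?R" "(i, j') \<in> ?R" "j < j'" for i j j'
    proof (cases "i \<le> \<beta> j'")
      case True
      moreover have "\<beta> j' \<le> \<beta> j"
        using profiles_antimono[OF \<beta>p] region_column[OF tp that(1)] that(3) by auto
      ultimately show ?thesis
        using semistandardD(3)[OF ss, of i j j'] T_eq[of i j] T_eq[of i j'] that by auto
    next
      case False
      then show ?thesis using lab[of j' i] all[OF that(1)] that by auto
    qed
    moreover have "T (i, j) < T (i', j)" if "(i, j) \<in> ?R" "(i', j) \<in> ?R" "i < i'" for i i' j
    proof (cases "i' \<le> \<beta> j")
      case True
      then show ?thesis
        using semistandardD(4)[OF ss, of i j i'] T_eq[of i j] T_eq[of i' j] that by auto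
    next
      case False
      then show ?thesis
        using lab[of j i'] all[OF that(1)] that by auto
    qed
    ultimately show ?l
      using ext all unfolding semistandard_tableaux_def tableaux_def PiE_iff row_weakly_bounded_def by auto
  qed
  have "(\<Sum>T\<in>?F. \<Prod>x\<in>?R. w (T x)) =
      (\<Sum>Z\<in>region s ` ?Bs. (\<Prod>x\<in>?R - Z. w (fst x)) * (\<Sum>T\<in>?Y Z. \<Prod>x\<in>Z. w (T x)))"
  proof (rule sum_split_label[where lab = fst and g = "\<lambda>_. w" and Y = ?Y])
    show "finite (?Y Z)" if "Z \<in> region s ` ?Bs" for Z
      using that by (auto intro!: finite_bounded_tableaux finite_region simp: bounded_profiles_def)
    show "Z \<subseteq> ?R" if "Z \<in> region s ` ?Bs" for Z
      using that region_Diff(3) by blast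
    show "T x \<noteq> fst x" if "T \<in> ?Y Z" "x \<in> Z" for Z T x
      using that by (cases x) (fastforce simp: bounded_tableaux_def)
  qed (use iff in \<open>auto simp: finite_region[OF tp] bounded_tableaux_def dest: semistandardD(2)\<close>)
  also have "\<dots> = (\<Sum>\<beta>\<in>?Bs. (\<Prod>x\<in>?R - region s \<beta>. w (fst x)) *
      (\<Sum>T\<in>?Y (region s \<beta>). \<Prod>x\<in>region s \<beta>. w (T x)))"
    by (rule sum.reindex[unfolded comp_def]) (auto intro!: inj_onI dest: region_inject)
  also have "\<dots> = (\<Sum>\<beta>\<in>?Bs. row_weight t \<beta> * (\<Sum>T\<in>?Y (region s \<beta>). \<Prod>x\<in>region s \<beta>. w (T x)))"
    by (rule sum.cong[OF refl]) (simp add: region_Diff prod_region[OF tp] row_weight_def)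
  finally show ?thesis .
qed

text \<open>Labels decrease here, so the boxes with the largest label are the lower set, adjacent to
  \<open>b\<close>, and smaller labels fill the part adjacent to \<open>c\<close>. Strict rows make
  the peeled boxes a vertical strip. The chain of D accordingly descends from \<open>c\<close> and
  uses the largest label last.\<close>

lemma sum_bounded_reverse_tableaux_Suc:
  assumes b: "b \<in> bounded_profiles p r L" and c: "c \<in> bounded_profiles p r L" and bc: "b \<le> c"
  shows "(\<Sum>T\<in>bounded_reverse_tableaux (Suc M) (region b c). \<Prod>x\<in>region b c. - w (T x)) =
    (\<Sum>\<gamma> | \<gamma> \<in> bounded_profiles p r L \<and> b \<le> \<gamma> \<and> \<gamma> \<le> c.
       (\<Sum>T\<in>bounded_reverse_tableaux M (region \<gamma> c). \<Prod>x\<in>region \<gamma> c. - w (T x)) * D (Suc M) \<gamma> b)"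
proof -
  note bp = bounded_profilesD(1)[OF b] and cp = bounded_profilesD(1)[OF c]
  let ?R = "region b c"
  let ?Y = "bounded_reverse_tableaux M"
  let ?Bs = "{\<gamma> \<in> bounded_profiles p r L. b \<le> \<gamma> \<and> \<gamma> \<le> c \<and>
    (\<forall>j\<in>J. \<gamma> (Suc j) \<le> b j \<and> b j \<le> \<gamma> j \<and> (b j < \<gamma> j \<longrightarrow> Suc M \<le> b j))}"
  have iff: "T \<in> bounded_reverse_tableaux (Suc M) ?R \<longleftrightarrow>
         {x \<in> ?R. T x \<noteq> Suc M} \<in> (\<lambda>\<gamma>. region \<gamma> c) ` ?Bs \<and>
         restrict T {x \<in> ?R. T x \<noteq> Suc M} \<in> ?Y {x \<in> ?R. T x \<noteq> Suc M}"
    (is "?l \<longleftrightarrow> ?r") if ext: "T \<in> extensional ?R" for T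
  proof
    assume l: ?l
    then have rs: "T \<in> reverse_row_strict_tableaux ?R"
      and le: "\<And>i j. (i, j) \<in> ?R \<Longrightarrow> T (i, j) \<le> Suc M \<and> T (i, j) < i"
      by (auto simp: bounded_reverse_tableaux_def)
    let ?Z = "{x \<in> ?R. T x = Suc M}"
    obtain \<gamma> where \<gamma>: "\<gamma> \<in> bounded_profiles p r L" "b \<le> \<gamma>" "\<gamma> \<le> c" "?Z = region b \<gamma>"
    proof (rule lower_set_eq_region[OF b c bc, of ?Z])
      fix i j i' j' assume *: "(i, j) \<in> ?Z" "(i', j') \<in> ?R" "i' \<le> i" "j' \<le> j"
      then have k: "(i', j) \<in> ?R" using region_corner[OF bp cp] by blast
      have "Suc M = T (i, j)" using * by simp
      also have "\<dots> \<le> T (i', j)" using reverse_row_strictD(4)[OF rs k, of i] * by auto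
      also have "\<dots> \<le> T (i', j')" using reverse_row_strictD(3)[OF rs *(2) k] *(4) by (cases "j' = j") auto
      finally show "(i', j') \<in> ?Z" using * le[of i' j'] by simp
    qed auto
    have lab: "T (i, j) = Suc M" if "b j < i" "i \<le> \<gamma> j" for i j
    proof -
      have "(i, j) \<in> ?Z" unfolding \<gamma>(4) using that by simp
      then show ?thesis by blast
    qed
    have "\<gamma> (Suc j) \<le> b j \<and> b j \<le> \<gamma> j \<and> (b j < \<gamma> j \<longrightarrow> Suc M \<le> b j)" if "j \<in> J" for j
    proof (intro conjI impI)
      show "b j \<le> \<gamma> j" using \<gamma>(2) by (rule le_funD)
      \<comment> \<open>The topmost peeled box of the column is in row \<open>Suc (b j)\<close>, and
        its label \<open>Suc M\<close> must be strictly smaller than that row.\<close>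
      show "Suc M \<le> b j" if "b j < \<gamma> j"
        using lab[of j "Suc (b j)"] le[of "Suc (b j)" j] that le_funD[OF \<gamma>(3), of j] by auto
      show "\<gamma> (Suc j) \<le> b j"
      proof (rule ccontr)
        assume *: "\<not> \<gamma> (Suc j) \<le> b j"
        have "b (Suc j) \<le> b j" "\<gamma> (Suc j) \<le> \<gamma> j"
          using that bp bounded_profilesD(1)[OF \<gamma>(1)] by (auto intro: profiles_Suc)
        then have "(\<gamma> (Suc j), j) \<in> ?Z" "(\<gamma> (Suc j), Suc j) \<in> ?Z"
          unfolding \<gamma>(4) using * by auto
        then show False
          using reverse_row_strictD(3)[OF rs, of "\<gamma> (Suc j)" j "Suc j"] by auto
      qed
    qed
    then have "\<gamma> \<in> ?Bs" using \<gamma> by blast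
    moreover have Z': "{x \<in> ?R. T x \<noteq> Suc M} = region \<gamma> c"
      unfolding region_Diff(1)[OF \<gamma>(2,3), symmetric] \<gamma>(4)[symmetric] by blast
    ultimately have "{x \<in> ?R. T x \<noteq> Suc M} \<in> (\<lambda>\<gamma>. region \<gamma> c) ` ?Bs" by blast
    moreover have "restrict T {x \<in> ?R. T x \<noteq> Suc M} \<in> ?Y {x \<in> ?R. T x \<noteq> Suc M}"
      using reverse_row_strict_restrict[OF rs, of "{x \<in> ?R. T x \<noteq> Suc M}"] le
      by (fastforce simp: bounded_reverse_tableaux_def le_Suc_eq)
    ultimately show ?r ..
  next
    assume ?r
    then obtain \<gamma> where \<gamma>: "\<gamma> \<in> ?Bs" and Z: "{x \<in> ?R. T x \<noteq> Suc M} = region \<gamma> c"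
      and T: "restrict T (region \<gamma> c) \<in> ?Y (region \<gamma> c)"
      by auto
    have \<gamma>': "b j \<le> \<gamma> j" "\<gamma> j \<le> c j" for j using \<gamma> by (auto simp: le_fun_def)
    have \<gamma>p: "\<gamma> \<in> profiles p r" using \<gamma> bounded_profilesD(1) by blast
    have lab: "T (i, j) = Suc M" if "i \<le> \<gamma> j" "(i, j) \<in> ?R" for i j
    proof -
      have "(i, j) \<notin> {x \<in> ?R. T x \<noteq> Suc M}" unfolding Z using that by simp
      then show ?thesis using that by simp
    qed
    have T_eq: "restrict T (region \<gamma> c) (i, j) = T (i, j)" if "(i, j) \<in> region \<gamma> c" for i j
      using that by (rule restrict_apply')
    have rs: "restrict T (region \<gamma> c) \<in> reverse_row_strict_tableaux (region \<gamma> c)"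
      using T by (simp add: bounded_reverse_tableaux_def)
    have inZ: "T (i, j) \<le> M" "T (i, j) < i" "1 \<le> T (i, j)" if "(i, j) \<in> region \<gamma> c" for i j
      using T reverse_row_strictD(1)[OF rs] that T_eq[OF that]
      unfolding bounded_reverse_tableaux_def tableaux_def PiE_iff by fastforce+
    have col: "j \<in> J" if "(i, j) \<in> ?R" for i j using region_column[OF cp that] .
    have step: "\<gamma> (Suc j) \<le> b j" "b j < \<gamma> j \<Longrightarrow> Suc M \<le> b j" if "j \<in> J" for j
      using \<gamma> that by auto
    have all: "1 \<le> T (i, j) \<and> T (i, j) \<le> Suc M \<and> T (i, j) < i" if "(i, j) \<in> ?R" for i j
    proof (cases "i \<le> \<gamma> j")
      case True
      then show ?thesis using lab[of i j] that step(2)[OF col[OF that]] by auto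
    next
      case False
      then show ?thesis using inZ[of i j] that by auto
    qed
    have "T (i, j) > T (i, j')" if "(i, j) \<in> ?R" "(i, j') \<in> ?R" "j < j'" for i j j'
    proof -
      have "\<gamma> j' \<le> \<gamma> (Suc j)"
        using profiles_antimono[OF \<gamma>p, of "Suc j" j'] col[OF that(1)] that(3) by auto
      also have "\<dots> \<le> b j" using step(1)[OF col[OF that(1)]] .
      also have "\<dots> < i" using that by simp
      finally have "(i, j') \<in> region \<gamma> c" using that by simp
      then show ?thesis
        using lab[of i j] inZ[of i j'] reverse_row_strictD(3)[OF rs, of i j j'] T_eq[of i j] T_eq[of i j'] that
        by (cases "i \<le> \<gamma> j") auto
    qed
    moreover have "T (i, j) \<ge> T (i', j)" if "(i, j) \<in> ?R" "(i', j) \<in> ?R" "i < i'" for i i' j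
    proof (cases "i \<le> \<gamma> j")
      case True
      then show ?thesis using lab[of i j] all[OF that(2)] that by auto
    next
      case False
      then show ?thesis
        using reverse_row_strictD(4)[OF rs, of i j i'] T_eq[of i j] T_eq[of i' j] that by auto
    qed
    ultimately show ?l
      using ext all
      unfolding bounded_reverse_tableaux_def reverse_row_strict_tableaux_def tableaux_def PiE_iff by auto
  qed
  have "(\<Sum>T\<in>bounded_reverse_tableaux (Suc M) ?R. \<Prod>x\<in>?R. - w (T x)) =
      (\<Sum>Z\<in>(\<lambda>\<gamma>. region \<gamma> c) ` ?Bs. (\<Prod>x\<in>?R - Z. - w (Suc M)) * (\<Sum>T\<in>?Y Z. \<Prod>x\<in>Z. - w (T x)))"
  proof (rule sum_split_label[where lab = "\<lambda>_. Suc M" and g = "\<lambda>_ k. - w k" and Y = ?Y])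
    show "finite (?Y Z)" if "Z \<in> (\<lambda>\<gamma>. region \<gamma> c) ` ?Bs" for Z
      using that by (auto intro!: finite_bounded_reverse_tableaux finite_region[OF cp])
    show "Z \<subseteq> ?R" if "Z \<in> (\<lambda>\<gamma>. region \<gamma> c) ` ?Bs" for Z
      using that region_Diff(4) by blast
    show "T x \<noteq> Suc M" if "T \<in> ?Y Z" "x \<in> Z" for Z T x
      using that by (cases x) (fastforce simp: bounded_reverse_tableaux_def)
  qed (use iff in \<open>auto simp: finite_region[OF cp] bounded_reverse_tableaux_def dest: reverse_row_strictD(2)\<close>)
  also have "\<dots> = (\<Sum>\<gamma>\<in>?Bs. (\<Prod>x\<in>?R - region \<gamma> c. - w (Suc M)) *
      (\<Sum>T\<in>?Y (region \<gamma> c). \<Prod>x\<in>region \<gamma> c. - w (T x)))"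
    by (rule sum.reindex[unfolded comp_def]) (auto intro!: inj_onI dest: region_inject')
  also have "\<dots> = (\<Sum>\<gamma>\<in>?Bs. (\<Sum>T\<in>?Y (region \<gamma> c). \<Prod>x\<in>region \<gamma> c. - w (T x)) * D (Suc M) \<gamma> b)"
  proof (rule sum.cong[OF refl])
    fix \<gamma> assume \<gamma>: "\<gamma> \<in> ?Bs"
    then have gp: "\<gamma> \<in> profiles p r" using bounded_profilesD(1) by blast
    from \<gamma> have "(\<Prod>x\<in>?R - region \<gamma> c. - w (Suc M)) = (\<Prod>j\<in>J. \<Prod>i\<in>{b j<..\<gamma> j}. - w (Suc M))"
      using prod_region[OF gp, of "\<lambda>_. - w (Suc M)" b] by (simp add: region_Diff del: prod_constant)
    also have "\<dots> = D (Suc M) \<gamma> b"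
      using \<gamma> unfolding D_def by auto
    finally show "(\<Prod>x\<in>?R - region \<gamma> c. - w (Suc M)) * (\<Sum>T\<in>?Y (region \<gamma> c). \<Prod>x\<in>region \<gamma> c. - w (T x)) =
      (\<Sum>T\<in>?Y (region \<gamma> c). \<Prod>x\<in>region \<gamma> c. - w (T x)) * D (Suc M) \<gamma> b"
      by (simp only: mult.commute)
  qed
  also have "\<dots> = (\<Sum>\<gamma> | \<gamma> \<in> bounded_profiles p r L \<and> b \<le> \<gamma> \<and> \<gamma> \<le> c.
       (\<Sum>T\<in>?Y (region \<gamma> c). \<Prod>x\<in>region \<gamma> c. - w (T x)) * D (Suc M) \<gamma> b)"
  proof (rule sum.mono_neutral_left)
    show "\<forall>\<gamma>\<in>{\<gamma>. \<gamma> \<in> bounded_profiles p r L \<and> b \<le> \<gamma> \<and> \<gamma> \<le> c} - ?Bs.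
       (\<Sum>T\<in>?Y (region \<gamma> c). \<Prod>x\<in>region \<gamma> c. - w (T x)) * D (Suc M) \<gamma> b = 0"
    proof
      fix \<gamma> assume "\<gamma> \<in> {\<gamma>. \<gamma> \<in> bounded_profiles p r L \<and> b \<le> \<gamma> \<and> \<gamma> \<le> c} - ?Bs"
      then have "\<not> (\<forall>j\<in>J. \<gamma> (Suc j) \<le> b j \<and> b j \<le> \<gamma> j \<and> (b j < \<gamma> j \<longrightarrow> Suc M \<le> b j))" by blast
      then have "D (Suc M) \<gamma> b = 0"
        unfolding D_def by (rule if_not_P)
      then show "(\<Sum>T\<in>?Y (region \<gamma> c). \<Prod>x\<in>region \<gamma> c. - w (T x)) * D (Suc M) \<gamma> b = 0" by simp
    qed
  qed auto
  finally show ?thesis .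
qed

lemma D_chain_eq_tableaux:
  assumes c: "c \<in> bounded_profiles p r L" and "b \<in> bounded_profiles p r L" and "b \<le> c"
  shows "D_chain L M c b = (\<Sum>T\<in>bounded_reverse_tableaux M (region b c). \<Prod>x\<in>region b c. - w (T x))"
  using assms(2,3)
proof (induction M arbitrary: b)
  case 0
  show ?case
  proof (cases "b = c")
    case True
    moreover have "bounded_reverse_tableaux 0 {} = {\<lambda>x. undefined}"
      by (auto simp: bounded_reverse_tableaux_def reverse_row_strict_tableaux_def tableaux_def)
    ultimately show ?thesis by simp
  next
    case False
    then have "region b c \<noteq> {}" using region_empty_iff[OF \<open>b \<le> c\<close>] by simp
    then have "bounded_reverse_tableaux 0 (region b c) = {}"
      by (rule tableaux_no_labels) (auto simp: bounded_reverse_tableaux_def reverse_row_strict_tableaux_def)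
    then show ?thesis using False by simp
  qed
next
  case (Suc M)
  let ?S = "bounded_profiles p r L"
  have "D_chain L (Suc M) c b = (\<Sum>\<gamma>\<in>?S. D_chain L M c \<gamma> * D (Suc M) \<gamma> b)"
    by (simp add: kernel_mult_def)
  also have "\<dots> = (\<Sum>\<gamma> | \<gamma> \<in> ?S \<and> b \<le> \<gamma> \<and> \<gamma> \<le> c. D_chain L M c \<gamma> * D (Suc M) \<gamma> b)"
  proof (rule sum.mono_neutral_right)
    show "\<forall>\<gamma>\<in>?S - {\<gamma>. \<gamma> \<in> ?S \<and> b \<le> \<gamma> \<and> \<gamma> \<le> c}. D_chain L M c \<gamma> * D (Suc M) \<gamma> b = 0"
    proof
      fix \<gamma> assume \<gamma>: "\<gamma> \<in> ?S - {\<gamma>. \<gamma> \<in> ?S \<and> b \<le> \<gamma> \<and> \<gamma> \<le> c}"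
      then have "D_chain L M c \<gamma> = 0 \<or> D (Suc M) \<gamma> b = 0"
        using D_chain_nonzero[OF _ c] D_nonzero[OF bounded_profilesD(1)[OF Suc.prems(1)]] by blast
      then show "D_chain L M c \<gamma> * D (Suc M) \<gamma> b = 0" by auto
    qed
  qed auto
  also have "\<dots> = (\<Sum>T\<in>bounded_reverse_tableaux (Suc M) (region b c). \<Prod>x\<in>region b c. - w (T x))"
    unfolding sum_bounded_reverse_tableaux_Suc[OF Suc.prems(1) c Suc.prems(2)]
    by (rule sum.cong[OF refl]) (use Suc.IH in simp)
  finally show ?case .
qed

end

section \<open>Set-valued tableaux\<close>

text \<open>Conditions on pairs of labels survive the removal of a label from the sets, whereas
  \<open>Max\<close> and \<open>Min\<close> would have to be recomputed.\<close>

lemma SS_iff: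
  "T \<in> SS \<sigma> \<longleftrightarrow> T \<in> set_valued_tableaux \<sigma> \<and>
     (\<forall>i j j'. (i, j) \<in> \<sigma> \<and> (i, j') \<in> \<sigma> \<and> j < j' \<longrightarrow> (\<forall>a\<in>T (i, j). \<forall>c\<in>T (i, j'). a \<le> c)) \<and>
     (\<forall>i i' j. (i, j) \<in> \<sigma> \<and> (i', j) \<in> \<sigma> \<and> i < i' \<longrightarrow> (\<forall>a\<in>T (i, j). \<forall>c\<in>T (i', j). a < c))"
proof (cases "T \<in> set_valued_tableaux \<sigma>")
  case True
  then have fin: "finite (T x)" "T x \<noteq> {}" if "x \<in> \<sigma>" for x
    using that by (auto simp: set_valued_tableaux_def PiE_iff)
  have "(Max (T x) \<le> Min (T z)) = (\<forall>a\<in>T x. \<forall>c\<in>T z. a \<le> c)"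
    "(Max (T x) < Min (T z)) = (\<forall>a\<in>T x. \<forall>c\<in>T z. a < c)" if "x \<in> \<sigma>" "z \<in> \<sigma>" for x z
    using fin[OF that(1)] fin[OF that(2)] by simp_all blast+
  then show ?thesis
    using True unfolding SS_def by auto
qed (simp add: SS_def)

lemma SSD:
  assumes "T \<in> SS \<sigma>"
  shows "T \<in> set_valued_tableaux \<sigma>" "T \<in> extensional \<sigma>"
    "x \<in> \<sigma> \<Longrightarrow> finite (T x)" "x \<in> \<sigma> \<Longrightarrow> T x \<noteq> {}" "x \<in> \<sigma> \<Longrightarrow> a \<in> T x \<Longrightarrow> 1 \<le> a"
    "(i, j) \<in> \<sigma> \<Longrightarrow> (i, j') \<in> \<sigma> \<Longrightarrow> j < j' \<Longrightarrow> a \<in> T (i, j) \<Longrightarrow> c \<in> T (i, j') \<Longrightarrow> a \<le> c"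
    "(i, j) \<in> \<sigma> \<Longrightarrow> (i', j) \<in> \<sigma> \<Longrightarrow> i < i' \<Longrightarrow> a \<in> T (i, j) \<Longrightarrow> c \<in> T (i', j) \<Longrightarrow> a < c"
proof -
  show T: "T \<in> set_valued_tableaux \<sigma>" using assms by (simp add: SS_def)
  then show "T \<in> extensional \<sigma>" "x \<in> \<sigma> \<Longrightarrow> finite (T x)" "x \<in> \<sigma> \<Longrightarrow> T x \<noteq> {}"
    "x \<in> \<sigma> \<Longrightarrow> a \<in> T x \<Longrightarrow> 1 \<le> a"
    by (auto simp: set_valued_tableaux_def PiE_iff)
  show "(i, j) \<in> \<sigma> \<Longrightarrow> (i, j') \<in> \<sigma> \<Longrightarrow> j < j' \<Longrightarrow> a \<in> T (i, j) \<Longrightarrow> c \<in> T (i, j') \<Longrightarrow> a \<le> c"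
    "(i, j) \<in> \<sigma> \<Longrightarrow> (i', j) \<in> \<sigma> \<Longrightarrow> i < i' \<Longrightarrow> a \<in> T (i, j) \<Longrightarrow> c \<in> T (i', j) \<Longrightarrow> a < c"
    using assms unfolding SS_iff by blast+
qed

text \<open>The set-valued counterpart of \<open>sum_split_label\<close>. Z collects the boxes that
  hold some label other than m, and Q those boxes of Z that hold m as well. Deleting m loses no
  information once Z and Q are recorded, and \<open>h x\<close> is the price of inserting m into a
  nonempty set.\<close>

lemma sum_split_set_label:
  fixes g :: "'b \<Rightarrow> 'c set \<Rightarrow> 'a::comm_semiring_1"
  assumes "finite R" "finite Zs" "\<And>Z Q. (Z, Q) \<in> Zs \<Longrightarrow> finite (Y Z)"
    and sub: "\<And>Z Q. (Z, Q) \<in> Zs \<Longrightarrow> Q \<subseteq> Z \<and> Z \<subseteq> R"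
    and F: "F \<subseteq> extensional R"
      "\<And>T. T \<in> extensional R \<Longrightarrow> T \<in> F \<longleftrightarrow>
         ({x \<in> R. T x \<noteq> {m}}, {x \<in> R. T x \<noteq> {m} \<and> m \<in> T x}) \<in> Zs \<and>
         (\<lambda>x\<in>{x \<in> R. T x \<noteq> {m}}. T x - {m}) \<in> Y {x \<in> R. T x \<noteq> {m}}"
    and Y: "\<And>Z Q T. (Z, Q) \<in> Zs \<Longrightarrow> T \<in> Y Z \<Longrightarrow> T \<in> extensional Z"
      "\<And>Z Q T x. (Z, Q) \<in> Zs \<Longrightarrow> T \<in> Y Z \<Longrightarrow> x \<in> Z \<Longrightarrow>
         T x \<noteq> {} \<and> m \<notin> T x \<and> g x (insert m (T x)) = h x * g x (T x)"
  shows "(\<Sum>T\<in>F. \<Prod>x\<in>R. g x (T x)) =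
    (\<Sum>(Z, Q)\<in>Zs. (\<Prod>x\<in>R - Z. g x {m}) * (\<Prod>x\<in>Q. h x) * (\<Sum>T\<in>Y Z. \<Prod>x\<in>Z. g x (T x)))"
proof -
  let ?Z = "\<lambda>T. {x \<in> R. T x \<noteq> {m}}"
  let ?Q = "\<lambda>T. {x \<in> R. T x \<noteq> {m} \<and> m \<in> T x}"
  let ?T = "\<lambda>T. \<lambda>x\<in>?Z T. T x - {m}"
  let ?ext = "\<lambda>((Z, Q), T). \<lambda>x\<in>R. if x \<in> Z then if x \<in> Q then insert m (T x) else T x else {m}"
  have ext_eqs: "?Z (?ext ((Z, Q), T)) = Z" "?Q (?ext ((Z, Q), T)) = Q"
      "(\<lambda>x\<in>Z. ?ext ((Z, Q), T) x - {m}) = T"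
    if "(Z, Q) \<in> Zs" "T \<in> Y Z" for Z Q T
  proof -
    have ne: "T x \<noteq> {}" "m \<notin> T x" if "x \<in> Z" for x
      using Y(2)[OF \<open>(Z, Q) \<in> Zs\<close> \<open>T \<in> Y Z\<close> that] by auto
    have QZR: "Q \<subseteq> Z" "Z \<subseteq> R" using sub[OF that(1)] by auto
    have "insert m (T x) \<noteq> {m}" "T x \<noteq> {m}" if "x \<in> Z" for x
      using ne[OF that] by auto
    then show "?Z (?ext ((Z, Q), T)) = Z" "?Q (?ext ((Z, Q), T)) = Q"
      using QZR ne by auto
    show "(\<lambda>x\<in>Z. ?ext ((Z, Q), T) x - {m}) = T"
    proof (rule ext)
      show "(\<lambda>x\<in>Z. ?ext ((Z, Q), T) x - {m}) x = T x" for x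
        using QZR ne[of x] Y(1)[OF that] by (auto simp: extensional_def)
    qed
  qed
  let ?W = "\<lambda>((Z, Q), T). (\<Prod>x\<in>R - Z. g x {m}) * (\<Prod>x\<in>Q. h x) * (\<Prod>x\<in>Z. g x (T x))"
  have "(\<Sum>T\<in>F. \<Prod>x\<in>R. g x (T x)) = (\<Sum>ZT\<in>Sigma Zs (\<lambda>(Z, Q). Y Z). ?W ZT)"
  proof (rule sum.reindex_bij_witness[where j = "\<lambda>T. ((?Z T, ?Q T), ?T T)" and i = ?ext])
    fix T assume T: "T \<in> F"
    then have e: "T \<in> extensional R" using F(1) by blast
    show "?ext ((?Z T, ?Q T), ?T T) = T"
    proof (rule ext)
      show "?ext ((?Z T, ?Q T), ?T T) x = T x" for x
        using e by (auto simp: extensional_def)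
    qed
    have mem: "(?Z T, ?Q T) \<in> Zs" "?T T \<in> Y (?Z T)"
      using T F(2)[OF e] by auto
    then show "((?Z T, ?Q T), ?T T) \<in> Sigma Zs (\<lambda>(Z, Q). Y Z)" by auto
    have "(\<Prod>x\<in>R. g x (T x)) = (\<Prod>x\<in>R - ?Z T. g x (T x)) * (\<Prod>x\<in>?Z T. g x (T x))"
      by (rule prod.subset_diff) (use \<open>finite R\<close> in auto)
    also have "(\<Prod>x\<in>R - ?Z T. g x (T x)) = (\<Prod>x\<in>R - ?Z T. g x {m})"
      by (rule prod.cong) auto
    also have "(\<Prod>x\<in>?Z T. g x (T x)) = (\<Prod>x\<in>?Z T. (if x \<in> ?Q T then h x else 1) * g x (?T T x))"
    proof (rule prod.cong[OF refl])
      fix x assume x: "x \<in> ?Z T"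
      show "g x (T x) = (if x \<in> ?Q T then h x else 1) * g x (?T T x)"
        using Y(2)[OF mem x] x by (auto simp: insert_absorb)
    qed
    also have "\<dots> = (\<Prod>x\<in>?Q T. h x) * (\<Prod>x\<in>?Z T. g x (?T T x))"
    proof -
      have "(\<Prod>x\<in>?Z T. if x \<in> ?Q T then h x else 1) = (\<Prod>x\<in>?Q T. h x)"
        using \<open>finite R\<close> by (intro prod.mono_neutral_cong_right) auto
      then show ?thesis by (simp only: prod.distrib)
    qed
    finally show "?W ((?Z T, ?Q T), ?T T) = (\<Prod>x\<in>R. g x (T x))"
      by (simp only: prod.case mult.assoc)
  next
    fix ZT assume "ZT \<in> Sigma Zs (\<lambda>(Z, Q). Y Z)"
    then obtain Z Q T where ZT: "ZT = ((Z, Q), T)" "(Z, Q) \<in> Zs" "T \<in> Y Z" by auto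
    note eqs = ext_eqs[OF ZT(2,3)]
    show "((?Z (?ext ZT), ?Q (?ext ZT)), ?T (?ext ZT)) = ZT"
      unfolding ZT(1) eqs ..
    have "?ext ((Z, Q), T) \<in> extensional R" by simp
    from F(2)[OF this] show "?ext ZT \<in> F"
      unfolding ZT(1) eqs using ZT(2,3) by blast
  qed
  also have "\<dots> = (\<Sum>x\<in>Zs. \<Sum>T\<in>(case x of (Z, Q) \<Rightarrow> Y Z). case x of (Z, Q) \<Rightarrow>
      (\<Prod>x\<in>R - Z. g x {m}) * (\<Prod>x\<in>Q. h x) * (\<Prod>x\<in>Z. g x (T x)))"
    by (subst sum.Sigma) (use assms in \<open>auto intro!: sum.cong\<close>)
  also have "\<dots> = (\<Sum>(Z, Q)\<in>Zs. (\<Prod>x\<in>R - Z. g x {m}) * (\<Prod>x\<in>Q. h x) * (\<Sum>T\<in>Y Z. \<Prod>x\<in>Z. g x (T x)))"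
    by (rule sum.cong) (auto simp: sum_distrib_left)
  finally show ?thesis .
qed

definition bounded_SS :: "nat \<Rightarrow> box set \<Rightarrow> (box \<Rightarrow> nat set) set" where
  "bounded_SS N \<sigma> = {T \<in> SS \<sigma>. \<forall>x\<in>\<sigma>. T x \<subseteq> {..N}}"

lemma finite_bounded_SS: "finite \<sigma> \<Longrightarrow> finite (bounded_SS N \<sigma>)"
proof (rule finite_subset)
  show "bounded_SS N \<sigma> \<subseteq> \<sigma> \<rightarrow>\<^sub>E Pow {..N}"
  proof (intro subsetI PiE_I)
    fix T x assume T: "T \<in> bounded_SS N \<sigma>"
    show "T x \<in> Pow {..N}" if "x \<in> \<sigma>" using T that by (auto simp: bounded_SS_def)
    show "T x = undefined" if "x \<notin> \<sigma>"
      using T SSD(2)[of T \<sigma>] that extensional_arb[of T \<sigma> x] by (auto simp only: bounded_SS_def)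
  qed
qed (auto intro!: finite_PiE)

section \<open>Set-valued tableaux as chains of \<open>V_above\<close>\<close>

context transfer_kernels
begin

text \<open>The share of one box in a term of \<open>RG\<close>, sign included: all labels of the
  box but one count as excess of its row.\<close>

definition box_weight :: "(nat \<Rightarrow> 'a) \<Rightarrow> box \<Rightarrow> nat set \<Rightarrow> 'a" where
  "box_weight y x S = (\<Prod>k\<in>S. y k) * (- w (fst x)) ^ (card S - 1)"

lemma box_weight_insert:
  assumes "finite S" "S \<noteq> {}" "m \<notin> S"
  shows "box_weight y x (insert m S) = (y m * - w (fst x)) * box_weight y x S"
proof -
  have "card S = Suc (card S - 1)" using assms by (simp add: card_gt_0_iff)
  then have "(- w (fst x)) ^ card S = - w (fst x) * (- w (fst x)) ^ (card S - 1)"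
    by (metis power_Suc)
  then show ?thesis
    using assms by (simp add: box_weight_def mult_ac)
qed

text \<open>The columns whose lowest box can hold the new label besides smaller ones; these are the
  columns where \<open>V_above\<close> has a factor \<open>1 - x w\<close>.\<close>

definition doubled_columns :: "(nat \<Rightarrow> nat) \<Rightarrow> (nat \<Rightarrow> nat) \<Rightarrow> (nat \<Rightarrow> nat) \<Rightarrow> nat set" where
  "doubled_columns t b \<beta> = {j \<in> J. b j = \<beta> j \<and> \<beta> (Suc j) < \<beta> j \<and> t j < \<beta> j}"

text \<open>Multiplying out the factors \<open>1 - x w\<close> gives one term for each set P of
  columns whose lowest box takes the new label as an additional one.\<close>

lemma V_above_expand:
  assumes "\<forall>j\<in>J. b j = \<beta> j \<or> b j = Suc (\<beta> j)"
  shows "V_above t x \<beta> b = (\<Prod>j\<in>J. \<Prod>i\<in>{\<beta> j<..b j}. x) *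
    (\<Sum>P\<in>Pow (doubled_columns t b \<beta>). \<Prod>j\<in>P. x * - w (\<beta> j))"
proof -
  let ?A = "doubled_columns t b \<beta>"
  have "V_above t x \<beta> b = (\<Prod>j\<in>J. (\<Prod>i\<in>{\<beta> j<..b j}. x) * (if j \<in> ?A then x * - w (\<beta> j) + 1 else 1))"
    using assms unfolding V_above_def doubled_columns_def by (auto intro!: prod.cong)
  also have "\<dots> = (\<Prod>j\<in>J. \<Prod>i\<in>{\<beta> j<..b j}. x) * (\<Prod>j\<in>?A. x * - w (\<beta> j) + 1)"
  proof -
    have "(\<Prod>j\<in>J. if j \<in> ?A then x * - w (\<beta> j) + 1 else 1) = (\<Prod>j\<in>?A. x * - w (\<beta> j) + 1)"
      by (rule prod.mono_neutral_cong_right) (auto simp: doubled_columns_def)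
    then show ?thesis by (simp only: prod.distrib)
  qed
  also have "(\<Prod>j\<in>?A. x * - w (\<beta> j) + 1) = (\<Sum>P\<in>Pow ?A. \<Prod>j\<in>P. x * - w (\<beta> j))"
    by (subst prod_add) (auto simp: doubled_columns_def)
  finally show ?thesis .
qed

text \<open>Boxes that hold a label at most N form a lower set, bounded by some \<beta>. Outside it
  a box is exactly \<open>{Suc N}\<close>, at most one in each column. Inside it
  \<open>Suc N\<close> can occur only where no smaller label follows below or to the right and no
  \<open>{Suc N}\<close> stands underneath, that is, at the bottom of a doubled column.\<close>

lemma sum_bounded_SS_Suc:
  assumes t: "t \<in> bounded_profiles p r L" and b: "b \<in> bounded_profiles p r L" and tb: "t \<le> b"
  shows "(\<Sum>T\<in>bounded_SS (Suc N) (region t b). \<Prod>x\<in>region t b. box_weight y x (T x)) =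
    (\<Sum>\<beta> | \<beta> \<in> bounded_profiles p r L \<and> t \<le> \<beta> \<and> \<beta> \<le> b.
       (\<Sum>T\<in>bounded_SS N (region t \<beta>). \<Prod>x\<in>region t \<beta>. box_weight y x (T x)) *
       V_above t (y (Suc N)) \<beta> b)"
proof -
  note tp = bounded_profilesD(1)[OF t] and bp = bounded_profilesD(1)[OF b]
  let ?R = "region t b"
  let ?m = "Suc N"
  let ?Bs = "{\<beta> \<in> bounded_profiles p r L. t \<le> \<beta> \<and> \<beta> \<le> b \<and> (\<forall>j\<in>J. b j = \<beta> j \<or> b j = Suc (\<beta> j))}"
  let ?A = "doubled_columns t b"
  let ?Q = "\<lambda>\<beta> P. (\<lambda>j. (\<beta> j, j)) ` P"
  let ?Zs = "(\<lambda>(\<beta>, P). (region t \<beta>, ?Q \<beta> P)) ` Sigma ?Bs (\<lambda>\<beta>. Pow (?A \<beta>))"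
  have iff: "T \<in> bounded_SS ?m ?R \<longleftrightarrow>
         ({x \<in> ?R. T x \<noteq> {?m}}, {x \<in> ?R. T x \<noteq> {?m} \<and> ?m \<in> T x}) \<in> ?Zs \<and>
         (\<lambda>x\<in>{x \<in> ?R. T x \<noteq> {?m}}. T x - {?m}) \<in> bounded_SS N {x \<in> ?R. T x \<noteq> {?m}}"
    (is "?l \<longleftrightarrow> ?r") if ext: "T \<in> extensional ?R" for T
  proof
    assume l: ?l
    then have ss: "T \<in> SS ?R" and le: "\<And>x k. x \<in> ?R \<Longrightarrow> k \<in> T x \<Longrightarrow> k \<le> ?m"
      by (auto simp: bounded_SS_def)
    note row = SSD(6)[OF ss] and column = SSD(7)[OF ss]
    let ?Z = "{x \<in> ?R. T x \<noteq> {?m}}"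
    have small: "\<exists>k\<in>T x. k \<le> N" if "x \<in> ?Z" for x
      using SSD(4)[OF ss, of x] le[of x] that by (auto simp: le_Suc_eq)
    have ZI: "x \<in> ?Z" if "x \<in> ?R" "k \<in> T x" "k \<le> N" for x k
    proof -
      have "T x \<noteq> {?m}"
      proof
        assume "T x = {?m}"
        with that(2,3) show False by simp
      qed
      with that(1) show ?thesis by blast
    qed
    obtain \<beta> where \<beta>: "\<beta> \<in> bounded_profiles p r L" "t \<le> \<beta>" "\<beta> \<le> b" "?Z = region t \<beta>"
    proof (rule lower_set_eq_region[OF t b tb, of ?Z])
      fix i j i' j' assume *: "(i, j) \<in> ?Z" "(i', j') \<in> ?R" "i' \<le> i" "j' \<le> j"
      then have c: "(i', j) \<in> ?R" using region_corner[OF tp bp] by blast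
      from *(1) have ij: "(i, j) \<in> ?R" by simp
      obtain k where k: "k \<in> T (i, j)" "k \<le> N" using small[OF *(1)] by blast
      obtain k' where k': "k' \<in> T (i', j)" "k' \<le> N"
        using column[OF c ij _ _ k(1)] SSD(4)[OF ss c] k *(3) by (cases "i' = i") fastforce+
      obtain k'' where "k'' \<in> T (i', j')" "k'' \<le> N"
        using row[OF *(2) c _ _ k'(1)] SSD(4)[OF ss *(2)] k' *(4) by (cases "j' = j") fastforce+
      then show "(i', j') \<in> ?Z" using ZI *(2) by blast
    qed auto
    have \<beta>': "t j \<le> \<beta> j" "\<beta> j \<le> b j" for j using \<beta>(2,3) by (auto simp: le_fun_def)
    have \<beta>p: "\<beta> \<in> profiles p r" using \<beta>(1) bounded_profilesD(1) by blast
    have lab: "T (i, j) = {?m}" if "\<beta> j < i" "i \<le> b j" for i j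
    proof -
      have "(i, j) \<in> ?R - ?Z"
        unfolding \<beta>(4) region_Diff(1)[OF \<beta>(2,3)] using that by simp
      then show ?thesis by blast
    qed
    have inZ: "(i, j) \<in> ?R" "\<exists>k\<in>T (i, j). k \<le> N" if "t j < i" "i \<le> \<beta> j" for i j
    proof -
      have "(i, j) \<in> ?Z" unfolding \<beta>(4) using that by simp
      then show "(i, j) \<in> ?R" "\<exists>k\<in>T (i, j). k \<le> N" using small by auto
    qed
    have "b j = \<beta> j \<or> b j = Suc (\<beta> j)" for j
    proof (rule ccontr)
      assume "\<not> (b j = \<beta> j \<or> b j = Suc (\<beta> j))"
      then have "Suc (Suc (\<beta> j)) \<le> b j" using \<beta>'(2)[of j] by simp
      then show False
        using column[of "Suc (\<beta> j)" j "Suc (Suc (\<beta> j))" ?m ?m] lab[of j "Suc (\<beta> j)"]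
          lab[of j "Suc (Suc (\<beta> j))"] \<beta>'(1)[of j] by auto
    qed
    then have "\<beta> \<in> ?Bs" using \<beta> by blast
    \<comment> \<open>The columns in which the bottom box of the remaining region holds
      \<open>Suc N\<close> as an additional label.\<close>
    moreover define P where "P = {j \<in> J. t j < \<beta> j \<and> ?m \<in> T (\<beta> j, j)}"
    have "P \<subseteq> ?A \<beta>"
    proof
      fix j assume "j \<in> P"
      then have j: "j \<in> J" "t j < \<beta> j" "?m \<in> T (\<beta> j, j)" by (auto simp: P_def)
      have "b j = \<beta> j"
      proof (rule ccontr)
        assume "b j \<noteq> \<beta> j"
        then have "Suc (\<beta> j) \<le> b j" using \<beta>'(2)[of j] by simp
        then show False
          using column[of "\<beta> j" j "Suc (\<beta> j)" ?m ?m] lab[of j "Suc (\<beta> j)"] j by auto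
      qed
      moreover have "\<beta> (Suc j) < \<beta> j"
      proof (rule ccontr)
        assume "\<not> \<beta> (Suc j) < \<beta> j"
        then have "\<beta> (Suc j) = \<beta> j" using profiles_Suc[OF \<beta>p, of j] j(1) by auto
        moreover have "t (Suc j) \<le> t j" using profiles_Suc[OF tp, of j] j(1) by auto
        ultimately have "t (Suc j) < \<beta> j" "\<beta> j \<le> \<beta> (Suc j)" using j(2) by auto
        from inZ[OF this] obtain k where "(\<beta> j, Suc j) \<in> ?R" "k \<in> T (\<beta> j, Suc j)" "k \<le> N" by blast
        then show False using row[OF inZ(1)[OF j(2) order.refl] _ _ j(3), of "Suc j" k] by auto
      qed
      ultimately show "j \<in> ?A \<beta>" using j by (simp add: doubled_columns_def)
    qed
    moreover have "{x \<in> ?R. T x \<noteq> {?m} \<and> ?m \<in> T x} = ?Q \<beta> P"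
    proof -
      have "{x \<in> ?R. T x \<noteq> {?m} \<and> ?m \<in> T x} = {x \<in> region t \<beta>. ?m \<in> T x}"
        unfolding \<beta>(4)[symmetric] by blast
      also have "\<dots> = ?Q \<beta> P"
      proof safe
        fix i j assume ij: "(i, j) \<in> region t \<beta>" "?m \<in> T (i, j)"
        have "i = \<beta> j"
        proof (rule ccontr)
          assume "i \<noteq> \<beta> j"
          then have "i < \<beta> j" "t j < \<beta> j" using ij(1) by auto
          from inZ(1,2)[OF this(2) order.refl] obtain k where "(\<beta> j, j) \<in> ?R" "k \<in> T (\<beta> j, j)" "k \<le> N" by blast
          moreover have "(i, j) \<in> ?R" using inZ(1)[of j i] ij(1) by simp
          ultimately show False using column[of i j "\<beta> j" ?m k] \<open>i < \<beta> j\<close> ij(2) by auto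
        qed
        then show "(i, j) \<in> ?Q \<beta> P"
          using ij region_column[OF \<beta>p ij(1)] by (auto simp: P_def)
      qed (auto simp: P_def)
      finally show ?thesis .
    qed
    ultimately have "({x \<in> ?R. T x \<noteq> {?m}}, {x \<in> ?R. T x \<noteq> {?m} \<and> ?m \<in> T x}) \<in> ?Zs"
      by (intro image_eqI[of _ _ "(\<beta>, P)"]) (simp_all only: prod.case \<beta>(4) mem_Sigma_iff Pow_iff simp_thms)
    moreover have "(\<lambda>x\<in>?Z. T x - {?m}) \<in> bounded_SS N ?Z"
    proof -
      have "(\<lambda>x\<in>?Z. T x - {?m}) \<in> set_valued_tableaux ?Z"
        unfolding set_valued_tableaux_def
      proof (rule restrict_PiE_iff[THEN iffD2], rule ballI)
        fix x assume x: "x \<in> ?Z"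
        then have "x \<in> ?R" by simp
        moreover have "T x - {?m} \<noteq> {}" using small[OF x] by auto
        ultimately show "T x - {?m} \<in> {S. finite S \<and> S \<noteq> {} \<and> S \<subseteq> {1..}}"
          using SSD(3,5)[OF ss, of x] by auto
      qed
      moreover have "T x - {?m} \<subseteq> {..N}" if "x \<in> ?Z" for x
        using le[of x] that by (auto simp: le_Suc_eq)
      ultimately show ?thesis
        unfolding bounded_SS_def SS_iff
      proof (intro CollectI conjI allI impI ballI)
        fix i j j' a c
        assume *: "(i, j) \<in> ?Z \<and> (i, j') \<in> ?Z \<and> j < j'"
          and "a \<in> (\<lambda>x\<in>?Z. T x - {?m}) (i, j)" "c \<in> (\<lambda>x\<in>?Z. T x - {?m}) (i, j')"
        then have "a \<in> T (i, j)" "c \<in> T (i, j')" by (simp_all add: restrict_def)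
        then show "a \<le> c" using row[of i j j' a c] * by blast
      next
        fix i i' j a c
        assume *: "(i, j) \<in> ?Z \<and> (i', j) \<in> ?Z \<and> i < i'"
          and "a \<in> (\<lambda>x\<in>?Z. T x - {?m}) (i, j)" "c \<in> (\<lambda>x\<in>?Z. T x - {?m}) (i', j)"
        then have "a \<in> T (i, j)" "c \<in> T (i', j)" by (simp_all add: restrict_def)
        then show "a < c" using column[of i j i' a c] * by blast
      qed (simp_all only: restrict_apply')
    qed
    ultimately show ?r ..
  next
    assume r: ?r
    then obtain \<beta> P where \<beta>: "\<beta> \<in> ?Bs" and P: "P \<subseteq> ?A \<beta>" and Z: "{x \<in> ?R. T x \<noteq> {?m}} = region t \<beta>"
      and Q: "{x \<in> ?R. T x \<noteq> {?m} \<and> ?m \<in> T x} = ?Q \<beta> P"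
      by auto
    have T: "(\<lambda>x\<in>region t \<beta>. T x - {?m}) \<in> bounded_SS N (region t \<beta>)"
      using r unfolding Z by blast
    then have ss: "(\<lambda>x\<in>region t \<beta>. T x - {?m}) \<in> SS (region t \<beta>)" by (simp add: bounded_SS_def)
    have \<beta>': "t j \<le> \<beta> j" "\<beta> j \<le> b j" for j using \<beta> by (auto simp: le_fun_def)
    have \<beta>p: "\<beta> \<in> profiles p r" using \<beta> bounded_profilesD(1) by blast
    have sub: "x \<in> ?R" if "x \<in> region t \<beta>" for x using that Z by blast
    have lab: "T (i, j) = {?m}" if "\<beta> j < i" "(i, j) \<in> ?R" for i j
    proof -
      have "(i, j) \<notin> {x \<in> ?R. T x \<noteq> {?m}}" unfolding Z using that by simp
      then show ?thesis using that by simp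
    qed
    have big: "b j = \<beta> j \<and> \<beta> (Suc j) < \<beta> j \<and> i = \<beta> j" if "(i, j) \<in> region t \<beta>" "?m \<in> T (i, j)" for i j
    proof -
      have "T (i, j) \<noteq> {?m}" using that(1) Z by blast
      then have "(i, j) \<in> ?Q \<beta> P" unfolding Q[symmetric] using that sub by blast
      then show ?thesis using P by (auto simp: doubled_columns_def)
    qed
    have inZ: "T x - {?m} \<noteq> {}" "finite (T x - {?m})" "a \<in> T x - {?m} \<Longrightarrow> a \<le> N \<and> 1 \<le> a" if "x \<in> region t \<beta>" for x a
      using SSD(3)[OF ss that] SSD(4)[OF ss that] SSD(5)[OF ss that, of a] T that
      by (auto simp: bounded_SS_def)
    have row: "a \<le> c" if "(i, j) \<in> region t \<beta>" "(i, j') \<in> region t \<beta>" "j < j'" "a \<in> T (i, j) - {?m}" "c \<in> T (i, j') - {?m}" for i j j' a c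
      using SSD(6)[OF ss that(1-3), of a c] that by simp
    have column: "a < c" if "(i, j) \<in> region t \<beta>" "(i', j) \<in> region t \<beta>" "i < i'" "a \<in> T (i, j) - {?m}" "c \<in> T (i', j) - {?m}" for i i' j a c
      using SSD(7)[OF ss that(1-3), of a c] that by simp
    have col: "j \<in> J" if "(i, j) \<in> ?R" for i j using region_column[OF bp that] .
    have step: "b j = \<beta> j \<or> b j = Suc (\<beta> j)" if "j \<in> J" for j
      using \<beta> that by blast
    have all: "finite (T x) \<and> T x \<noteq> {} \<and> (\<forall>a\<in>T x. 1 \<le> a \<and> a \<le> ?m)" if "x \<in> ?R" for x
    proof (cases "x \<in> region t \<beta>")
      case True
      have "a \<le> ?m \<and> 1 \<le> a" if "a \<in> T x" for a
        using inZ(3)[OF True, of a] that by (cases "a = ?m") auto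
      then show ?thesis using inZ(1,2)[OF True] by auto
    next
      case False
      then have "T x = {?m}" using Z that by blast
      then show ?thesis by simp
    qed
    have rows: "a \<le> c" if "(i, j) \<in> ?R" "(i, j') \<in> ?R" "j < j'" "a \<in> T (i, j)" "c \<in> T (i, j')" for i j j' a c
    proof (cases "c = ?m")
      case True
      then show ?thesis using all[OF that(1)] that(4) by auto
    next
      case False
      have i: "i \<le> \<beta> j'"
      proof (rule ccontr)
        assume "\<not> i \<le> \<beta> j'"
        then show False using lab[of j' i] that False by auto
      qed
      have "\<beta> j' \<le> \<beta> (Suc j)"
        using profiles_antimono[OF \<beta>p, of "Suc j" j'] col[OF that(1)] that(3) by auto
      moreover have "\<beta> (Suc j) \<le> \<beta> j"
        using profiles_Suc[OF \<beta>p, of j] col[OF that(1)] by auto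
      ultimately have "(i, j) \<in> region t \<beta>" "(i, j') \<in> region t \<beta>" "i \<le> \<beta> (Suc j)"
        using i that by auto
      \<comment> \<open>A box that holds \<open>?m\<close> inside the region sits in row
        \<open>\<beta> j\<close> with \<open>\<beta> (Suc j) < \<beta> j\<close>; row i still meets
        column j + 1, so (i, j) is no such box.\<close>
      moreover from this(3) have "a \<noteq> ?m" using big[OF \<open>(i, j) \<in> region t \<beta>\<close>] that(4) by auto
      ultimately show ?thesis using row[of i j j' a c] that False by auto
    qed
    have columns: "a < c" if "(i, j) \<in> ?R" "(i', j) \<in> ?R" "i < i'" "a \<in> T (i, j)" "c \<in> T (i', j)" for i i' j a c
    proof -
      have a: "(i, j) \<in> region t \<beta>"
        using that step[OF col[OF that(1)]] by auto
      have "a \<noteq> ?m"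
      proof
        assume "a = ?m"
        then have "b j = \<beta> j" "i = \<beta> j" using big[OF a] that(4) by auto
        then show False using that by simp
      qed
      show ?thesis
      proof (cases "c = ?m")
        case True
        then show ?thesis using all[OF that(1)] that(4) \<open>a \<noteq> ?m\<close> by (auto simp: nat_less_le)
      next
        case False
        have "i' \<le> \<beta> j"
        proof (rule ccontr)
          assume "\<not> i' \<le> \<beta> j"
          then show False using lab[of j i'] that False by auto
        qed
        then show ?thesis using column[OF a, of i' a c] that False \<open>a \<noteq> ?m\<close> by auto
      qed
    qed
    show ?l
      unfolding bounded_SS_def SS_iff
    proof (intro CollectI conjI allI impI ballI subsetI)
      show "T \<in> set_valued_tableaux ?R"
        unfolding set_valued_tableaux_def
      proof (rule PiE_I)
        show "T x \<in> {S. finite S \<and> S \<noteq> {} \<and> S \<subseteq> {1..}}" if "x \<in> ?R" for x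
          using all[OF that] by auto
      qed (rule extensional_arb[OF ext])
      show "a \<le> c" if "(i, j) \<in> ?R \<and> (i, j') \<in> ?R \<and> j < j'" "a \<in> T (i, j)" "c \<in> T (i, j')" for i j j' a c
        using rows that by blast
      show "a < c" if "(i, j) \<in> ?R \<and> (i', j) \<in> ?R \<and> i < i'" "a \<in> T (i, j)" "c \<in> T (i', j)" for i i' j a c
        using columns that by blast
      show "a \<in> {..?m}" if "x \<in> ?R" "a \<in> T x" for x a
        using all[OF that(1)] that(2) by simp
    qed
  qed
  let ?G = "\<lambda>\<beta>. \<Sum>T\<in>bounded_SS N (region t \<beta>). \<Prod>x\<in>region t \<beta>. box_weight y x (T x)"
  have "(\<Sum>T\<in>bounded_SS ?m ?R. \<Prod>x\<in>?R. box_weight y x (T x)) =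
      (\<Sum>(Z, Q)\<in>?Zs. (\<Prod>x\<in>?R - Z. box_weight y x {?m}) * (\<Prod>x\<in>Q. y ?m * - w (fst x)) *
        (\<Sum>T\<in>bounded_SS N Z. \<Prod>x\<in>Z. box_weight y x (T x)))"
  proof (rule sum_split_set_label[where Y = "bounded_SS N"])
    have sub: "Q \<subseteq> Z \<and> Z \<subseteq> ?R" if "(Z, Q) \<in> ?Zs" for Z Q
    proof -
      from that obtain \<beta> P where \<beta>: "\<beta> \<in> ?Bs" "P \<subseteq> ?A \<beta>" "Z = region t \<beta>" "Q = ?Q \<beta> P" by auto
      then show ?thesis using region_Diff(3)[of t \<beta> b] by (auto simp: doubled_columns_def)
    qed
    then show "Q \<subseteq> Z \<and> Z \<subseteq> ?R" if "(Z, Q) \<in> ?Zs" for Z Q using that .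
    show "finite ?R" by (rule finite_region[OF bp])
    then show "finite (bounded_SS N Z)" if "(Z, Q) \<in> ?Zs" for Z Q
      using sub[OF that] by (intro finite_bounded_SS) (auto intro: finite_subset)
    show "finite ?Zs" by (auto simp: doubled_columns_def)
    show "T x \<noteq> {} \<and> ?m \<notin> T x \<and> box_weight y x (insert ?m (T x)) = (y ?m * - w (fst x)) * box_weight y x (T x)"
      if "T \<in> bounded_SS N Z" "x \<in> Z" for Z T x
    proof -
      have "T \<in> SS Z" "T x \<subseteq> {..N}" using that by (auto simp: bounded_SS_def)
      then have T: "finite (T x)" "T x \<noteq> {}" "?m \<notin> T x"
        using SSD(3,4)[of T Z x] that(2) by auto
      then show ?thesis
        using box_weight_insert[OF T] by blast
    qed
  qed (use iff in \<open>auto simp: bounded_SS_def dest: SSD(2)\<close>)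
  also have "\<dots> = (\<Sum>(\<beta>, P)\<in>Sigma ?Bs (\<lambda>\<beta>. Pow (?A \<beta>)). (\<Prod>x\<in>?R - region t \<beta>. box_weight y x {?m}) *
      (\<Prod>x\<in>?Q \<beta> P. y ?m * - w (fst x)) * ?G \<beta>)"
  proof (subst sum.reindex)
    show "inj_on (\<lambda>(\<beta>, P). (region t \<beta>, ?Q \<beta> P)) (Sigma ?Bs (\<lambda>\<beta>. Pow (?A \<beta>)))"
    proof (rule inj_onI, clarify)
      fix \<beta> P \<beta>' P' assume *: "t \<le> \<beta>" "t \<le> \<beta>'" "region t \<beta> = region t \<beta>'" "?Q \<beta> P = ?Q \<beta>' P'"
      have "\<beta> = \<beta>'" using region_inject *(1-3) by blast
      moreover have "P = P'" using arg_cong[OF *(4), of "image snd"] by (simp add: image_image)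
      ultimately show "\<beta> = \<beta>' \<and> P = P'" ..
    qed
  qed (simp add: comp_def case_prod_unfold)
  also have "\<dots> = (\<Sum>\<beta>\<in>?Bs. \<Sum>P\<in>Pow (?A \<beta>). (\<Prod>x\<in>?R - region t \<beta>. box_weight y x {?m}) *
      (\<Prod>x\<in>?Q \<beta> P. y ?m * - w (fst x)) * ?G \<beta>)"
    by (rule sum.Sigma[symmetric]) (auto simp: doubled_columns_def)
  also have "\<dots> = (\<Sum>\<beta>\<in>?Bs. ?G \<beta> * V_above t (y ?m) \<beta> b)"
  proof (rule sum.cong[OF refl])
    fix \<beta> assume \<beta>: "\<beta> \<in> ?Bs"
    have "(\<Prod>x\<in>?R - region t \<beta>. box_weight y x {?m}) = (\<Prod>j\<in>J. \<Prod>i\<in>{\<beta> j<..b j}. y ?m)"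
      using \<beta> prod_region[OF bp, of "\<lambda>_. y ?m" \<beta>] by (simp add: region_Diff box_weight_def del: prod_constant)
    moreover have "(\<Prod>x\<in>?Q \<beta> P. y ?m * - w (fst x)) = (\<Prod>j\<in>P. y ?m * - w (\<beta> j))" for P
      by (subst prod.reindex) (auto simp: inj_on_def)
    moreover have "V_above t (y ?m) \<beta> b = (\<Prod>j\<in>J. \<Prod>i\<in>{\<beta> j<..b j}. y ?m) *
        (\<Sum>P\<in>Pow (?A \<beta>). \<Prod>j\<in>P. y ?m * - w (\<beta> j))"
      by (rule V_above_expand) (use \<beta> in blast)
    ultimately show "(\<Sum>P\<in>Pow (?A \<beta>). (\<Prod>x\<in>?R - region t \<beta>. box_weight y x {?m}) *
      (\<Prod>x\<in>?Q \<beta> P. y ?m * - w (fst x)) * ?G \<beta>) = ?G \<beta> * V_above t (y ?m) \<beta> b"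
      by (simp only: sum_distrib_right[symmetric] sum_distrib_left[symmetric] mult_ac)
  qed
  also have "\<dots> = (\<Sum>\<beta> | \<beta> \<in> bounded_profiles p r L \<and> t \<le> \<beta> \<and> \<beta> \<le> b. ?G \<beta> * V_above t (y ?m) \<beta> b)"
  proof (rule sum.mono_neutral_left)
    show "\<forall>\<beta>\<in>{\<beta>. \<beta> \<in> bounded_profiles p r L \<and> t \<le> \<beta> \<and> \<beta> \<le> b} - ?Bs. ?G \<beta> * V_above t (y ?m) \<beta> b = 0"
    proof
      fix \<beta> assume "\<beta> \<in> {\<beta>. \<beta> \<in> bounded_profiles p r L \<and> t \<le> \<beta> \<and> \<beta> \<le> b} - ?Bs"
      then have "\<not> (\<forall>j\<in>J. b j = \<beta> j \<or> b j = Suc (\<beta> j))" by blast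
      then have "V_above t (y ?m) \<beta> b = 0"
        unfolding V_above_def by (rule if_not_P)
      then show "?G \<beta> * V_above t (y ?m) \<beta> b = 0" by simp
    qed
  qed auto
  finally show ?thesis .
qed

lemma V_above_chain_eq_tableaux:
  assumes t: "t \<in> bounded_profiles p r L" and "b \<in> bounded_profiles p r L" and "t \<le> b"
  shows "V_above_chain L t y N t b =
    (\<Sum>T\<in>bounded_SS N (region t b). \<Prod>x\<in>region t b. box_weight y x (T x))"
  using assms(2,3)
proof (induction N arbitrary: b)
  case 0
  show ?case
  proof (cases "t = b")
    case True
    moreover have "bounded_SS 0 {} = {\<lambda>x. undefined}"
      by (auto simp: bounded_SS_def SS_def set_valued_tableaux_def)
    ultimately show ?thesis by simp
  next
    case False
    then obtain x where x: "x \<in> region t b" using region_empty_iff[OF \<open>t \<le> b\<close>] by blast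
    have "T \<notin> bounded_SS 0 (region t b)" for T
    proof
      assume "T \<in> bounded_SS 0 (region t b)"
      then have "T \<in> SS (region t b)" "T x \<subseteq> {..0}" using x by (auto simp: bounded_SS_def)
      then show False using SSD(4,5)[of T "region t b" x] x by fastforce
    qed
    then have "bounded_SS 0 (region t b) = {}" by blast
    then show ?thesis using False by simp
  qed
next
  case (Suc N)
  let ?S = "bounded_profiles p r L"
  have "V_above_chain L t y (Suc N) t b = (\<Sum>\<beta>\<in>?S. V_above_chain L t y N t \<beta> * V_above t (y (Suc N)) \<beta> b)"
    by (simp add: kernel_mult_def)
  also have "\<dots> = (\<Sum>\<beta> | \<beta> \<in> ?S \<and> t \<le> \<beta> \<and> \<beta> \<le> b. V_above_chain L t y N t \<beta> * V_above t (y (Suc N)) \<beta> b)"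
  proof (rule sum.mono_neutral_right)
    show "\<forall>\<beta>\<in>?S - {\<beta>. \<beta> \<in> ?S \<and> t \<le> \<beta> \<and> \<beta> \<le> b}. V_above_chain L t y N t \<beta> * V_above t (y (Suc N)) \<beta> b = 0"
    proof
      fix \<beta> assume \<beta>: "\<beta> \<in> ?S - {\<beta>. \<beta> \<in> ?S \<and> t \<le> \<beta> \<and> \<beta> \<le> b}"
      then have "\<beta> \<in> ?S" "\<not> t \<le> \<beta> \<or> \<not> \<beta> \<le> b" by auto
      then have "V_above_chain L t y N t \<beta> = 0 \<or> V_above t (y (Suc N)) \<beta> b = 0"
        using V_above_chain_nonzero[OF _ t, of y N \<beta>] V_above_nonzero[of \<beta> t "y (Suc N)" b] bounded_profilesD(1) by blast
      then show "V_above_chain L t y N t \<beta> * V_above t (y (Suc N)) \<beta> b = 0" by auto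
    qed
  qed auto
  also have "\<dots> = (\<Sum>T\<in>bounded_SS (Suc N) (region t b). \<Prod>x\<in>region t b. box_weight y x (T x))"
    unfolding sum_bounded_SS_Suc[OF t Suc.prems]
    by (rule sum.cong[OF refl]) (use Suc.IH in simp)
  finally show ?case .
qed

end

section \<open>The expansion with finitely many labels\<close>

context transfer_kernels
begin

text \<open>This is the theorem with labels restricted to at most N. The pair (s, c) gives the two
  boundaries of \<mu>; \<open>region s t\<close> is the part A, \<open>region b c\<close> the part
  B, and the sign of B sits in the factors \<open>- w\<close>.\<close>

lemma sum_bounded_SS_expansion:
  assumes t: "t \<in> bounded_profiles p r L" and b: "b \<in> bounded_profiles p r L" and tb: "t \<le> b"
    and L: "\<And>j. t j + N \<le> L"
  shows "(\<Sum>T\<in>bounded_SS N (region t b). \<Prod>x\<in>region t b. box_weight y x (T x)) =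
    (\<Sum>(s, c) | s \<in> bounded_profiles p r L \<and> c \<in> bounded_profiles p r L \<and> s \<le> t \<and> b \<le> c.
       (\<Sum>T | T \<in> semistandard_tableaux (region s t) \<and> row_weakly_bounded (region s t) T. \<Prod>x\<in>region s t. w (T x)) *
       (\<Sum>T\<in>bounded_tableaux (\<lambda>_ _. True) N (region s c). \<Prod>x\<in>region s c. y (T x)) *
       (\<Sum>T\<in>bounded_reverse_tableaux L (region b c). \<Prod>x\<in>region b c. - w (T x)))"
proof -
  let ?S = "bounded_profiles p r L"
  let ?A = "\<lambda>s. \<Sum>\<nu> | \<nu> \<in> ?S \<and> \<nu> \<le> t. row_weight t \<nu> * H_chain L L s \<nu>"
  have H_strip: "H_chain L L = chain ?S (\<lambda>k. strip (\<lambda>i. k < i) (w k)) L"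
    by (simp only: H_eq_strip[abs_def])
  have A: "?A s = (\<Sum>T | T \<in> semistandard_tableaux (region s t) \<and> row_weakly_bounded (region s t) T. \<Prod>x\<in>region s t. w (T x))"
    if s: "s \<in> ?S" "s \<le> t" for s
  proof -
    have "?A s = (\<Sum>\<nu> | \<nu> \<in> ?S \<and> s \<le> \<nu> \<and> \<nu> \<le> t. row_weight t \<nu> * H_chain L L s \<nu>)"
      by (rule sum.mono_neutral_right) (use H_chain_nonzero[of L L s] s in force)+
    also have "\<dots> = (\<Sum>\<nu> | \<nu> \<in> ?S \<and> s \<le> \<nu> \<and> \<nu> \<le> t. row_weight t \<nu> *
       (\<Sum>T\<in>bounded_tableaux (\<lambda>k i. k < i) L (region s \<nu>). \<Prod>x\<in>region s \<nu>. w (T x)))"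
      unfolding H_strip by (intro sum.cong refl) (simp add: strip_chain_eq_tableaux[OF s(1)])
    also have "\<dots> = (\<Sum>T | T \<in> semistandard_tableaux (region s t) \<and> row_weakly_bounded (region s t) T. \<Prod>x\<in>region s t. w (T x))"
      by (rule sum_row_weakly_bounded[OF s(1) t s(2), symmetric])
    finally show ?thesis .
  qed
  have A0: "?A s = 0" if "s \<in> ?S" "\<not> s \<le> t" for s
    by (rule sum.neutral) (use H_chain_nonzero[of L L s] that in force)
  have V_strip: "V_chain L 0 y N s c = (\<Sum>T\<in>bounded_tableaux (\<lambda>_ _. True) N (region s c). \<Prod>x\<in>region s c. y (T x))"
    if "s \<in> ?S" "c \<in> ?S" "s \<le> c" for s c
    unfolding V_0_eq_strip by (rule strip_chain_eq_tableaux[OF that])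
  have "(\<Sum>T\<in>bounded_SS N (region t b). \<Prod>x\<in>region t b. box_weight y x (T x)) = V_above_chain L t y N t b"
    by (rule V_above_chain_eq_tableaux[OF t b tb, symmetric])
  also have "\<dots> = (\<Sum>s\<in>?S. \<Sum>c\<in>?S. ?A s * V_chain L 0 y N s c * D_chain L L c b)"
    by (rule V_above_chain_expansion[OF t b tb L])
  also have "\<dots> = (\<Sum>(s, c)\<in>?S \<times> ?S. ?A s * V_chain L 0 y N s c * D_chain L L c b)"
    by (rule sum.cartesian_product)
  also have "\<dots> = (\<Sum>(s, c) | s \<in> ?S \<and> c \<in> ?S \<and> s \<le> t \<and> b \<le> c. ?A s * V_chain L 0 y N s c * D_chain L L c b)"
  proof (rule sum.mono_neutral_right)
    show "\<forall>i\<in>?S \<times> ?S - {(s, c). s \<in> ?S \<and> c \<in> ?S \<and> s \<le> t \<and> b \<le> c}.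
        (case i of (s, c) \<Rightarrow> ?A s * V_chain L 0 y N s c * D_chain L L c b) = 0"
    proof
      fix i assume i: "i \<in> ?S \<times> ?S - {(s, c). s \<in> ?S \<and> c \<in> ?S \<and> s \<le> t \<and> b \<le> c}"
      then obtain s c where sc: "i = (s, c)" "s \<in> ?S" "c \<in> ?S" "\<not> s \<le> t \<or> \<not> b \<le> c" by auto
      from sc(4) have "?A s = 0 \<or> D_chain L L c b = 0"
        using A0[OF sc(2)] D_chain_nonzero[OF _ sc(3) b] by blast
      then show "(case i of (s, c) \<Rightarrow> ?A s * V_chain L 0 y N s c * D_chain L L c b) = 0"
        unfolding sc(1) by auto
    qed
  qed auto
  also have "\<dots> = (\<Sum>(s, c) | s \<in> ?S \<and> c \<in> ?S \<and> s \<le> t \<and> b \<le> c.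
       (\<Sum>T | T \<in> semistandard_tableaux (region s t) \<and> row_weakly_bounded (region s t) T. \<Prod>x\<in>region s t. w (T x)) *
       (\<Sum>T\<in>bounded_tableaux (\<lambda>_ _. True) N (region s c). \<Prod>x\<in>region s c. y (T x)) *
       (\<Sum>T\<in>bounded_reverse_tableaux L (region b c). \<Prod>x\<in>region b c. - w (T x)))"
  proof (rule sum.cong[OF refl], clarify)
    fix s c assume sc: "s \<in> ?S" "c \<in> ?S" "s \<le> t" "b \<le> c"
    have "s \<le> c" using sc tb by simp
    then show "?A s * V_chain L 0 y N s c * D_chain L L c b =
       (\<Sum>T | T \<in> semistandard_tableaux (region s t) \<and> row_weakly_bounded (region s t) T. \<Prod>x\<in>region s t. w (T x)) *
       (\<Sum>T\<in>bounded_tableaux (\<lambda>_ _. True) N (region s c). \<Prod>x\<in>region s c. y (T x)) *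
       (\<Sum>T\<in>bounded_reverse_tableaux L (region b c). \<Prod>x\<in>region b c. - w (T x))"
      by (simp only: A[OF sc(1,3)] V_strip[OF sc(1,2)] D_chain_eq_tableaux[OF sc(2) b sc(4)])
  qed
  finally show ?thesis .
qed

end

section \<open>Skew shapes as regions\<close>

text \<open>An empty column c cannot be crossed by an edge of the Hasse diagram: the box in column c
  and in the row of the smaller end would lie between the two ends, hence in the shape.\<close>

lemma connected_shape_columns:
  assumes "skew_shape \<sigma>" "connected_shape \<sigma>" "\<sigma> \<noteq> {}"
  shows "snd ` \<sigma> = {Min (snd ` \<sigma>)..<Suc (Max (snd ` \<sigma>))}"
proof
  have fin: "finite \<sigma>" using assms(1) by (simp add: skew_shape_def)
  then have "Min (snd ` \<sigma>) \<le> j \<and> j \<le> Max (snd ` \<sigma>)" if "j \<in> snd ` \<sigma>" for j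
    using that by simp
  then show "snd ` \<sigma> \<subseteq> {Min (snd ` \<sigma>)..<Suc (Max (snd ` \<sigma>))}"
    by (simp add: subset_iff less_Suc_eq_le)
  have Min_in: "Min (snd ` \<sigma>) \<in> snd ` \<sigma>" and Max_in: "Max (snd ` \<sigma>) \<in> snd ` \<sigma>"
    using fin assms(3) by (simp_all add: Min_in Max_in)
  show "{Min (snd ` \<sigma>)..<Suc (Max (snd ` \<sigma>))} \<subseteq> snd ` \<sigma>"
  proof (rule subsetI, rule ccontr)
    fix c assume c: "c \<in> {Min (snd ` \<sigma>)..<Suc (Max (snd ` \<sigma>))}" "c \<notin> snd ` \<sigma>"
    from Min_in obtain x where x: "x \<in> \<sigma>" "snd x = Min (snd ` \<sigma>)" by force
    from Max_in obtain z where z: "z \<in> \<sigma>" "snd z = Max (snd ` \<sigma>)" by force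
    have "snd x < c"
      using c x Min_in by (cases "snd x = c") auto
    have "c < snd z"
      using c z Max_in by (cases "snd z = c") auto
    have edge: "snd a < c \<longleftrightarrow> snd b < c" if "(a, b) \<in> hasse \<sigma>" for a b
    proof -
      have ab: "a \<in> \<sigma>" "b \<in> \<sigma>" "a \<le> b" using that by (auto simp: hasse_def)
      show ?thesis
      proof
        show "snd a < c" if "snd b < c"
          using ab(3) that by (auto simp: less_eq_prod_def)
      next
        assume "snd a < c"
        show "snd b < c"
        proof (rule ccontr)
          assume "\<not> snd b < c"
          then have "a \<le> (fst a, c)" "(fst a, c) \<le> b"
            using ab(3) \<open>snd a < c\<close> by (auto simp: less_eq_prod_def)
          then have "(fst a, c) \<in> \<sigma>"
            using assms(1) ab(1,2) unfolding skew_shape_def by blast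
          then show False using c(2) by force
        qed
      qed
    qed
    have "(x, z) \<in> (hasse \<sigma> \<union> (hasse \<sigma>)\<inverse>)\<^sup>*"
      using assms(2) x(1) z(1) by (auto simp: connected_shape_def)
    then have "snd z < c"
      by (induction rule: rtrancl_induct) (use \<open>snd x < c\<close> edge in auto)
    then show False using \<open>c < snd z\<close> by simp
  qed
qed

text \<open>Interval closure fills each column between its extreme rows. It also makes the
  boundaries monotone: if a boundary descended from column j to j + 1, the box at its new level in
  one column, or at its old level in the other, would lie between two boxes of \<mu> and violate
  extremality.\<close>

lemma skew_shape_eq_region:
  assumes \<mu>: "skew_shape \<mu>" and cols: "snd ` \<mu> = {p..<r}"
  obtains t b where "t \<in> profiles p r" "b \<in> profiles p r" "\<forall>j\<in>{p..<r}. t j < b j" "\<mu> = region t b"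
proof -
  define C where "C j = {i. (i, j) \<in> \<mu>}" for j
  define b where "b j = (if j \<in> {p..<r} then Max (C j) else 0)" for j
  \<comment> \<open>Rows start from 1, so the subtraction is exact and \<open>Suc (t j)\<close> is
    the top row of the column.\<close>
  define t where "t j = (if j \<in> {p..<r} then Min (C j) - 1 else 0)" for j
  have fin: "finite \<mu>" and pos: "\<And>i j. (i, j) \<in> \<mu> \<Longrightarrow> 1 \<le> i"
    and interval: "\<And>x y z. x \<in> \<mu> \<Longrightarrow> z \<in> \<mu> \<Longrightarrow> x \<le> y \<Longrightarrow> y \<le> z \<Longrightarrow> y \<in> \<mu>"
    using \<mu> unfolding skew_shape_def by (simp, fastforce, blast)
  have finC: "finite (C j)" for j
  proof (rule finite_subset)
    show "C j \<subseteq> fst ` \<mu>" by (force simp: C_def)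
  qed (simp add: fin)
  have col: "j \<in> {p..<r}" if "(i, j) \<in> \<mu>" for i j
    using imageI[OF that, of snd] cols by simp
  have neC: "C j \<noteq> {}" if j: "j \<in> {p..<r}" for j
  proof -
    from j have "j \<in> snd ` \<mu>" using cols by blast
    then obtain x where "x \<in> \<mu>" "snd x = j" by blast
    then show ?thesis by (cases x) (auto simp: C_def)
  qed
  have bin: "(b j, j) \<in> \<mu>" and tin: "(Suc (t j), j) \<in> \<mu>" and t1: "\<And>i. (i, j) \<in> \<mu> \<Longrightarrow> t j < i \<and> i \<le> b j"
    if j: "j \<in> {p..<r}" for j
  proof -
    have M: "Max (C j) \<in> C j" "Min (C j) \<in> C j" using finC neC[OF j] by (auto intro: Max_in Min_in)
    then show "(b j, j) \<in> \<mu>" unfolding b_def using j by (auto simp: C_def)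
    have "1 \<le> Min (C j)" using M(2) pos by (auto simp: C_def)
    then have S: "Suc (t j) = Min (C j)" using j by (simp add: t_def)
    with M(2) show "(Suc (t j), j) \<in> \<mu>" by (simp add: C_def)
    show "t j < i \<and> i \<le> b j" if "(i, j) \<in> \<mu>" for i
      using Max_ge[OF finC, of i j] Min_le[OF finC, of i j] that S j by (auto simp: b_def C_def)
  qed
  have "\<mu> = region t b"
  proof safe
    fix i j assume "(i, j) \<in> \<mu>"
    then show "(i, j) \<in> region t b" using t1[OF col] by auto
  next
    fix i j assume ij: "(i, j) \<in> region t b"
    then have "j \<in> {p..<r}" by (auto simp: b_def split: if_splits)
    from interval[OF tin[OF this] bin[OF this], of "(i, j)"] show "(i, j) \<in> \<mu>" using ij by auto
  qed
  moreover have "b (Suc j) \<le> b j \<and> t (Suc j) \<le> t j" if "p \<le> j" for j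
  proof (cases "Suc j < r")
    case True
    then have j: "j \<in> {p..<r}" "Suc j \<in> {p..<r}" using that by auto
    have "b (Suc j) \<le> b j"
    proof (rule ccontr)
      assume "\<not> b (Suc j) \<le> b j"
      then have "(b (Suc j), j) \<in> \<mu>"
        by (intro interval[OF bin[OF j(1)] bin[OF j(2)]]) auto
      then show False using t1[OF j(1)] \<open>\<not> b (Suc j) \<le> b j\<close> by blast
    qed
    moreover have "t (Suc j) \<le> t j"
    proof (rule ccontr)
      assume *: "\<not> t (Suc j) \<le> t j"
      then have "(Suc (t j), Suc j) \<in> \<mu>"
        by (intro interval[OF tin[OF j(1)] tin[OF j(2)]]) auto
      then have "t (Suc j) < Suc (t j)" using t1[OF j(2)] by blast
      then show False using * by simp
    qed
    ultimately show ?thesis ..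
  next
    case False
    then show ?thesis by (simp add: b_def t_def)
  qed
  then have "b \<in> profiles p r" "t \<in> profiles p r"
    by (auto simp: profiles_def b_def t_def)
  moreover have "t j < b j" if "j \<in> {p..<r}" for j
    using t1[OF that bin[OF that]] by simp
  ultimately show ?thesis using that by blast
qed

lemma skew_shape_region:
  assumes t: "t \<in> profiles p r" and b: "b \<in> profiles p r" and "1 \<le> p"
  shows "skew_shape (region t b)"
  unfolding skew_shape_def
proof (intro conjI ballI allI impI)
  show "finite (region t b)" by (rule finite_region[OF b])
  show "case x of (i, j) \<Rightarrow> 1 \<le> i \<and> 1 \<le> j" if "x \<in> region t b" for x
    using that region_column[OF b] \<open>1 \<le> p\<close> by (cases x) fastforce
  fix x z y assume *: "x \<in> region t b" "z \<in> region t b" "x \<le> y \<and> y \<le> z"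
  obtain i j i' j' k l where e: "x = (i, j)" "z = (i', j')" "y = (k, l)" by (metis surj_pair)
  have "p \<le> j" using region_column[OF b] *(1) e by simp
  then have "t l \<le> t j" "b j' \<le> b l"
    using * e by (auto intro!: profiles_antimono[OF t] profiles_antimono[OF b])
  then show "y \<in> region t b" using * e by auto
qed

text \<open>In a nonempty column the top and bottom rows recover both heights. This makes the pair
  of boundaries a faithful index for the shapes \<mu>.\<close>

lemma region_eqD:
  assumes "s \<in> profiles p r" "c \<in> profiles p r" "s' \<in> profiles p r" "c' \<in> profiles p r"
    and "\<And>j. j \<in> {p..<r} \<Longrightarrow> s j < c j" "region s c = region s' c'"
    and "\<And>j. j \<in> {p..<r} \<Longrightarrow> s' j < c' j"
  shows "s = s' \<and> c = c'"
proof -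
  have "s j = s' j \<and> c j = c' j" for j
  proof (cases "j \<in> {p..<r}")
    case True
    have "(Suc (s j), j) \<in> region s c" "(c j, j) \<in> region s c"
      "(Suc (s' j), j) \<in> region s' c'" "(c' j, j) \<in> region s' c'"
      using assms(5)[OF True] assms(7)[OF True] by auto
    then have "(Suc (s j), j) \<in> region s' c'" "(c j, j) \<in> region s' c'"
      "(Suc (s' j), j) \<in> region s c" "(c' j, j) \<in> region s c"
      using assms(6) by blast+
    then show ?thesis by simp
  next
    case False
    then show ?thesis using profiles_outside assms(1-4) by metis
  qed
  then show ?thesis by auto
qed

text \<open>The containment convention forces \<mu> to occupy exactly the columns of \<sigma>, so
  the index set of the theorem becomes a set of pairs of profiles enclosing those of
  \<sigma>.\<close>

lemma contains_region:
  assumes "t \<in> profiles p r" "b \<in> profiles p r" "1 \<le> p" "\<And>j. j \<in> {p..<r} \<Longrightarrow> t j < b j"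
  shows "skew_shape \<mu> \<and> contains_shape \<mu> (region t b) \<longleftrightarrow>
    (\<exists>s c. s \<in> profiles p r \<and> c \<in> profiles p r \<and> s \<le> t \<and> b \<le> c \<and> \<mu> = region s c)" (is "?l \<longleftrightarrow> ?r")
proof
  assume l: ?l
  have "snd ` \<mu> = {p..<r}"
  proof safe
    fix i j assume "(i, j) \<in> \<mu>"
    then obtain i' where "(i', j) \<in> region t b"
      using l unfolding contains_shape_def by blast
    then show "snd (i, j) \<in> {p..<r}" using region_column[OF assms(2)] by simp
  next
    fix j assume "j \<in> {p..<r}"
    then have "(b j, j) \<in> \<mu>"
      using assms(4)[of j] l by (auto simp: contains_shape_def)
    then show "j \<in> snd ` \<mu>" by force
  qed
  then obtain s c where sc: "s \<in> profiles p r" "c \<in> profiles p r" "\<mu> = region s c"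
    using skew_shape_eq_region[of \<mu> p r] l by metis
  have sub: "region t b \<subseteq> region s c" using l sc(3) by (simp add: contains_shape_def)
  have "s j \<le> t j \<and> b j \<le> c j" for j
  proof (cases "j \<in> {p..<r}")
    case True
    then have "(Suc (t j), j) \<in> region t b" "(b j, j) \<in> region t b"
      using assms(4)[OF True] by auto
    then have "(Suc (t j), j) \<in> region s c" "(b j, j) \<in> region s c"
      using sub by blast+
    then show ?thesis by auto
  next
    case False
    then show ?thesis using profiles_outside[OF sc(1)] profiles_outside[OF assms(2)] by simp
  qed
  then show ?r using sc by (auto simp: le_fun_def)
next
  assume ?r
  then obtain s c where sc: "s \<in> profiles p r" "c \<in> profiles p r" "s \<le> t" "b \<le> c" "\<mu> = region s c" by blast
  have le: "s j \<le> t j" "b j \<le> c j" for j using sc(3,4) by (auto simp: le_fun_def)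
  have "\<exists>i'. (i', j) \<in> region t b" if "(i, j) \<in> \<mu>" for i j
  proof -
    have "j \<in> {p..<r}" using region_column[OF sc(2)] that sc(5) by blast
    then show ?thesis using assms(4)[of j] by (intro exI[of _ "b j"]) auto
  qed
  moreover have "region t b \<subseteq> \<mu>"
  proof
    fix x assume "x \<in> region t b"
    then show "x \<in> \<mu>" using le[of "snd x"] unfolding sc(5) by (cases x) auto
  qed
  ultimately show ?l
    using skew_shape_region[OF sc(1,2) assms(3)] sc(5) by (auto simp: contains_shape_def)
qed

lemma parts_region:
  assumes "t \<in> profiles p r" "b \<in> profiles p r" "\<And>j. j \<in> {p..<r} \<Longrightarrow> t j < b j"
    and "c \<in> profiles p r" "s \<le> t" "b \<le> c"
  shows "above_part (region s c) (region t b) = region s t"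
    "below_part (region s c) (region t b) = region b c"
proof -
  have le: "s j \<le> t j" "b j \<le> c j" for j using assms(5,6) by (auto simp: le_fun_def)
  have tb: "t j \<le> b j" for j
    using assms(3)[of j] profiles_outside[OF assms(1), of j] by (cases "j \<in> {p..<r}") auto
  have "(i, j) \<in> above_part (region s c) (region t b) \<longleftrightarrow> (i, j) \<in> region s t" for i j
  proof
    assume "(i, j) \<in> region s t"
    moreover from this have "j \<in> {p..<r}" using region_column[OF assms(1)] by blast
    ultimately show "(i, j) \<in> above_part (region s c) (region t b)"
      using le[of j] assms(3)[of j] unfolding above_part_def by (auto intro!: exI[of _ "b j"])
  qed (auto simp: above_part_def)
  then show "above_part (region s c) (region t b) = region s t" by (auto simp only: set_eq_iff split_paired_All)
  have "(i, j) \<in> below_part (region s c) (region t b) \<longleftrightarrow> (i, j) \<in> region b c" for i j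
  proof
    assume "(i, j) \<in> region b c"
    moreover from this have "j \<in> {p..<r}" using region_column[OF assms(4)] by blast
    ultimately show "(i, j) \<in> below_part (region s c) (region t b)"
      using le[of j] assms(3)[of j] unfolding below_part_def by (auto intro!: exI[of _ "b j"])
  qed (auto simp: below_part_def)
  then show "below_part (region s c) (region t b) = region b c" by (auto simp only: set_eq_iff split_paired_All)
qed

section \<open>Monomials of tableaux\<close>

text \<open>A single multiplicative evaluation that covers the monomials in x, the monomials in w
  and the sign, the last with \<open>f\<close> constantly -1.\<close>

definition eval_exponents :: "(nat \<Rightarrow> 'a) \<Rightarrow> (nat \<Rightarrow>\<^sub>0 nat) \<Rightarrow> 'a::comm_monoid_mult" where
  "eval_exponents f c = (\<Prod>i\<in>Poly_Mapping.keys c. f i ^ Poly_Mapping.lookup c i)"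

lemma x_power_eval: "x_power = eval_exponents (\<lambda>i. mfps_var (X i))"
  by (intro ext) (simp add: x_power_def eval_exponents_def)

lemma w_power_eval: "w_power = eval_exponents (\<lambda>i. mfps_var (W i))"
  by (intro ext) (simp add: w_power_def eval_exponents_def)

lemma minus_one_power_exponent_sum: "(- 1) ^ exponent_sum e = eval_exponents (\<lambda>_. - 1 :: 'a::comm_ring_1) e"
  by (simp add: exponent_sum_def eval_exponents_def power_sum)

lemma eval_exponents_superset:
  assumes "finite A" "Poly_Mapping.keys c \<subseteq> A"
  shows "eval_exponents f c = (\<Prod>i\<in>A. f i ^ Poly_Mapping.lookup c i)"
  unfolding eval_exponents_def
  by (rule prod.mono_neutral_left) (use assms in \<open>auto simp: in_keys_iff\<close>)

lemma eval_exponents_add: "eval_exponents f (a + b) = eval_exponents f a * eval_exponents f b"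
proof -
  let ?A = "Poly_Mapping.keys a \<union> Poly_Mapping.keys b"
  have "finite ?A" by simp
  moreover have "Poly_Mapping.keys (a + b) \<subseteq> ?A" by (rule keys_add)
  ultimately show ?thesis
    by (simp add: eval_exponents_superset[of ?A] lookup_add power_add prod.distrib)
qed

lemma eval_exponents_single [simp]: "eval_exponents f (Poly_Mapping.single i n) = f i ^ n"
  by (subst eval_exponents_superset[of "{i}"]) auto

lemma eval_exponents_sum: "eval_exponents f (\<Sum>x\<in>A. g x) = (\<Prod>x\<in>A. eval_exponents f (g x))"
proof (induction A rule: infinite_finite_induct)
  case (insert x A)
  then show ?case by (simp add: eval_exponents_add)
qed (simp_all add: eval_exponents_def)

lemma eval_content: "eval_exponents f (content \<sigma> T) = (\<Prod>x\<in>\<sigma>. f (T x))"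
  by (simp add: content_def eval_exponents_sum)

lemma eval_sv_content: "eval_exponents f (sv_content \<sigma> T) = (\<Prod>x\<in>\<sigma>. \<Prod>i\<in>T x. f i)"
  by (simp add: sv_content_def eval_exponents_sum)

text \<open>Every box holds at least one label, so the truncated subtraction in
  \<open>excess\<close> is exact and can be carried out box by box.\<close>

lemma eval_excess:
  assumes "T \<in> SS \<sigma>"
  shows "eval_exponents f (excess \<sigma> T) = (\<Prod>x\<in>\<sigma>. f (fst x) ^ (card (T x) - 1))"
proof -
  have "Poly_Mapping.single (fst x) (card (T x)) =
      Poly_Mapping.single (fst x) (card (T x) - 1) + Poly_Mapping.single (fst x) 1" if "x \<in> \<sigma>" for x
  proof -
    have "card (T x) = card (T x) - 1 + 1"
      using SSD(3,4)[OF assms that] by (simp add: card_gt_0_iff)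
    then show ?thesis by (metis single_add)
  qed
  then have "excess \<sigma> T = (\<Sum>x\<in>\<sigma>. Poly_Mapping.single (fst x) (card (T x) - 1))"
    by (simp add: excess_def sum.distrib)
  then show ?thesis by (simp add: eval_exponents_sum)
qed

section \<open>Extracting coefficients\<close>

lemma coeff_zero_of_dvd:
  assumes "mfps_var v dvd g" "v \<notin> Poly_Mapping.keys m"
  shows "coeff g m = 0"
proof -
  obtain h where g: "g = mfps_var v * h" using assms(1) by (rule dvdE)
  show ?thesis
    unfolding g coeff_mult
  proof (rule sum.neutral, clarify)
    fix a b assume "(a, b) \<in> decomps m"
    then have m: "m = a + b" by (simp add: decomps_def)
    have "a \<noteq> Poly_Mapping.single v 1"
    proof
      assume "a = Poly_Mapping.single v 1"
      then have "Poly_Mapping.lookup m v = 1 + Poly_Mapping.lookup b v"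
        by (simp add: m lookup_add)
      then show False using assms(2) by (simp add: in_keys_iff)
    qed
    then show "coeff (mfps_var v) a * coeff h b = 0" by (simp add: mfps_var_def)
  qed
qed

lemma coeff_infsum:
  assumes "F summable_on I" "finite A" "A \<subseteq> I" "\<And>i. i \<in> I - A \<Longrightarrow> coeff (F i) m = 0"
  shows "coeff (infsum F I) m = coeff (\<Sum>i\<in>A. F i) m"
proof -
  have "(sum F \<longlongrightarrow> infsum F I) (finite_subsets_at_top I)"
    using has_sum_infsum[OF assms(1)] by (simp add: has_sum_def)
  then have "eventually (\<lambda>B. coeff (sum F B) m = coeff (infsum F I) m) (finite_subsets_at_top I)"
    by (simp add: tendsto_mfps_iff)
  then obtain B where B: "finite B" "B \<subseteq> I"
      "\<forall>C. finite C \<and> B \<subseteq> C \<and> C \<subseteq> I \<longrightarrow> coeff (sum F C) m = coeff (infsum F I) m"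
    unfolding eventually_finite_subsets_at_top by blast
  have "coeff (infsum F I) m = coeff (sum F (B \<union> A)) m"
    using B(1,2) assms(2,3) by (intro B(3)[rule_format, symmetric]) simp
  also have "\<dots> = coeff (sum F A) m"
    unfolding coeff_sum using B(1,2) assms(2-) by (intro sum.mono_neutral_right) auto
  finally show ?thesis .
qed

text \<open>Convergence is coefficientwise, so the finite set that already yields the right value
  may depend on the exponent m.\<close>

lemma has_sum_mfpsI:
  assumes "\<And>m. \<exists>A. finite A \<and> A \<subseteq> I \<and> (\<forall>i\<in>I - A. coeff (F i) m = 0) \<and> coeff (\<Sum>i\<in>A. F i) m = coeff l m"
  shows "(F has_sum l) I"
  unfolding has_sum_def tendsto_mfps_iff
proof
  fix m
  obtain A where A: "finite A" "A \<subseteq> I" "\<And>i. i \<in> I - A \<Longrightarrow> coeff (F i) m = 0" "coeff (\<Sum>i\<in>A. F i) m = coeff l m"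
    using assms[of m] by blast
  show "eventually (\<lambda>B. coeff (sum F B) m = coeff l m) (finite_subsets_at_top I)"
    unfolding eventually_finite_subsets_at_top
  proof (intro exI[of _ A] conjI allI impI)
    fix B assume B: "finite B \<and> A \<subseteq> B \<and> B \<subseteq> I"
    have "coeff (sum F B) m = coeff (sum F A) m"
      unfolding coeff_sum using B A(3) by (intro sum.mono_neutral_right) auto
    then show "coeff (sum F B) m = coeff l m" using A(4) by simp
  qed (use A in auto)
qed

text \<open>Only the x part is bounded, since it alone limits the labels; the w variables are
  limited by the rows that occur.\<close>

definition x_bounded :: "nat \<Rightarrow> (variable \<Rightarrow>\<^sub>0 nat) \<Rightarrow> bool" where
  "x_bounded N m \<longleftrightarrow> (\<forall>i. X i \<in> Poly_Mapping.keys m \<longrightarrow> i \<le> N)"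

lemma x_bounded_exists: "\<exists>N. x_bounded N m"
proof -
  have "finite {i. X i \<in> Poly_Mapping.keys m}"
    using finite_vimageI[of "Poly_Mapping.keys m" X] by (auto simp: vimage_def inj_def)
  then show ?thesis
    unfolding x_bounded_def by (metis (mono_tags, lifting) finite_nat_set_iff_bounded_le mem_Collect_eq)
qed

text \<open>Boundedness passes from an exponent to its summands. So a Schur function may be replaced
  by its part with labels at most N even inside a product with w factors.\<close>

lemma coeff_mult_cong:
  assumes "\<And>k. x_bounded N k \<Longrightarrow> coeff f k = coeff f' k" "x_bounded N m"
  shows "coeff (f * g) m = coeff (f' * g) m"
  unfolding coeff_mult
proof (rule sum.cong[OF refl], clarify)
  fix a b assume "(a, b) \<in> decomps m"
  then have "m = a + b" by (simp add: decomps_def)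
  then have "Poly_Mapping.keys a \<subseteq> Poly_Mapping.keys m"
    by (auto simp: in_keys_iff lookup_add)
  then have "x_bounded N a" using assms(2) by (auto simp: x_bounded_def)
  then show "coeff f a * coeff g b = coeff f' a * coeff g b" using assms(1) by simp
qed

text \<open>A tableau with a label k above N has a monomial divisible by the variable
  \<open>X k\<close>, which does not occur in m.\<close>

lemma coeff_schur:
  assumes "finite \<mu>" "x_bounded N m"
  shows "coeff (schur \<mu>) m =
    coeff (\<Sum>T\<in>bounded_tableaux (\<lambda>_ _. True) N \<mu>. \<Prod>x\<in>\<mu>. mfps_var (X (T x))) m"
proof -
  have eq: "x_power (content \<mu> T) = (\<Prod>x\<in>\<mu>. mfps_var (X (T x)))" for T
    by (simp add: x_power_eval eval_content)
  have "coeff (schur \<mu>) m = coeff (\<Sum>T\<in>bounded_tableaux (\<lambda>_ _. True) N \<mu>. x_power (content \<mu> T)) m"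
    unfolding schur_def
  proof (rule coeff_infsum[OF schur_summable[OF assms(1)] finite_bounded_tableaux[OF assms(1)]])
    fix T assume "T \<in> semistandard_tableaux \<mu> - bounded_tableaux (\<lambda>_ _. True) N \<mu>"
    then obtain x where x: "x \<in> \<mu>" "\<not> T x \<le> N"
      unfolding bounded_tableaux_def by blast
    have "mfps_var (X (T x)) dvd x_power (content \<mu> T)"
      unfolding eq using assms(1) x(1) by (rule dvd_prodI)
    moreover have "X (T x) \<notin> Poly_Mapping.keys m"
      using assms(2) x(2) by (auto simp: x_bounded_def)
    ultimately show "coeff (x_power (content \<mu> T)) m = 0" by (rule coeff_zero_of_dvd)
  qed (auto simp: bounded_tableaux_def)
  then show ?thesis by (simp only: eq)
qed

lemma RG_term:
  assumes "T \<in> SS \<sigma>"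
  shows "(- 1) ^ exponent_sum (excess \<sigma> T) * x_power (sv_content \<sigma> T) * w_power (excess \<sigma> T) =
    (\<Prod>x\<in>\<sigma>. transfer_kernels.box_weight (\<lambda>i. mfps_var (W i)) (\<lambda>i. mfps_var (X i)) x (T x))"
proof -
  \<comment> \<open>The constant \<open>box_weight\<close> involves only w, so any columns p and r
    serve here.\<close>
  interpret transfer_kernels 0 0 "\<lambda>i. mfps_var (W i)" by unfold_locales simp
  show ?thesis
    unfolding minus_one_power_exponent_sum x_power_eval w_power_eval eval_sv_content eval_excess[OF assms]
      box_weight_def prod.distrib[symmetric]
  proof (rule prod.cong[OF refl])
    fix x
    show "(- 1) ^ (card (T x) - 1) * (\<Prod>i\<in>T x. mfps_var (X i)) * mfps_var (W (fst x)) ^ (card (T x) - 1) =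
        (\<Prod>k\<in>T x. mfps_var (X k)) * (- mfps_var (W (fst x))) ^ (card (T x) - 1)"
      by (subst power_minus[of "mfps_var (W (fst x))"]) (simp only: mult_ac)
  qed
qed

lemma coeff_RG:
  assumes "finite \<sigma>" "x_bounded N m"
  shows "coeff (RG \<sigma>) m = coeff (\<Sum>T\<in>bounded_SS N \<sigma>. \<Prod>x\<in>\<sigma>.
    transfer_kernels.box_weight (\<lambda>i. mfps_var (W i)) (\<lambda>i. mfps_var (X i)) x (T x)) m"
proof -
  let ?F = "\<lambda>T. (- 1) ^ exponent_sum (excess \<sigma> T) * x_power (sv_content \<sigma> T) * w_power (excess \<sigma> T)"
  have "coeff (RG \<sigma>) m = coeff (\<Sum>T\<in>bounded_SS N \<sigma>. ?F T) m"
    unfolding RG_def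
  proof (rule coeff_infsum[OF RG_summable[OF assms(1)] finite_bounded_SS[OF assms(1)]])
    fix T assume "T \<in> SS \<sigma> - bounded_SS N \<sigma>"
    then obtain x k where x: "T \<in> SS \<sigma>" "x \<in> \<sigma>" "k \<in> T x" "\<not> k \<le> N"
      unfolding bounded_SS_def by blast
    have "mfps_var (X k) dvd (\<Prod>i\<in>T x. mfps_var (X i))"
      using SSD(3)[OF x(1,2)] x(3) by (rule dvd_prodI)
    also have "\<dots> dvd x_power (sv_content \<sigma> T)"
      unfolding x_power_eval eval_sv_content using assms(1) x(2) by (rule dvd_prodI)
    also have "\<dots> dvd ?F T" by simp
    finally have "mfps_var (X k) dvd ?F T" .
    moreover have "X k \<notin> Poly_Mapping.keys m"
      using assms(2) x(4) by (auto simp: x_bounded_def)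
    ultimately show "coeff (?F T) m = 0" by (rule coeff_zero_of_dvd)
  qed (auto simp: bounded_SS_def)
  also have "(\<Sum>T\<in>bounded_SS N \<sigma>. ?F T) = (\<Sum>T\<in>bounded_SS N \<sigma>. \<Prod>x\<in>\<sigma>.
    transfer_kernels.box_weight (\<lambda>i. mfps_var (W i)) (\<lambda>i. mfps_var (X i)) x (T x))"
    by (rule sum.cong[OF refl]) (rule RG_term, simp add: bounded_SS_def)
  finally show ?thesis .
qed

text \<open>Contents add over the two parts, so collecting pairs (T', T'') by their total content e
  turns the product of two generating functions into a sum over e. Labels start from 1, which keeps
  0 out of the support of e, as the index set of the theorem demands.\<close>

lemma sum_coeff_a:
  assumes PA: "finite {T \<in> semistandard_tableaux (above_part \<mu> \<sigma>). row_weakly_bounded (above_part \<mu> \<sigma>) T}"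
    and PB: "finite {T \<in> reverse_row_strict_tableaux (below_part \<mu> \<sigma>). row_bounded (below_part \<mu> \<sigma>) T}"
  shows "finite {e. coeff_a \<sigma> \<mu> e \<noteq> 0}" "coeff_a \<sigma> \<mu> e \<noteq> 0 \<Longrightarrow> 0 \<notin> Poly_Mapping.keys e"
    "(\<Sum>e | coeff_a \<sigma> \<mu> e \<noteq> 0. of_nat (coeff_a \<sigma> \<mu> e) * w_power e) =
     (\<Sum>T | T \<in> semistandard_tableaux (above_part \<mu> \<sigma>) \<and> row_weakly_bounded (above_part \<mu> \<sigma>) T.
        \<Prod>x\<in>above_part \<mu> \<sigma>. mfps_var (W (T x))) *
     (\<Sum>T | T \<in> reverse_row_strict_tableaux (below_part \<mu> \<sigma>) \<and> row_bounded (below_part \<mu> \<sigma>) T.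
        \<Prod>x\<in>below_part \<mu> \<sigma>. mfps_var (W (T x)))"
proof -
  let ?a = "above_part \<mu> \<sigma>" and ?b = "below_part \<mu> \<sigma>"
  let ?A = "{T \<in> semistandard_tableaux ?a. row_weakly_bounded ?a T}"
  let ?B = "{T \<in> reverse_row_strict_tableaux ?b. row_bounded ?b T}"
  let ?c = "\<lambda>(T', T''). content ?a T' + content ?b T''"
  have fin: "finite (?A \<times> ?B)" using PA PB by simp
  have a: "coeff_a \<sigma> \<mu> e = card {P \<in> ?A \<times> ?B. ?c P = e}" for e
    unfolding coeff_a_def by (rule arg_cong[of _ _ card]) auto
  have E: "{e. coeff_a \<sigma> \<mu> e \<noteq> 0} = ?c ` (?A \<times> ?B)"
  proof -
    have "finite {P \<in> ?A \<times> ?B. ?c P = e}" for e using fin by simp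
    then have "coeff_a \<sigma> \<mu> e \<noteq> 0 \<longleftrightarrow> {P \<in> ?A \<times> ?B. ?c P = e} \<noteq> {}" for e
      unfolding a by (simp only: card_eq_0_iff simp_thms)
    then have "{e. coeff_a \<sigma> \<mu> e \<noteq> 0} = {e. {P \<in> ?A \<times> ?B. ?c P = e} \<noteq> {}}" by (simp only:)
    also have "\<dots> = ?c ` (?A \<times> ?B)" by blast
    finally show ?thesis .
  qed
  show "finite {e. coeff_a \<sigma> \<mu> e \<noteq> 0}" unfolding E using fin by (rule finite_imageI)
  show "0 \<notin> Poly_Mapping.keys e" if "coeff_a \<sigma> \<mu> e \<noteq> 0"
  proof -
    from that have "e \<in> {e. coeff_a \<sigma> \<mu> e \<noteq> 0}" by simp
    then obtain T' T'' where T: "T' \<in> ?A" "T'' \<in> ?B" "e = content ?a T' + content ?b T''"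
      unfolding E by auto
    have nz: "0 \<notin> Poly_Mapping.keys (content \<tau> T)" if "T \<in> tableaux \<tau>" for \<tau> T
    proof -
      have "Poly_Mapping.lookup (content \<tau> T) 0 = (\<Sum>x\<in>\<tau>. Poly_Mapping.lookup (Poly_Mapping.single (T x) (1::nat)) 0)"
        unfolding content_def lookup_sum ..
      also have "\<dots> = 0"
        by (rule sum.neutral) (use that in \<open>fastforce simp: tableaux_def PiE_iff lookup_single\<close>)
      finally show ?thesis by (simp add: in_keys_iff)
    qed
    have "T' \<in> tableaux ?a" "T'' \<in> tableaux ?b"
      using T semistandardD(1) reverse_row_strictD(1) by blast+
    then show ?thesis
      unfolding T(3) using nz keys_add[of "content ?a T'" "content ?b T''"] by blast
  qed
  have "(\<Sum>e | coeff_a \<sigma> \<mu> e \<noteq> 0. of_nat (coeff_a \<sigma> \<mu> e) * w_power e) =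
      (\<Sum>e\<in>?c ` (?A \<times> ?B). \<Sum>P | P \<in> ?A \<times> ?B \<and> ?c P = e. w_power (?c P))"
    unfolding E unfolding a by (rule sum.cong[OF refl]) simp
  also have "\<dots> = (\<Sum>P\<in>?A \<times> ?B. w_power (?c P))"
    by (rule sum.image_gen[OF fin, symmetric])
  also have "\<dots> = (\<Sum>(T', T'')\<in>?A \<times> ?B. (\<Prod>x\<in>?a. mfps_var (W (T' x))) * (\<Prod>x\<in>?b. mfps_var (W (T'' x))))"
    by (rule sum.cong) (auto simp: w_power_eval eval_exponents_add eval_content)
  also have "\<dots> = (\<Sum>T\<in>?A. \<Prod>x\<in>?a. mfps_var (W (T x))) * (\<Sum>T\<in>?B. \<Prod>x\<in>?b. mfps_var (W (T x)))"
    by (simp add: sum_product sum.cartesian_product)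
  finally show "(\<Sum>e | coeff_a \<sigma> \<mu> e \<noteq> 0. of_nat (coeff_a \<sigma> \<mu> e) * w_power e) =
     (\<Sum>T | T \<in> semistandard_tableaux ?a \<and> row_weakly_bounded ?a T. \<Prod>x\<in>?a. mfps_var (W (T x))) *
     (\<Sum>T | T \<in> reverse_row_strict_tableaux ?b \<and> row_bounded ?b T. \<Prod>x\<in>?b. mfps_var (W (T x)))" .
qed

lemma row_weakly_bounded_eq:
  assumes "\<And>i j. (i, j) \<in> \<tau> \<Longrightarrow> i \<le> L"
  shows "{T \<in> semistandard_tableaux \<tau>. row_weakly_bounded \<tau> T} = bounded_tableaux (\<lambda>k i. k \<le> i) L \<tau>"
  using assms by (fastforce simp: bounded_tableaux_def row_weakly_bounded_def)

lemma row_bounded_eq: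
  assumes "\<And>i j. (i, j) \<in> \<tau> \<Longrightarrow> i \<le> L"
  shows "{T \<in> reverse_row_strict_tableaux \<tau>. row_bounded \<tau> T} = bounded_reverse_tableaux L \<tau>"
  using assms by (fastforce simp: bounded_reverse_tableaux_def row_bounded_def)

text \<open>This removes the shapes \<mu> that reach too far down: their Schur functions have no
  term with all labels at most N.\<close>

lemma no_bounded_tableaux:
  assumes "s j + N < c j"
  shows "bounded_tableaux ok N (region s c) = {}"
proof (rule equals0I)
  fix T assume T: "T \<in> bounded_tableaux ok N (region s c)"
  then have ss: "T \<in> semistandard_tableaux (region s c)"
    and le: "T (c j, j) \<le> N" using assms by (auto simp: bounded_tableaux_def)
  have in_R: "(Suc (s j), j) \<in> region s c" "(c j, j) \<in> region s c" using assms by auto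
  have "T (Suc (s j), j) + (c j - Suc (s j)) \<le> T (c j, j)"
    using assms by (intro semistandard_column_growth[OF ss in_R]) auto
  moreover have "1 \<le> T (Suc (s j), j)"
    using semistandardD(1)[OF ss] in_R(1) by (auto simp: tableaux_def PiE_iff)
  ultimately show False using le assms by simp
qed

section \<open>Comparison of coefficients\<close>

theorem theorem3p4:
  fixes \<sigma> :: "box set"
  assumes "skew_shape \<sigma>" and "connected_shape \<sigma>"
    and "\<sigma> \<noteq> {}" and "Min (fst ` \<sigma>) = 1"
  shows "((\<lambda>(\<mu>, e). (-1) ^ card (below_part \<mu> \<sigma>) * of_nat (coeff_a \<sigma> \<mu> e) * schur \<mu> * w_power e)
           has_sum RG \<sigma>)
         {(\<mu>, e). skew_shape \<mu> \<and> contains_shape \<mu> \<sigma> \<and> 0 \<notin> Poly_Mapping.keys e}"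
    (is "(?F has_sum _) ?I")
proof (rule has_sum_mfpsI)
  fix m
  define p r where "p = Min (snd ` \<sigma>)" and "r = Suc (Max (snd ` \<sigma>))"
  have fin: "finite \<sigma>" using assms(1) by (simp add: skew_shape_def)
  have cols: "snd ` \<sigma> = {p..<r}"
    unfolding p_def r_def by (rule connected_shape_columns[OF assms(1-3)])
  then have "p < r" using assms(3) by force
  have "1 \<le> p"
    using cols \<open>p < r\<close> assms(1) unfolding skew_shape_def
    by (metis (mono_tags, lifting) atLeastLessThan_iff case_prodD imageE order_refl prod.collapse)
  obtain t b where tp: "t \<in> profiles p r" and bp: "b \<in> profiles p r"
    and tb': "\<forall>j\<in>{p..<r}. t j < b j" and \<sigma>: "\<sigma> = region t b"
    by (rule skew_shape_eq_region[OF assms(1) cols])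
  have tb: "t j < b j" if "j \<in> {p..<r}" for j using tb' that by blast
  obtain N where N: "x_bounded N m" using x_bounded_exists by blast
  \<comment> \<open>\<open>b p\<close> is the lowest row of \<sigma>. A shape \<mu> reaching below
    row \<open>b p + N\<close> has more than N boxes in some column, because its upper boundary is
    not below that of \<sigma>.\<close>
  define L where "L = b p + N"
  let ?S = "bounded_profiles p r L"
  interpret transfer_kernels p r "\<lambda>i. mfps_var (W i)" by unfold_locales (use \<open>p < r\<close> in simp)
  have bL: "b j + N \<le> L" for j
    using profiles_antimono[OF bp, of p j] profiles_outside[OF bp, of j] unfolding L_def
    by (cases "j \<in> {p..<r}") auto
  have le: "t j \<le> b j" for j
    using tb[of j] profiles_outside[OF tp, of j] by (cases "j \<in> {p..<r}") auto
  have tN: "t j + N \<le> L" for j using bL[of j] le[of j] by simp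
  have b: "b \<in> ?S"
    using bp bL le_trans[OF le_add1 bL] by (simp add: bounded_profiles_def)
  have t: "t \<in> ?S"
    using tp le_trans[OF le_add1 tN] by (simp add: bounded_profiles_def)
  have t_le_b: "t \<le> b" using le by (simp add: le_fun_def)
  let ?Pr = "{(s, c). s \<in> ?S \<and> c \<in> ?S \<and> s \<le> t \<and> b \<le> c}"
  let ?Ms = "(\<lambda>(s, c). region s c) ` ?Pr"
  \<comment> \<open>The finitely many indices that can matter for m: outside this set either the
    number of pairs is zero or \<mu> reaches below row L.\<close>
  let ?A = "Sigma ?Ms (\<lambda>\<mu>. {e. coeff_a \<sigma> \<mu> e \<noteq> 0})"
  have finPr: "finite ?Pr"
    by (rule finite_subset[of _ "?S \<times> ?S"]) auto
  have index: "skew_shape \<mu> \<and> contains_shape \<mu> \<sigma> \<longleftrightarrow>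
      (\<exists>s c. s \<in> profiles p r \<and> c \<in> profiles p r \<and> s \<le> t \<and> b \<le> c \<and> \<mu> = region s c)" for \<mu>
    unfolding \<sigma> by (rule contains_region[OF tp bp \<open>1 \<le> p\<close> tb])
  have parts: "above_part (region s c) \<sigma> = region s t" "below_part (region s c) \<sigma> = region b c"
    if "(s, c) \<in> ?Pr" for s c
    using parts_region[OF tp bp tb] bounded_profilesD(1)[of c] that unfolding \<sigma> by blast+
  have rows: "i \<le> L" if "c \<in> ?S" "(i, j) \<in> region s c" for s c i j
    using that bounded_profilesD(2)[OF that(1), of j] by simp
  have PA: "{T \<in> semistandard_tableaux (region s t). row_weakly_bounded (region s t) T} =
      bounded_tableaux (\<lambda>k i. k \<le> i) L (region s t)" for s
    by (rule row_weakly_bounded_eq) (rule rows[OF t])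
  have PB: "{T \<in> reverse_row_strict_tableaux (region b c). row_bounded (region b c) T} =
      bounded_reverse_tableaux L (region b c)" if "c \<in> ?S" for c
    by (rule row_bounded_eq) (rule rows[OF that])
  have fin_A: "finite {T \<in> semistandard_tableaux (above_part (region s c) \<sigma>). row_weakly_bounded (above_part (region s c) \<sigma>) T}"
    and fin_B: "finite {T \<in> reverse_row_strict_tableaux (below_part (region s c) \<sigma>). row_bounded (below_part (region s c) \<sigma>) T}"
    if "(s, c) \<in> ?Pr" for s c
  proof -
    have c: "c \<in> ?S" using that by simp
    show "finite {T \<in> semistandard_tableaux (above_part (region s c) \<sigma>). row_weakly_bounded (above_part (region s c) \<sigma>) T}"
      unfolding parts[OF that] PA by (rule finite_bounded_tableaux[OF finite_region[OF tp]])
    show "finite {T \<in> reverse_row_strict_tableaux (below_part (region s c) \<sigma>). row_bounded (below_part (region s c) \<sigma>) T}"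
      unfolding parts[OF that] PB[OF c]
      by (rule finite_bounded_reverse_tableaux[OF finite_region[OF bounded_profilesD(1)[OF c]]])
  qed
  let ?y = "\<lambda>i. mfps_var (X i)" and ?w = "\<lambda>i. mfps_var (W i)"
  let ?GA = "\<lambda>s. \<Sum>T | T \<in> semistandard_tableaux (region s t) \<and> row_weakly_bounded (region s t) T. \<Prod>x\<in>region s t. ?w (T x)"
  let ?GB = "\<lambda>c. \<Sum>T\<in>bounded_reverse_tableaux L (region b c). \<Prod>x\<in>region b c. - ?w (T x)"
  let ?s = "\<lambda>\<mu>. \<Sum>T\<in>bounded_tableaux (\<lambda>_ _. True) N \<mu>. \<Prod>x\<in>\<mu>. ?y (T x)"
  have sum_e: "(\<Sum>e | coeff_a \<sigma> (region s c) e \<noteq> 0. ?F (region s c, e)) = schur (region s c) * (?GA s * ?GB c)"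
    if sc: "(s, c) \<in> ?Pr" for s c
  proof -
    let ?\<mu> = "region s c"
    have c: "c \<in> ?S" using sc by simp
    have "(\<Sum>e | coeff_a \<sigma> ?\<mu> e \<noteq> 0. ?F (?\<mu>, e)) =
        schur ?\<mu> * ((-1) ^ card (below_part ?\<mu> \<sigma>) * (\<Sum>e | coeff_a \<sigma> ?\<mu> e \<noteq> 0. of_nat (coeff_a \<sigma> ?\<mu> e) * w_power e))"
      unfolding sum_distrib_left by (intro sum.cong refl) (simp add: mult_ac)
    also have "\<dots> = schur ?\<mu> * ((-1) ^ card (region b c) * (?GA s *
        (\<Sum>T\<in>bounded_reverse_tableaux L (region b c). \<Prod>x\<in>region b c. ?w (T x))))"
      unfolding sum_coeff_a(3)[OF fin_A[OF sc] fin_B[OF sc]] unfolding parts[OF sc] PB[OF c] ..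
    \<comment> \<open>The global sign becomes one factor -1 for each box of B.\<close>
    also have "\<dots> = schur ?\<mu> * (?GA s * ?GB c)"
      by (simp add: prod_uminus mult_ac flip: sum_distrib_left)
    finally show ?thesis .
  qed
  show "\<exists>A. finite A \<and> A \<subseteq> ?I \<and> (\<forall>i\<in>?I - A. coeff (?F i) m = 0) \<and> coeff (\<Sum>i\<in>A. ?F i) m = coeff (RG \<sigma>) m"
  proof (intro exI[of _ ?A] conjI ballI)
    have fin_e: "finite {e. coeff_a \<sigma> \<mu> e \<noteq> 0}" if "\<mu> \<in> ?Ms" for \<mu>
      using that sum_coeff_a(1)[OF fin_A fin_B] by auto
    then show "finite ?A"
      using finPr by (intro finite_SigmaI finite_imageI) auto
    show "?A \<subseteq> ?I"
    proof
      fix i assume "i \<in> ?A"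
      then obtain s c e where i: "i = (region s c, e)" "(s, c) \<in> ?Pr" "coeff_a \<sigma> (region s c) e \<noteq> 0" by auto
      have "skew_shape (region s c) \<and> contains_shape (region s c) \<sigma>"
        unfolding index using i(2) bounded_profilesD(1) by blast
      then show "i \<in> ?I"
        using sum_coeff_a(2)[OF fin_A[OF i(2)] fin_B[OF i(2)] i(3)] i(1) by simp
    qed
    show "coeff (?F i) m = 0" if "i \<in> ?I - ?A" for i
    proof -
      obtain \<mu> e where i: "i = (\<mu>, e)" by (cases i)
      have "skew_shape \<mu> \<and> contains_shape \<mu> \<sigma>" using that i by simp
      then obtain s c where sc: "s \<in> profiles p r" "c \<in> profiles p r" "s \<le> t" "b \<le> c" "\<mu> = region s c"
        unfolding index by blast
      have s: "s \<in> ?S"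
        using sc(1) le_trans[OF le_funD[OF sc(3)] bounded_profilesD(2)[OF t]] by (simp add: bounded_profiles_def)
      show ?thesis
      proof (cases "c \<in> ?S")
        case True
        then have "\<mu> \<in> ?Ms" using s sc by blast
        then have "coeff_a \<sigma> \<mu> e = 0" using that i by blast
        then show ?thesis by (simp add: i)
      next
        case False
        then obtain j where j: "\<not> c j \<le> L" using sc(2) by (auto simp: bounded_profiles_def)
        have "s j + N < c j"
          using j le_funD[OF sc(3), of j] tN[of j] by simp
        then have "bounded_tableaux (\<lambda>_ _. True) N \<mu> = {}"
          unfolding sc(5) by (rule no_bounded_tableaux)
        then have "coeff (schur \<mu>) k = coeff 0 k" if "x_bounded N k" for k
          using coeff_schur[OF _ that, of \<mu>] finite_region[OF sc(2), of s] sc(5) by simp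
        then have "coeff (schur \<mu> * ((-1) ^ card (below_part \<mu> \<sigma>) * of_nat (coeff_a \<sigma> \<mu> e) * w_power e)) m =
            coeff (0 * ((-1) ^ card (below_part \<mu> \<sigma>) * of_nat (coeff_a \<sigma> \<mu> e) * w_power e)) m"
          using N by (rule coeff_mult_cong)
        then show ?thesis by (simp add: i mult_ac)
      qed
    qed
    have inj: "inj_on (\<lambda>(s, c). region s c) ?Pr"
    proof (rule inj_onI, clarify)
      fix s c s' c'
      assume *: "s \<in> ?S" "c \<in> ?S" "s' \<in> ?S" "c' \<in> ?S" "region s c = region s' c'"
        and **: "s \<le> t" "b \<le> c" "s' \<le> t" "b \<le> c'"
      have lt: "s j < c j" "s' j < c' j" if "j \<in> {p..<r}" for j
        using tb[OF that] le_funD[OF **(1), of j] le_funD[OF **(2), of j] le_funD[OF **(3), of j] le_funD[OF **(4), of j]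
        by simp_all
      show "s = s' \<and> c = c'"
        by (rule region_eqD[OF bounded_profilesD(1)[OF *(1)] bounded_profilesD(1)[OF *(2)]
              bounded_profilesD(1)[OF *(3)] bounded_profilesD(1)[OF *(4)] lt(1) *(5) lt(2)])
    qed
    have "(\<Sum>i\<in>?A. ?F i) = (\<Sum>\<mu>\<in>?Ms. \<Sum>e | coeff_a \<sigma> \<mu> e \<noteq> 0. ?F (\<mu>, e))"
      using finPr fin_e by (subst sum.Sigma) (auto intro!: sum.cong)
    also have "\<dots> = (\<Sum>(s, c)\<in>?Pr. schur (region s c) * (?GA s * ?GB c))"
      unfolding sum.reindex[OF inj] by (rule sum.cong[OF refl]) (use sum_e in auto)
    finally have "coeff (\<Sum>i\<in>?A. ?F i) m = (\<Sum>(s, c)\<in>?Pr. coeff (schur (region s c) * (?GA s * ?GB c)) m)"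
      by (simp only: coeff_sum case_prod_unfold)
    \<comment> \<open>The exponent m cannot see labels above N, so only now, coefficient by
      coefficient, is the Schur series replaced by a finite sum.\<close>
    also have "\<dots> = (\<Sum>(s, c)\<in>?Pr. coeff (?s (region s c) * (?GA s * ?GB c)) m)"
    proof (rule sum.cong[OF refl], clarify)
      fix s c assume "c \<in> ?S"
      then have "finite (region s c)" by (intro finite_region bounded_profilesD(1))
      then show "coeff (schur (region s c) * (?GA s * ?GB c)) m = coeff (?s (region s c) * (?GA s * ?GB c)) m"
        by (intro coeff_mult_cong[OF coeff_schur N])
    qed
    also have "\<dots> = coeff (\<Sum>(s, c)\<in>?Pr. ?GA s * ?s (region s c) * ?GB c) m"
      by (simp only: coeff_sum case_prod_unfold mult_ac)
    also have "\<dots> = coeff (\<Sum>T\<in>bounded_SS N (region t b). \<Prod>x\<in>region t b. box_weight ?y x (T x)) m"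
      using sum_bounded_SS_expansion[OF t b t_le_b tN, of ?y] by (simp only:)
    also have "\<dots> = coeff (RG \<sigma>) m"
      using coeff_RG[OF fin N] unfolding \<sigma> by (simp only:)
    finally show "coeff (\<Sum>i\<in>?A. ?F i) m = coeff (RG \<sigma>) m" .
  qed
qed

end
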